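(* For any $\mu_0\in\mathcal{P}(X)$, the class $E(\mu_0)=\{\nu\in\mathcal{P}(X): J(\mu_0,\nu)<\infty\}$ endowed with the transportation topology $\tau_J$ is a Radon space; that is, it is separable and metrizable, and every Borel probability measure $Q$ on $(E(\mu_0),\tau_J)$ is tight: for every $\epsilon>0$ there is a $\tau_J$-compact set $\mathcal{D}\subset E(\mu_0)$ with $Q(E(\mu_0)\setminus\mathcal{D})<\epsilon$.
   Context: Setting. $(X,\rho)$ is a Radon space: a separable metric space such that for every Borel probability measure $\mu$ on $X$ and every $\epsilon>0$ there is a compact set $D$ with $\mu(X\setminus D)<\epsilon$. $\mathcal{P}(X)$ is the set of Borel probability measures on $X$. The cost function $c\colon X\times X\to[0,\infty)$ is continuous and consistent: for any $x\in X$ and $\{x_n\}\subset X$, $c(x,x_n)\to0$ iff $c(x_n,x)\to0$ iff $x_n\to x$. Growth assumption: there are constants $A,B\ge0$ such that for all $x,y,z\in X$ the number $c(x,y)$ is at most each of $A+B(c(x,z)+c(y,z))$, $A+B(c(x,z)+c(z,y))$, $A+B(c(z,x)+c(y,z))$, $A+B(c(z,x)+c(z,y))$. Compactness assumption: for some (and therefore any) $x_0\in X$ and all $r\ge 0$ the set $\{y\in X: c(x_0,y)\le r\}$ is compact. Transportation cost: $J(\mu,\nu)=\inf_{\gamma\in\Pi(\mu,\nu)}\int c(x,y)\,d\gamma(x,y)\in[0,\infty]$, where $\Pi(\mu,\nu)$ is the set of Borel probability measures on $X\times X$ with first marginal $\mu$ and second marginal $\nu$. The balls $\{\nu\in\mathcal{P}(X):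 J(\mu,\nu)<r\}$, $\mu\in\mathcal{P}(X)$, $r>0$, form a basis of a topology $\tau_J$ on $\mathcal{P}(X)$, called the transportation topology; $\nu_n\to\nu^*$ in $\tau_J$ is equivalent to $J(\nu_n,\nu^* )\to0$ and $J(\nu^*,\nu_n)\to0$. *)

theory Defs
  imports "HOL-Probability.Probability"
begin

definition borel_of :: "'b topology \<Rightarrow> 'b measure" where
  "borel_of T = sigma (topspace T) {U. openin T U}"

lemma borel_of_euclidean: "borel_of (euclidean :: 'a::topological_space topology) = borel"
  by (simp add: borel_of_def borel_def)

(* A compact set in a metrizable space is closed, so \<open>space Q - D\<close> below is measurable. *)
definition radon_space :: "'b topology \<Rightarrow> bool" where
  "radon_space T \<longleftrightarrow> separable_space T \<and> metrizable_space T \<and>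
    (\<forall>Q. prob_space Q \<longrightarrow> sets Q = sets (borel_of T) \<longrightarrow>
      (\<forall>\<epsilon>>0. \<exists>D. compactin T D \<and> measure Q (space Q - D) < \<epsilon>))"

definition prob_measures :: "'a::topological_space measure set" where
  "prob_measures = {\<mu>. sets \<mu> = sets borel \<and> prob_space \<mu>}"

definition couplings ::
  "'a::topological_space measure \<Rightarrow> 'a measure \<Rightarrow> ('a \<times> 'a) measure set" where
  "couplings \<mu> \<nu> = {\<gamma> \<in> prob_measures. distr \<gamma> borel fst = \<mu> \<and> distr \<gamma> borel snd = \<nu>}"

definition transport_cost ::
  "('a::topological_space \<Rightarrow> 'a \<Rightarrow> real) \<Rightarrow> 'a measure \<Rightarrow> 'a measure \<Rightarrow> ennreal" where
  "transport_cost c \<mu> \<nu> = (INF \<gamma>\<in>couplings \<mu> \<nu>. \<integral>\<^sup>+(x, y). ennreal (c x y) \<partial>\<gamma>)"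

definition transport_ball ::
  "('a::topological_space \<Rightarrow> 'a \<Rightarrow> real) \<Rightarrow> 'a measure \<Rightarrow> real \<Rightarrow> 'a measure set" where
  "transport_ball c \<mu> r = {\<nu> \<in> prob_measures. transport_cost c \<mu> \<nu> < ennreal r}"

(* The coarsest topology containing all the balls: whenever the balls form a basis of some
   topology, it is this one. *)
definition transport_topology ::
  "('a::topological_space \<Rightarrow> 'a \<Rightarrow> real) \<Rightarrow> 'a measure topology" where
  "transport_topology c =
    topology_generated_by {transport_ball c \<mu> r | \<mu> r. \<mu> \<in> prob_measures \<and> r > 0}"

definition finite_cost_class ::
  "('a::topological_space \<Rightarrow> 'a \<Rightarrow> real) \<Rightarrow> 'a measure \<Rightarrow> 'a measure set" where
  "finite_cost_class c \<mu>\<^sub>0 = {\<nu> \<in> prob_measures. transport_cost c \<mu>\<^sub>0 \<nu> < \<infinity>}"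

definition consistent_cost :: "('a::topological_space \<Rightarrow> 'a \<Rightarrow> real) \<Rightarrow> bool" where
  "consistent_cost c \<longleftrightarrow> (\<forall>x s.
    ((\<lambda>n. c x (s n)) \<longlonglongrightarrow> 0 \<longleftrightarrow> (\<lambda>n. c (s n) x) \<longlonglongrightarrow> 0) \<and>
    ((\<lambda>n. c (s n) x) \<longlonglongrightarrow> 0 \<longleftrightarrow> s \<longlonglongrightarrow> x))"

definition cost_growth :: "('a \<Rightarrow> 'a \<Rightarrow> real) \<Rightarrow> bool" where
  "cost_growth c \<longleftrightarrow> (\<exists>A\<ge>0. \<exists>B\<ge>0. \<forall>x y z.
    c x y \<le> A + B * (c x z + c y z) \<and>
    c x y \<le> A + B * (c x z + c z y) \<and>
    c x y \<le> A + B * (c z x + c y z) \<and>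
    c x y \<le> A + B * (c z x + c z y))"

end

theory Submission
  imports Defs
begin

text \<open>
  Put \<open>\<rho> x y = sup\<^sub>w \<bar>min 1 (c w x) - min 1 (c w y)\<bar>\<close>. By the compactness assumption \<open>\<rho>\<close> is a
  compatible metric, and \<open>D x y = \<rho> x y + c x y + c y x\<close> is continuous, symmetric, complete and
  satisfies \<open>D x z \<le> K * (D x y + D y z)\<close>. The transport cost \<open>W\<close> of \<open>D\<close> is finite on the same
  pairs of measures as that of \<open>c\<close> and inherits a relaxed triangle inequality, so by Frink's
  chain construction it is uniformly equivalent to a metric on the class of \<open>\<mu>\<^sub>0\<close>. This metric
  induces the transportation topology; it is separable (discretise the couplings with \<open>\<mu>\<^sub>0\<close>)
  and complete (the limit of a fast Cauchy sequence is the law of the limit of a Markov chain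
  with these marginals), and finite measures on complete separable metric spaces are tight.
  Disintegration is not needed: conditioning on the cells of a countable partition into cells of
  small \<open>D\<close>-diameter is enough.
\<close>

section \<open>Kernels and Markov chains\<close>

text \<open>The growth bound carries the additive constant \<open>A\<close>, so it says nothing at
  small scales, and consistency concerns one point at a time. Neither yields a triangle inequality
  near the diagonal or a uniform modulus. Adding \<rho> repairs this: once \<open>\<rho> x z\<close>
  reaches 1, the constants are absorbed by \<open>\<rho> x y + \<rho> y z\<close>, and below 1 the
  cost is dominated by \<rho>. Truncation at 1 confines the points \<open>w\<close> that matter to a
  bounded set, which is where compactness enters; it enters again in the completeness of
  \<open>D\<close>. Completeness and separability rest on uniform estimates and are therefore proved
  for \<open>W\<close>. The cost \<open>c\<close> returns in the comparison of neighbourhoods of a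
  fixed measure, where the moduli may depend on that measure; a penalty \<open>L * D\<close> or
  \<open>L * c\<close> replaces the missing modulus of continuity. Conditioning on cells costs a
  factor \<open>K\<close> each time, which is harmless because the triangle inequality is relaxed
  anyway and a small power of \<open>W\<close> absorbs any constant.\<close>

lemma emeasure_eq_suminf_index:
  fixes g :: "'b \<Rightarrow> nat"
  assumes [measurable]: "g \<in> N \<rightarrow>\<^sub>M count_space UNIV" "A \<in> sets N"
  shows "emeasure N A = (\<Sum>i. emeasure N (A \<inter> {y \<in> space N. g y = i}))"
proof -
  have "(\<Sum>i. emeasure N (A \<inter> {y \<in> space N. g y = i})) = emeasure N (\<Union>i. A \<inter> {y \<in> space N. g y = i})"
    by (rule suminf_emeasure) (auto simp: disjoint_family_on_def)
  also have "(\<Union>i. A \<inter> {y \<in> space N. g y = i}) = A"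
    using sets.sets_into_space[OF assms(2)] by auto
  finally show ?thesis ..
qed

lemma nn_integral_index:
  fixes g :: "'b \<Rightarrow> nat" and \<phi> :: "nat \<Rightarrow> ennreal"
  assumes [measurable]: "g \<in> N \<rightarrow>\<^sub>M count_space UNIV"
  shows "(\<integral>\<^sup>+y. \<phi> (g y) \<partial>N) = (\<Sum>i. \<phi> i * emeasure N {y \<in> space N. g y = i})"
proof -
  have "(\<integral>\<^sup>+y. \<phi> (g y) \<partial>N) = (\<integral>\<^sup>+y. (\<Sum>i. \<phi> i * indicator {y \<in> space N. g y = i} y) \<partial>N)"
  proof (rule nn_integral_cong)
    fix y assume y: "y \<in> space N"
    have "(\<Sum>i. \<phi> i * indicator {y \<in> space N. g y = i} y) = (\<Sum>i\<in>{g y}. \<phi> i * indicator {y \<in> space N. g y = i} y)"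
      by (rule suminf_finite) (auto simp: indicator_def)
    then show "\<phi> (g y) = (\<Sum>i. \<phi> i * indicator {y \<in> space N. g y = i} y)"
      using y by simp
  qed
  also have "\<dots> = (\<Sum>i. \<integral>\<^sup>+y. \<phi> i * indicator {y \<in> space N. g y = i} y \<partial>N)"
    by (rule nn_integral_suminf) auto
  also have "\<dots> = (\<Sum>i. \<phi> i * emeasure N {y \<in> space N. g y = i})"
    by (intro suminf_cong nn_integral_cmult_indicator) auto
  finally show ?thesis .
qed

text \<open>Labels with countably many values and equal laws can be matched by elementary
  conditioning: \<open>x\<close> is sent to \<open>N\<close> conditioned on the event that
  \<open>g\<close> takes the value \<open>f x\<close>. This is the only source of non-trivial
  kernels in the development.\<close>

lemma index_kernel_exists:
  fixes f :: "'a \<Rightarrow> nat" and g :: "'b \<Rightarrow> nat"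
  assumes "prob_space M" "prob_space N"
    and f[measurable]: "f \<in> M \<rightarrow>\<^sub>M count_space UNIV" and g[measurable]: "g \<in> N \<rightarrow>\<^sub>M count_space UNIV"
    and eq: "\<And>i. emeasure M {x \<in> space M. f x = i} = emeasure N {y \<in> space N. g y = i}"
  obtains \<kappa> where "\<kappa> \<in> M \<rightarrow>\<^sub>M prob_algebra N" "M \<bind> \<kappa> = N"
    "AE x in M. AE y in \<kappa> x. g y = f x"
proof -
  interpret M: prob_space M by fact
  interpret N: prob_space N by fact
  define L where "L i = {y \<in> space N. g y = i}" for i
  have L[measurable]: "L i \<in> sets N" for i unfolding L_def by measurable
  \<comment> \<open>Conditioning on a null cell is undefined; \<open>N\<close> is a placeholder that
    keeps \<open>k i\<close> a probability measure. Equality of the two laws makes the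
    \<open>x\<close> that see it a null set.\<close>
  define k where "k i = (if emeasure N (L i) = 0 then N else uniform_measure N (L i))" for i
  have k: "k i \<in> space (prob_algebra N)" for i
    by (auto simp: k_def space_prob_algebra N.prob_space_axioms intro!: prob_space_uniform_measure)
  have "k \<in> count_space UNIV \<rightarrow>\<^sub>M prob_algebra N" using k by simp
  then have meas: "(\<lambda>x. k (f x)) \<in> M \<rightarrow>\<^sub>M prob_algebra N"
    by (rule measurable_compose[OF f])
  \<comment> \<open>The multiplied form of conditional probability also covers null cells, where
    both sides vanish.\<close>
  have em: "emeasure (k i) A * emeasure N (L i) = emeasure N (A \<inter> L i)" if A: "A \<in> sets N" for i A
  proof (cases "emeasure N (L i) = 0")
    case True
    then have "emeasure N (A \<inter> L i) = 0"
      by (metis L emeasure_eq_0 inf_le2)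
    with True show ?thesis by simp
  next
    case False
    then show ?thesis using A
      by (simp add: k_def divide_mult_eq Int_commute N.emeasure_eq_measure ennreal_mult_divide_eq)
         (simp add: ennreal_divide_times ennreal_mult_divide_eq Int_commute)
  qed
  have "M \<bind> (\<lambda>x. k (f x)) = N"
  proof (rule measure_eqI)
    show "sets (M \<bind> (\<lambda>x. k (f x))) = sets N"
      using meas by (intro sets_bind) (auto simp: M.not_empty dest!: measurable_space simp: space_prob_algebra)
    fix A assume "A \<in> sets (M \<bind> (\<lambda>x. k (f x)))"
    then have A: "A \<in> sets N"
      using \<open>sets (M \<bind> (\<lambda>x. k (f x))) = sets N\<close> by simp
    have "emeasure (M \<bind> (\<lambda>x. k (f x))) A = (\<integral>\<^sup>+x. emeasure (k (f x)) A \<partial>M)"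
      by (rule emeasure_bind_prob_algebra[OF _ meas A]) (simp add: space_prob_algebra M.prob_space_axioms)
    also have "\<dots> = (\<Sum>i. emeasure (k i) A * emeasure M {x \<in> space M. f x = i})"
      by (rule nn_integral_index[OF f])
    also have "\<dots> = (\<Sum>i. emeasure N (A \<inter> L i))"
      using em[OF A] by (simp add: eq L_def)
    also have "\<dots> = emeasure N A"
      using emeasure_eq_suminf_index[OF g A] by (simp add: L_def)
    finally show "emeasure (M \<bind> (\<lambda>x. k (f x))) A = emeasure N A" .
  qed
  moreover have "AE x in M. AE y in k (f x). g y = f x"
  proof -
    have "AE x in M. \<forall>i. emeasure N (L i) = 0 \<longrightarrow> f x \<noteq> i"
    proof (subst AE_all_countable, intro allI)
      fix i
      show "AE x in M. emeasure N (L i) = 0 \<longrightarrow> f x \<noteq> i"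
      proof (cases "emeasure N (L i) = 0")
        case True
        then have "emeasure M {x \<in> space M. f x = i} = 0" by (simp add: eq L_def)
        then have "AE x in M. x \<notin> {x \<in> space M. f x = i}"
          by (intro AE_not_in) (auto simp: null_sets_def)
        with AE_space show ?thesis by eventually_elim auto
      qed simp
    qed
    moreover have "AE y in k i. g y = i" if "emeasure N (L i) \<noteq> 0" for i
    proof -
      have "AE y in uniform_measure N (L i). g y = i"
        by (rule AE_uniform_measureI[OF L]) (simp add: L_def)
      with that show ?thesis unfolding k_def by (simp only: if_False)
    qed
    ultimately show ?thesis by (auto elim!: eventually_mono)
  qed
  ultimately show ?thesis using that[OF meas] by blast
qed

text \<open>Ionescu-Tulcea with kernels that see only the last coordinate. Besides the initial law,
  the integral formula for consecutive coordinates is what is recorded: it determines the marginals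
  inductively and the expected cost of each step.\<close>

lemma markov_chain_exists:
  fixes \<kappa> :: "nat \<Rightarrow> 'a \<Rightarrow> 'a measure"
  assumes \<nu>: "\<nu> \<in> space (prob_algebra S)"
    and \<kappa>[measurable]: "\<And>n. \<kappa> n \<in> S \<rightarrow>\<^sub>M prob_algebra S"
  obtains \<Omega> :: "(nat \<Rightarrow> 'a) measure" where "prob_space \<Omega>" "\<forall>n. (\<lambda>\<omega>. \<omega> n) \<in> \<Omega> \<rightarrow>\<^sub>M S"
    "distr \<Omega> S (\<lambda>\<omega>. \<omega> 0) = \<nu>"
    "\<forall>n. \<forall>\<phi>\<in>borel_measurable (S \<Otimes>\<^sub>M S).
      (\<integral>\<^sup>+\<omega>. \<phi> (\<omega> n, \<omega> (Suc n)) \<partial>\<Omega>) = (\<integral>\<^sup>+x. (\<integral>\<^sup>+z. \<phi> (x, z) \<partial>\<kappa> n x) \<partial>distr \<Omega> S (\<lambda>\<omega>. \<omega> n))"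
proof -
  \<comment> \<open>\<open>P n\<close> takes a history on the indices below \<open>n\<close>. The
    initial law is thus the kernel for the empty history, and \<open>\<kappa> m\<close> draws
    coordinate \<open>Suc m\<close>.\<close>
  define P :: "nat \<Rightarrow> (nat \<Rightarrow> 'a) \<Rightarrow> 'a measure"
    where "P n \<omega> = (case n of 0 \<Rightarrow> \<nu> | Suc m \<Rightarrow> \<kappa> m (\<omega> m))" for n \<omega>
  have P_prob: "P n \<in> PiM {0..<n} (\<lambda>_. S) \<rightarrow>\<^sub>M prob_algebra S" for n
    by (cases n) (use \<nu> in \<open>auto simp: P_def[abs_def]\<close>)
  interpret Ionescu_Tulcea P "\<lambda>_. S"
  proof (rule Ionescu_Tulcea.intro)
    show "P i \<in> PiM {0..<i} (\<lambda>_. S) \<rightarrow>\<^sub>M subprob_algebra S" for i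
      by (rule measurable_prob_algebraD[OF P_prob])
    show "prob_space (P i x)" if "x \<in> space (PiM {0..<i} (\<lambda>_. S))" for i x
      using measurable_space[OF P_prob that] by (simp add: space_prob_algebra)
  qed
  let ?O = "PF.lim"
  have sets_O: "sets ?O = sets (PiM UNIV (\<lambda>_. S))" by simp
  have X[measurable]: "(\<lambda>\<omega>. \<omega> n) \<in> ?O \<rightarrow>\<^sub>M S" for n
    unfolding measurable_cong_sets[OF sets_O refl] by simp
  \<comment> \<open>The index set is already an initial segment, so no coordinate is projected away
    and the marginal is the iterated kernel itself.\<close>
  have CI: "CI {0..<n} = C 0 n (\<lambda>_. undefined)" for n
  proof -
    have "emeasure (CI {0..<n}) A = emeasure (C 0 n (\<lambda>_. undefined)) A" if A: "A \<in> sets (PiM {0..<n} (\<lambda>_. S))" for A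
      using emeasure_CI[of "{0..<n}" n A] A sets.sets_into_space[OF A]
      by (simp add: prod_emb_id space_PiM)
    then show ?thesis
      by (intro measure_eqI) (simp_all add: CI_def sets_C)
  qed
  have int_O: "(\<integral>\<^sup>+\<omega>. \<psi> (restrict \<omega> {0..<n}) \<partial>?O) = (\<integral>\<^sup>+\<omega>. \<psi> \<omega> \<partial>C 0 n (\<lambda>_. undefined))"
    if [measurable]: "\<psi> \<in> borel_measurable (PiM {0..<n} (\<lambda>_. S))" for \<psi> n
  proof -
    have "(\<lambda>x. restrict x {0..<n}) \<in> ?O \<rightarrow>\<^sub>M PiM {0..<n} (\<lambda>_. S)"
      unfolding measurable_cong_sets[OF sets_O refl] by (rule measurable_restrict_subset) simp
    then have "(\<integral>\<^sup>+\<omega>. \<psi> (restrict \<omega> {0..<n}) \<partial>?O) = (\<integral>\<^sup>+\<omega>. \<psi> \<omega> \<partial>distr ?O (PiM {0..<n} (\<lambda>_. S)) (\<lambda>x. restrict x {0..<n}))"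
      by (subst nn_integral_distr) auto
    also have "\<dots> = (\<integral>\<^sup>+\<omega>. \<psi> \<omega> \<partial>C 0 n (\<lambda>_. undefined))"
      by (simp add: distr_lim CI)
    finally show ?thesis .
  qed
  have prob_O: "prob_space ?O"
    using int_O[of "\<lambda>_. 1" 0] prob_space.emeasure_space_1[OF prob_space_C[of "\<lambda>_. undefined" 0 0]]
    by (intro prob_spaceI) (simp del: C.simps)
  have sC: "sets (C 0 n (\<lambda>_. undefined)) = sets (PiM {0..<n} (\<lambda>_. S))" for n
    by (simp add: sets_C)
  \<comment> \<open>The last coordinate is integrated out. The restrictions appear because the
    finite products consist of functions that are \<open>undefined\<close> off the segment, whereas
    the points of the limit space are defined everywhere.\<close>
  have int_Suc: "(\<integral>\<^sup>+\<omega>. \<psi> (restrict \<omega> {0..<Suc n}) \<partial>?O) =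
      (\<integral>\<^sup>+\<omega>. (\<integral>\<^sup>+z. \<psi> (fun_upd (restrict \<omega> {0..<n}) n z) \<partial>P n (restrict \<omega> {0..<n})) \<partial>?O)"
    if \<psi>[measurable]: "\<psi> \<in> borel_measurable (PiM {0..<Suc n} (\<lambda>_. S))" for \<psi> n
  proof -
    have m: "(\<lambda>\<omega>. (\<integral>\<^sup>+z. \<psi> (fun_upd \<omega> n z) \<partial>P n \<omega>)) \<in> borel_measurable (PiM {0..<n} (\<lambda>_. S))"
    proof (rule nn_integral_measurable_subprob_algebra2)
      show "P n \<in> PiM {0..<n} (\<lambda>_. S) \<rightarrow>\<^sub>M subprob_algebra S" by (rule P)
      show "(\<lambda>(\<omega>, z). \<psi> (fun_upd \<omega> n z)) \<in> borel_measurable (PiM {0..<n} (\<lambda>_. S) \<Otimes>\<^sub>M S)"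
        unfolding split_beta
        by (intro measurable_compose[OF _ \<psi>] measurable_fun_upd[where J="{0..<n}"]) auto
    qed
    have "(\<integral>\<^sup>+\<omega>. \<psi> (restrict \<omega> {0..<Suc n}) \<partial>?O) = (\<integral>\<^sup>+\<omega>. \<psi> \<omega> \<partial>C 0 (Suc n) (\<lambda>_. undefined))"
      by (rule int_O[OF \<psi>])
    also have "\<dots> = (\<integral>\<^sup>+\<omega>. (\<integral>\<^sup>+\<omega>'. \<psi> \<omega>' \<partial>eP n \<omega>) \<partial>C 0 n (\<lambda>_. undefined))"
      by (subst C.simps, subst nn_integral_bind[where B="PiM {0..<Suc n} (\<lambda>_. S)"]) (auto simp: measurable_cong_sets[OF sC refl] measurable_eP)
    also have "\<dots> = (\<integral>\<^sup>+\<omega>. (\<integral>\<^sup>+z. \<psi> (fun_upd \<omega> n z) \<partial>P n \<omega>) \<partial>C 0 n (\<lambda>_. undefined))"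
      by (intro nn_integral_cong nn_integral_eP) (auto simp: space_C)
    also have "\<dots> = (\<integral>\<^sup>+\<omega>. (\<integral>\<^sup>+z. \<psi> (fun_upd (restrict \<omega> {0..<n}) n z) \<partial>P n (restrict \<omega> {0..<n})) \<partial>?O)"
      by (rule int_O[OF m, symmetric])
    finally show ?thesis .
  qed
  have dist0: "distr ?O S (\<lambda>\<omega>. \<omega> 0) = \<nu>"
  proof (rule measure_eqI)
    show sets_eq: "sets (distr ?O S (\<lambda>\<omega>. \<omega> 0)) = sets \<nu>" using \<nu> by (simp add: space_prob_algebra)
    fix A assume "A \<in> sets (distr ?O S (\<lambda>\<omega>. \<omega> 0))"
    then have A[measurable]: "A \<in> sets S" by simp
    have "emeasure (distr ?O S (\<lambda>\<omega>. \<omega> 0)) A = (\<integral>\<^sup>+\<omega>. indicator A (\<omega> 0) \<partial>?O)"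
      by (subst nn_integral_indicator[symmetric], simp, subst nn_integral_distr) auto
    also have "\<dots> = (\<integral>\<^sup>+\<omega>. (\<integral>\<^sup>+z. indicator A z \<partial>\<nu>) \<partial>?O)"
      using int_Suc[of "\<lambda>\<omega>. indicator A (\<omega> 0)" 0] by (simp add: P_def)
    also have "\<dots> = emeasure \<nu> A"
      using nn_integral_indicator[of A \<nu>] A \<nu> prob_space.emeasure_space_1[OF prob_O]
      by (simp add: space_prob_algebra)
    finally show "emeasure (distr ?O S (\<lambda>\<omega>. \<omega> 0)) A = emeasure \<nu> A" .
  qed
  have step: "(\<integral>\<^sup>+\<omega>. \<phi> (\<omega> n, \<omega> (Suc n)) \<partial>?O) = (\<integral>\<^sup>+x. (\<integral>\<^sup>+z. \<phi> (x, z) \<partial>\<kappa> n x) \<partial>distr ?O S (\<lambda>\<omega>. \<omega> n))"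
    if \<phi>[measurable]: "\<phi> \<in> borel_measurable (S \<Otimes>\<^sub>M S)" for n \<phi>
  proof -
    have m: "(\<lambda>x. \<integral>\<^sup>+z. \<phi> (x, z) \<partial>\<kappa> n x) \<in> borel_measurable S"
      by (rule nn_integral_measurable_subprob_algebra2[OF _ measurable_prob_algebraD[OF \<kappa>]]) simp
    have "(\<integral>\<^sup>+\<omega>. \<phi> (\<omega> n, \<omega> (Suc n)) \<partial>?O) = (\<integral>\<^sup>+\<omega>. (\<integral>\<^sup>+z. \<phi> (\<omega> n, z) \<partial>\<kappa> n (\<omega> n)) \<partial>?O)"
      using int_Suc[of "\<lambda>\<omega>. \<phi> (\<omega> n, \<omega> (Suc n))" "Suc n"] by (simp add: P_def)
    also have "\<dots> = (\<integral>\<^sup>+x. (\<integral>\<^sup>+z. \<phi> (x, z) \<partial>\<kappa> n x) \<partial>distr ?O S (\<lambda>\<omega>. \<omega> n))"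
      by (subst nn_integral_distr) (use m in auto)
    finally show ?thesis .
  qed
  show ?thesis
    using prob_O X dist0 step by (intro that[of ?O]) simp_all
qed

section \<open>Metrization of quasi-metrics\<close>

text \<open>The induction splits a chain at the half of its total weight.\<close>

lemma chain_weight_bound:
  fixes d :: "'b \<Rightarrow> 'b \<Rightarrow> real"
  assumes nonneg: "\<And>x y. x \<in> E \<Longrightarrow> y \<in> E \<Longrightarrow> 0 \<le> d x y"
    and zero: "\<And>x. x \<in> E \<Longrightarrow> d x x = 0"
    and tri: "\<And>x y z w b. x \<in> E \<Longrightarrow> y \<in> E \<Longrightarrow> z \<in> E \<Longrightarrow> w \<in> E \<Longrightarrow>
      d x y \<le> b \<Longrightarrow> d y z \<le> b \<Longrightarrow> d z w \<le> b \<Longrightarrow> d x w \<le> 2 * b"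
  shows "(\<And>i. i \<le> n \<Longrightarrow> f i \<in> E) \<Longrightarrow> d (f 0) (f n) \<le> 2 * (\<Sum>i<n. d (f i) (f (Suc i)))"
proof (induction n arbitrary: f rule: less_induct)
  case (less n)
  define s where "s k = (\<Sum>i<k. d (f i) (f (Suc i)))" for k
  have s_Suc: "s (Suc k) = s k + d (f k) (f (Suc k))" for k by (simp add: s_def)
  have dpos: "0 \<le> d (f i) (f (Suc i))" if "i < n" for i using that less.prems by (intro nonneg) auto
  have s_mono: "s i \<le> s j" if "i \<le> j" "j \<le> n" for i j
    using that by (induction rule: dec_induct) (use dpos in \<open>auto simp: s_Suc intro: add_increasing2\<close>)
  have s0: "s 0 = 0" by (simp add: s_def)
  show ?case
  proof (cases "n = 0")
    case True
    then show ?thesis using less.prems by (simp add: zero)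
  next
    case False
    \<comment> \<open>Maximality of \<open>j\<close> leaves at most half of the weight on either
      side of the link from \<open>j\<close> to \<open>Suc j\<close>. By induction both end pieces
      have distance at most \<open>s n\<close>, and so has the link itself; hence \<open>tri\<close>
      applies with \<open>b = s n\<close>.\<close>
    define j where "j = Max {j. j < n \<and> s j \<le> s n / 2}"
    have fin: "finite {j. j < n \<and> s j \<le> s n / 2}" by simp
    have "0 \<in> {j. j < n \<and> s j \<le> s n / 2}"
      using False s_mono[of 0 n] s0 by auto
    then have j: "j < n" "s j \<le> s n / 2"
      using Max_in[OF fin] unfolding j_def by blast+
    have j': "s n - s (Suc j) \<le> s n / 2"
    proof (cases "Suc j = n")
      case True
      then show ?thesis using s_mono[of 0 n] s0 by simp
    next
      case False
      then have "\<not> s (Suc j) \<le> s n / 2"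
        using j Max_ge[OF fin, of "Suc j"] unfolding j_def[symmetric] by auto
      then show ?thesis by simp
    qed
    have E: "f 0 \<in> E" "f j \<in> E" "f (Suc j) \<in> E" "f n \<in> E" using j less.prems by auto
    have "d (f 0) (f j) \<le> 2 * s j"
      unfolding s_def using j less.prems by (intro less.IH) auto
    moreover have "d (f (Suc j)) (f n) \<le> 2 * (s n - s (Suc j))"
    proof -
      have "d (f (0 + Suc j)) (f (n - Suc j + Suc j)) \<le> 2 * (\<Sum>i<n - Suc j. d (f (i + Suc j)) (f (Suc i + Suc j)))"
        using less.IH[of "n - Suc j" "\<lambda>i. f (i + Suc j)"] j less.prems by simp
      also have "(\<Sum>i<n - Suc j. d (f (i + Suc j)) (f (Suc i + Suc j))) = (\<Sum>i\<in>{Suc j..<n}. d (f i) (f (Suc i)))"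
        by (rule sum.reindex_bij_witness[of _ "\<lambda>i. i - Suc j" "\<lambda>i. i + Suc j"]) auto
      also have "\<dots> = s n - s (Suc j)"
        unfolding s_def using j by (simp add: sum_diff_nat_ivl atLeast0LessThan[symmetric] del: sum.op_ivl_Suc)
      finally show ?thesis using j by simp
    qed
    moreover have "d (f j) (f (Suc j)) \<le> s n"
      using s_mono[of "Suc j" n] s_mono[of 0 j] j s_Suc[of j] s0 by auto
    ultimately have "d (f 0) (f n) \<le> 2 * s n"
      using j j' by (intro tri[OF E]) auto
    then show ?thesis by (simp add: s_def)
  qed
qed

text \<open>A small power \<open>q powr s\<close> satisfies the hypothesis of the chain bound above, so that the
  chain metric of \<open>q powr s\<close> lies between half of it and itself.\<close>

lemma quasi_metric_metrizable:
  fixes q :: "'b \<Rightarrow> 'b \<Rightarrow> real"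
  assumes nonneg: "\<And>x y. x \<in> E \<Longrightarrow> y \<in> E \<Longrightarrow> 0 \<le> q x y"
    and sym: "\<And>x y. x \<in> E \<Longrightarrow> y \<in> E \<Longrightarrow> q x y = q y x"
    and zero: "\<And>x y. x \<in> E \<Longrightarrow> y \<in> E \<Longrightarrow> q x y = 0 \<longleftrightarrow> x = y"
    and tri: "\<And>x y z. x \<in> E \<Longrightarrow> y \<in> E \<Longrightarrow> z \<in> E \<Longrightarrow> q x z \<le> K * (q x y + q y z)"
    and K: "1 \<le> K"
  obtains m s where "Metric_space E m" "0 < s"
    "\<forall>x\<in>E. \<forall>y\<in>E. m x y \<le> q x y powr s"
    "\<forall>x\<in>E. \<forall>y\<in>E. q x y powr s \<le> 2 * m x y"
proof -
  \<comment> \<open>Three links cost at most \<open>3 * K^2\<close> times the largest of them, and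
    this exponent turns that factor into the 2 of the chain bound. The base exceeds 1, so
    \<open>s\<close> is positive.\<close>
  define s where "s = log (3 * K^2) 2"
  have K2: "1 < 3 * K^2" using one_le_power[OF K, of 2] by linarith
  then have s: "0 < s" by (simp add: s_def)
  have K2s: "(3 * K^2) powr s = 2"
    unfolding s_def by (rule powr_log_cancel) (use K2 in linarith)+
  define d where "d x y = q x y powr s" for x y
  have d_nonneg: "0 \<le> d x y" for x y by (simp add: d_def)
  have d_zero: "d x x = 0" if "x \<in> E" for x using that zero by (simp add: d_def)
  have d_tri: "d x w \<le> 2 * b"
    if E: "x \<in> E" "y \<in> E" "z \<in> E" "w \<in> E" and b: "d x y \<le> b" "d y z \<le> b" "d z w \<le> b" for x y z w b
  proof -
    define M where "M = max (q x y) (max (q y z) (q z w))"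
    have M: "0 \<le> M" "q x y \<le> M" "q y z \<le> M" "q z w \<le> M"
      using nonneg[of x y] E by (auto simp: M_def)
    \<comment> \<open>The two inner links pass through the relaxed inequality twice. The first link
      passes through it once and is enlarged by another factor \<open>K\<close>, so that all three
      carry \<open>K^2\<close>.\<close>
    have "q x w \<le> K * (q x y + K * (q y z + q z w))"
      using tri[of x y w] tri[of y z w] E K by (smt (verit) mult_left_mono)
    also have "\<dots> \<le> K * (K * M + K * (M + M))"
    proof -
      have "q x y \<le> K * M" using M K mult_right_mono[of 1 K M] by linarith
      then show ?thesis using M K by (intro mult_left_mono add_mono) auto
    qed
    also have "\<dots> = (3 * K^2) * M" by (simp add: power2_eq_square algebra_simps)
    finally have "d x w \<le> ((3 * K^2) * M) powr s"
      unfolding d_def using s nonneg E by (intro powr_mono2) auto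
    also have "\<dots> = 2 * M powr s" using K2s M K2 by (simp add: powr_mult)
    also have "M powr s \<le> b"
      using b by (auto simp: M_def d_def max_def)
    finally show ?thesis by simp
  qed
  define S where "S x y = {\<Sum>i<n. d (f i) (f (Suc i)) | n f. f 0 = x \<and> f n = y \<and> (\<forall>i\<le>n. f i \<in> E)}" for x y :: 'b
  \<comment> \<open>There is no chain when an endpoint is outside \<open>E\<close>. The value 0
    keeps \<open>m\<close> nonnegative and symmetric there too, since \<open>Metric_space\<close>
    asks for these two properties at all points, and the infimum of the empty set of reals is
    unspecified.\<close>
  define m where "m x y = (if S x y = {} then 0 else Inf (S x y))" for x y
  have S_bdd: "bdd_below (S x y)" for x y
    by (rule bdd_belowI[of _ 0]) (auto simp: S_def intro!: sum_nonneg d_nonneg)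
  have S_single: "d x y \<in> S x y" if "x \<in> E" "y \<in> E" for x y
    using that unfolding S_def
    by (intro CollectI exI[of _ "Suc 0"] exI[of _ "\<lambda>i. if i = 0 then x else y"]) auto
  have S_ge: "d x y \<le> 2 * t" if "t \<in> S x y" for x y t
    using that chain_weight_bound[of E d, OF d_nonneg d_zero d_tri] unfolding S_def by fastforce
  have S_sym: "S x y \<subseteq> S y x" for x y
  proof
    fix t assume "t \<in> S x y"
    then obtain n f where f: "t = (\<Sum>i<n. d (f i) (f (Suc i)))" "f 0 = x" "f n = y" "\<forall>i\<le>n. f i \<in> E"
      by (auto simp: S_def)
    have "t = (\<Sum>i<n. d (f (n - Suc i)) (f (Suc (n - Suc i))))"
      unfolding f(1) by (rule sum.nat_diff_reindex[symmetric])
    also have "\<dots> = (\<Sum>i<n. d (f (n - i)) (f (n - Suc i)))"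
      using f(4) by (intro sum.cong refl) (auto simp: d_def Suc_diff_Suc sym)
    finally show "t \<in> S y x"
      unfolding S_def using f by (intro CollectI exI[of _ n] exI[of _ "\<lambda>i. f (n - i)"]) auto
  qed
  have S_append: "t + u \<in> S x z" if t: "t \<in> S x y" and u: "u \<in> S y z" for x y z t u
  proof -
    obtain n f where f: "t = (\<Sum>i<n. d (f i) (f (Suc i)))" "f 0 = x" "f n = y" "\<forall>i\<le>n. f i \<in> E"
      using t by (auto simp: S_def)
    obtain k g where g: "u = (\<Sum>i<k. d (g i) (g (Suc i)))" "g 0 = y" "g k = z" "\<forall>i\<le>k. g i \<in> E"
      using u by (auto simp: S_def)
    define h where "h i = (if i \<le> n then f i else g (i - n))" for i
    have hg: "h (n + i) = g i" for i using f g by (simp add: h_def)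
    have "(\<Sum>i<n + k. d (h i) (h (Suc i))) = (\<Sum>i<n. d (h i) (h (Suc i))) + (\<Sum>i<k. d (h (n + i)) (h (Suc (n + i))))"
      by (induction k) (simp_all add: add.assoc)
    also have "\<dots> = t + u"
      using hg[of "Suc _"] by (simp add: f g hg) (simp add: h_def)
    finally show ?thesis
      unfolding S_def using f g hg[of k]
      by (intro CollectI exI[of _ "n + k"] exI[of _ h]) (auto simp: h_def)
  qed
  have m_Inf: "m x y = Inf (S x y)" if "x \<in> E" "y \<in> E" for x y
    using S_single[OF that] by (auto simp: m_def)
  have m_le: "m x y \<le> d x y" if "x \<in> E" "y \<in> E" for x y
    using cInf_lower[OF S_single[OF that] S_bdd] S_single[OF that] by (auto simp: m_def)
  have m_ge: "d x y \<le> 2 * m x y" if "x \<in> E" "y \<in> E" for x y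
  proof -
    have "d x y / 2 \<le> m x y"
      unfolding m_Inf[OF that] using S_single[OF that] S_ge[of _ x y]
      by (intro cInf_greatest) (auto simp: field_simps)
    then show ?thesis by simp
  qed
  have "Metric_space E m"
  proof
    show "0 \<le> m x y" for x y
      unfolding m_def by (auto intro!: cInf_greatest sum_nonneg d_nonneg simp: S_def)
    show "m x y = m y x" for x y
      unfolding m_def using S_sym[of x y] S_sym[of y x] by (simp add: subset_antisym)
    show "m x y = 0 \<longleftrightarrow> x = y" if "x \<in> E" "y \<in> E" for x y
      using m_le[OF that] m_ge[OF that] d_zero[OF that(1)] zero[OF that] d_nonneg[of x y]
      by (auto simp: d_def)
    show "m x z \<le> m x y + m y z" if E: "x \<in> E" "y \<in> E" "z \<in> E" for x y z
    proof -
      have "m x z - u \<le> m x y" if u: "u \<in> S y z" for u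
        unfolding m_Inf[OF E(1,2)]
      proof (rule cInf_greatest)
        fix t assume "t \<in> S x y"
        from cInf_lower[OF S_append[OF this u] S_bdd] show "m x z - u \<le> t" by (simp add: m_Inf E)
      qed (use S_single E in auto)
      then have "m x z - m x y \<le> m y z"
        unfolding m_Inf[OF E(2,3)] by (intro cInf_greatest) (use S_single E in \<open>auto simp: algebra_simps\<close>)
      then show ?thesis by simp
    qed
  qed
  with s m_le m_ge show ?thesis
    by (intro that[of m s]) (auto simp: d_def)
qed

section \<open>Couplings\<close>

lemma prob_measures_iff: "\<mu> \<in> prob_measures \<longleftrightarrow> \<mu> \<in> space (prob_algebra borel)"
  by (auto simp: prob_measures_def space_prob_algebra)

lemma prob_measuresD:
  assumes "\<mu> \<in> prob_measures"
  shows "prob_space \<mu>" "sets \<mu> = sets borel" "space \<mu> = UNIV"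
  using assms sets_eq_imp_space_eq[of \<mu> borel] by (auto simp: prob_measures_def)

lemma couplingsD:
  assumes "\<gamma> \<in> couplings \<mu> \<nu>"
  shows "prob_space \<gamma>" "sets \<gamma> = sets borel" "space \<gamma> = UNIV"
    "distr \<gamma> borel fst = \<mu>" "distr \<gamma> borel snd = \<nu>"
  using assms prob_measuresD[of \<gamma>] by (auto simp: couplings_def)

text \<open>Couplings are Borel measures for the product topology; second countability identifies
  their sets with the product sigma-algebra, in which measurability can be checked by
  coordinates.\<close>

lemma sets_coupling:
  fixes \<mu> \<nu> :: "'a::second_countable_topology measure"
  assumes "\<gamma> \<in> couplings \<mu> \<nu>"
  shows "sets \<gamma> = sets (borel \<Otimes>\<^sub>M borel)"
  unfolding borel_prod by (rule couplingsD(2)[OF assms])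

lemma measurable_fst_borel[measurable]:
    "fst \<in> (borel :: ('a::second_countable_topology \<times> 'b::second_countable_topology) measure) \<rightarrow>\<^sub>M borel"
  and measurable_snd_borel[measurable]:
    "snd \<in> (borel :: ('a::second_countable_topology \<times> 'b::second_countable_topology) measure) \<rightarrow>\<^sub>M borel"
  unfolding borel_prod[symmetric] by measurable

lemma couplings_prob_measures:
  fixes \<mu> \<nu> :: "'a::second_countable_topology measure"
  assumes "\<gamma> \<in> couplings \<mu> \<nu>"
  shows "\<mu> \<in> prob_measures" "\<nu> \<in> prob_measures"
proof -
  interpret prob_space \<gamma> using assms by (rule couplingsD)
  have "fst \<in> \<gamma> \<rightarrow>\<^sub>M borel" "snd \<in> \<gamma> \<rightarrow>\<^sub>M borel"
    unfolding measurable_cong_sets[OF sets_coupling[OF assms] refl] by measurable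
  then show "\<mu> \<in> prob_measures" "\<nu> \<in> prob_measures"
    using couplingsD(4,5)[OF assms] prob_space_distr by (auto simp: prob_measures_def)
qed

lemma nn_integral_coupling:
  fixes \<mu> \<nu> :: "'a::second_countable_topology measure"
  assumes \<gamma>: "\<gamma> \<in> couplings \<mu> \<nu>" and [measurable]: "f \<in> borel_measurable borel"
  shows "(\<integral>\<^sup>+p. f (fst p) \<partial>\<gamma>) = (\<integral>\<^sup>+x. f x \<partial>\<mu>)" "(\<integral>\<^sup>+p. f (snd p) \<partial>\<gamma>) = (\<integral>\<^sup>+x. f x \<partial>\<nu>)"
proof -
  note [measurable_cong] = sets_coupling[OF \<gamma>]
  show "(\<integral>\<^sup>+p. f (fst p) \<partial>\<gamma>) = (\<integral>\<^sup>+x. f x \<partial>\<mu>)"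
    unfolding couplingsD(4)[OF \<gamma>, symmetric] by (subst nn_integral_distr) auto
  show "(\<integral>\<^sup>+p. f (snd p) \<partial>\<gamma>) = (\<integral>\<^sup>+x. f x \<partial>\<nu>)"
    unfolding couplingsD(5)[OF \<gamma>, symmetric] by (subst nn_integral_distr) auto
qed

lemma distr_in_couplings:
  fixes X Y :: "'b \<Rightarrow> 'a::second_countable_topology"
  assumes "prob_space M" and [measurable]: "X \<in> borel_measurable M" "Y \<in> borel_measurable M"
  shows "distr M borel (\<lambda>\<omega>. (X \<omega>, Y \<omega>)) \<in> couplings (distr M borel X) (distr M borel Y)"
proof -
  interpret prob_space M by fact
  have [measurable]: "(\<lambda>\<omega>. (X \<omega>, Y \<omega>)) \<in> borel_measurable M" by measurable
  show ?thesis
    by (auto simp: couplings_def prob_measures_def distr_distr comp_def intro!: prob_space_distr)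
qed

lemma transport_cost_le:
  assumes "\<gamma> \<in> couplings \<mu> \<nu>"
  shows "transport_cost c \<mu> \<nu> \<le> (\<integral>\<^sup>+p. ennreal (c (fst p) (snd p)) \<partial>\<gamma>)"
  unfolding transport_cost_def using assms by (intro INF_lower2) (auto simp: case_prod_unfold)

lemma transport_cost_lessE:
  assumes "transport_cost c \<mu> \<nu> < r"
  obtains \<gamma> where "\<gamma> \<in> couplings \<mu> \<nu>" "(\<integral>\<^sup>+p. ennreal (c (fst p) (snd p)) \<partial>\<gamma>) < r"
  using assms unfolding transport_cost_def INF_less_iff by (auto simp: case_prod_unfold)

text \<open>The coupling is the law of \<open>(X \<omega>, Y z)\<close> when \<omega> is drawn from
  \<open>M\<close> and then \<open>z\<close> from \<open>\<kappa> \<omega>\<close>. General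
  \<open>M\<close>, \<open>N\<close>, \<open>X\<close>, \<open>Y\<close> make it serve both for
  gluing, where \<open>M\<close> is itself a coupling, and for couplings enlarged by an auxiliary
  coin.\<close>

lemma coupling_of_kernel:
  fixes X :: "'b \<Rightarrow> 'a::second_countable_topology" and Y :: "'c \<Rightarrow> 'a"
  assumes "prob_space M" and \<kappa>[measurable]: "\<kappa> \<in> M \<rightarrow>\<^sub>M prob_algebra N"
    and X[measurable]: "X \<in> borel_measurable M" and Y[measurable]: "Y \<in> borel_measurable N"
  shows "\<exists>\<Gamma>\<in>couplings (distr M borel X) (distr (M \<bind> \<kappa>) borel Y). \<forall>\<phi>\<in>borel_measurable (borel \<Otimes>\<^sub>M borel).
      (\<integral>\<^sup>+p. \<phi> p \<partial>\<Gamma>) = (\<integral>\<^sup>+\<omega>. (\<integral>\<^sup>+z. \<phi> (X \<omega>, Y z) \<partial>\<kappa> \<omega>) \<partial>M)"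
proof -
  interpret prob_space M by fact
  have M_alg: "M \<in> space (prob_algebra M)" by (simp add: space_prob_algebra prob_space_axioms)
  have s\<kappa>: "sets (\<kappa> \<omega>) = sets N" and p\<kappa>: "emeasure (\<kappa> \<omega>) (space (\<kappa> \<omega>)) = 1" if "\<omega> \<in> space M" for \<omega>
    using measurable_space[OF \<kappa> that] by (auto simp: space_prob_algebra prob_space.emeasure_space_1)
  define k :: "'b \<Rightarrow> ('a \<times> 'a) measure"
    where "k \<omega> = distr (\<kappa> \<omega>) (borel \<Otimes>\<^sub>M borel) (\<lambda>z. (X \<omega>, Y z))" for \<omega>
  have k[measurable]: "k \<in> M \<rightarrow>\<^sub>M prob_algebra (borel \<Otimes>\<^sub>M borel)"
    unfolding k_def[abs_def] by measurable
  let ?G = "M \<bind> k"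
  have sG[measurable_cong]: "sets ?G = sets (borel \<Otimes>\<^sub>M borel)" by (rule sets_bind'[OF M_alg k])
  have int: "(\<integral>\<^sup>+p. \<phi> p \<partial>?G) = (\<integral>\<^sup>+\<omega>. (\<integral>\<^sup>+z. \<phi> (X \<omega>, Y z) \<partial>\<kappa> \<omega>) \<partial>M)"
    if [measurable]: "\<phi> \<in> borel_measurable (borel \<Otimes>\<^sub>M borel)" for \<phi>
  proof -
    have "(\<integral>\<^sup>+p. \<phi> p \<partial>?G) = (\<integral>\<^sup>+\<omega>. (\<integral>\<^sup>+q. \<phi> q \<partial>k \<omega>) \<partial>M)"
      by (rule nn_integral_bind[OF _ measurable_prob_algebraD[OF k]]) simp
    also have "\<dots> = (\<integral>\<^sup>+\<omega>. (\<integral>\<^sup>+z. \<phi> (X \<omega>, Y z) \<partial>\<kappa> \<omega>) \<partial>M)"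
    proof (rule nn_integral_cong)
      fix \<omega> assume "\<omega> \<in> space M"
      note [measurable_cong] = s\<kappa>[OF this]
      show "(\<integral>\<^sup>+q. \<phi> q \<partial>k \<omega>) = (\<integral>\<^sup>+z. \<phi> (X \<omega>, Y z) \<partial>\<kappa> \<omega>)"
        unfolding k_def by (subst nn_integral_distr) auto
    qed
    finally show ?thesis .
  qed
  have "distr ?G borel fst = distr M borel X"
  proof (rule measure_eqI)
    fix A assume "A \<in> sets (distr ?G borel fst)"
    then have A[measurable]: "A \<in> sets borel" by simp
    have "emeasure (distr ?G borel fst) A = (\<integral>\<^sup>+p. indicator A (fst p) \<partial>?G)"
      by (subst nn_integral_indicator[symmetric], simp, subst nn_integral_distr) auto
    also have "\<dots> = (\<integral>\<^sup>+\<omega>. indicator A (X \<omega>) \<partial>M)"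
      by (subst int) (auto intro!: nn_integral_cong simp: p\<kappa>)
    also have "\<dots> = emeasure (distr M borel X) A"
      by (subst nn_integral_indicator[symmetric], simp, subst nn_integral_distr) auto
    finally show "emeasure (distr ?G borel fst) A = emeasure (distr M borel X) A" .
  qed simp
  moreover have "distr ?G borel snd = distr (M \<bind> \<kappa>) borel Y"
  proof (rule measure_eqI)
    note [measurable_cong] = sets_bind'[OF M_alg \<kappa>]
    fix A assume "A \<in> sets (distr ?G borel snd)"
    then have A[measurable]: "A \<in> sets borel" by simp
    have "emeasure (distr ?G borel snd) A = (\<integral>\<^sup>+p. indicator A (snd p) \<partial>?G)"
      by (subst nn_integral_indicator[symmetric], simp, subst nn_integral_distr) auto
    also have "\<dots> = (\<integral>\<^sup>+\<omega>. (\<integral>\<^sup>+z. indicator A (Y z) \<partial>\<kappa> \<omega>) \<partial>M)"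
      by (subst int) auto
    also have "\<dots> = (\<integral>\<^sup>+z. indicator A (Y z) \<partial>(M \<bind> \<kappa>))"
      by (rule nn_integral_bind[OF _ measurable_prob_algebraD[OF \<kappa>], symmetric]) measurable
    also have "\<dots> = emeasure (distr (M \<bind> \<kappa>) borel Y) A"
      by (subst nn_integral_indicator[symmetric], simp, subst nn_integral_distr) auto
    finally show "emeasure (distr ?G borel snd) A = emeasure (distr (M \<bind> \<kappa>) borel Y) A" .
  qed simp
  moreover have "prob_space ?G" by (rule prob_space_bind'[OF M_alg k])
  ultimately have "?G \<in> couplings (distr M borel X) (distr (M \<bind> \<kappa>) borel Y)"
    using sG[unfolded borel_prod] by (simp add: couplings_def prob_measures_def)
  then show ?thesis by (rule rev_bexI) (simp add: int)
qed

text \<open>The gluing lemma in kernel form: a pair \<open>(x, y)\<close> drawn from \<gamma>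
  becomes \<open>(x, z)\<close> with \<open>z\<close> drawn from \<open>\<kappa> y\<close>. Since
  the second transport is given as a kernel, gluing is mere composition.\<close>

lemma coupling_compose_kernel:
  fixes \<mu> \<nu> :: "'a::second_countable_topology measure"
  assumes \<gamma>: "\<gamma> \<in> couplings \<mu> \<nu>" and \<kappa>[measurable]: "\<kappa> \<in> borel \<rightarrow>\<^sub>M prob_algebra borel"
  shows "\<exists>\<Gamma>\<in>couplings \<mu> (\<nu> \<bind> \<kappa>). \<forall>\<phi>\<in>borel_measurable (borel \<Otimes>\<^sub>M borel).
      (\<integral>\<^sup>+p. \<phi> p \<partial>\<Gamma>) = (\<integral>\<^sup>+p. (\<integral>\<^sup>+z. \<phi> (fst p, z) \<partial>\<kappa> (snd p)) \<partial>\<gamma>)"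
proof -
  note [measurable_cong] = sets_coupling[OF \<gamma>]
  have \<nu>: "\<nu> \<in> space (prob_algebra borel)"
    using couplings_prob_measures(2)[OF \<gamma>] by (simp add: prob_measures_iff)
  have "\<gamma> \<bind> (\<lambda>p. \<kappa> (snd p)) = distr \<gamma> borel snd \<bind> \<kappa>"
    using couplingsD(3)[OF \<gamma>]
    by (intro bind_distr[symmetric, where X=borel and K=borel] measurable_prob_algebraD) auto
  also have "\<dots> = \<nu> \<bind> \<kappa>" by (simp add: couplingsD(5)[OF \<gamma>])
  finally have eq: "\<gamma> \<bind> (\<lambda>p. \<kappa> (snd p)) = \<nu> \<bind> \<kappa>" .
  have id: "distr (\<nu> \<bind> \<kappa>) borel (\<lambda>z. z) = \<nu> \<bind> \<kappa>"
    by (rule distr_id2) (simp add: sets_bind'[OF \<nu> \<kappa>])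
  have "\<exists>\<Gamma>\<in>couplings (distr \<gamma> borel fst) (distr (\<gamma> \<bind> (\<lambda>p. \<kappa> (snd p))) borel (\<lambda>z. z)).
    \<forall>\<phi>\<in>borel_measurable (borel \<Otimes>\<^sub>M borel).
      (\<integral>\<^sup>+p. \<phi> p \<partial>\<Gamma>) = (\<integral>\<^sup>+p. (\<integral>\<^sup>+z. \<phi> (fst p, z) \<partial>\<kappa> (snd p)) \<partial>\<gamma>)"
    by (rule coupling_of_kernel[OF couplingsD(1)[OF \<gamma>], where N=borel]) measurable
  then show ?thesis unfolding eq id couplingsD(4)[OF \<gamma>] .
qed

section \<open>Transport costs of quasi-metrics\<close>

text \<open>The metric of the type only provides the topology and need not be complete.
  \<open>D_cont\<close> and \<open>D_conv\<close> tie \<open>D\<close> to this topology, and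
  \<open>D_complete\<close> concerns sequences that are Cauchy for \<open>D\<close>.\<close>

locale quasi_cost =
  fixes D :: "'a::{metric_space, second_countable_topology} \<Rightarrow> 'a \<Rightarrow> real" and K :: real
  assumes D_nonneg: "0 \<le> D x y"
    and D_refl: "D x x = 0"
    and D_sym: "D x y = D y x"
    and D_tri: "D x z \<le> K * (D x y + D y z)"
    and K_ge_1: "1 \<le> K"
    and D_cont: "continuous_on UNIV (\<lambda>(x, y). D x y)"
    and D_conv: "(\<lambda>n. D x (s n)) \<longlonglongrightarrow> 0 \<Longrightarrow> s \<longlonglongrightarrow> x"
    and D_complete: "(\<And>e. e > 0 \<Longrightarrow> \<exists>N. \<forall>m\<ge>N. \<forall>n\<ge>N. D (s m) (s n) < e) \<Longrightarrow> convergent s"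
begin

abbreviation W :: "'a measure \<Rightarrow> 'a measure \<Rightarrow> ennreal" where
  "W \<equiv> transport_cost D"

lemma measurable_D[measurable (raw)]:
  "f \<in> borel_measurable M \<Longrightarrow> g \<in> borel_measurable M \<Longrightarrow> (\<lambda>x. D (f x) (g x)) \<in> borel_measurable M"
  using borel_measurable_continuous_Pair[of f M g D] D_cont by (simp add: case_prod_unfold)

lemma tendsto_D: "f \<longlonglongrightarrow> x \<Longrightarrow> g \<longlonglongrightarrow> y \<Longrightarrow> (\<lambda>n. D (f n) (g n)) \<longlonglongrightarrow> D x y"
  using continuous_on_tendsto_compose[OF D_cont, of "\<lambda>n. (f n, g n)" "(x, y)" sequentially]
  by (auto intro: tendsto_Pair)

lemma ennreal_tri: "ennreal (D x z) \<le> ennreal K * (ennreal (D x y) + ennreal (D y z))"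
proof -
  have "ennreal (D x z) \<le> ennreal (K * (D x y + D y z))" by (rule ennreal_leI[OF D_tri])
  also have "\<dots> = ennreal K * (ennreal (D x y) + ennreal (D y z))"
    using K_ge_1 D_nonneg by (simp add: ennreal_mult ennreal_plus)
  finally show ?thesis .
qed

text \<open>A point is labelled by the first member of a countable dense sequence within \<delta> of
  it. Points with a common label have distance at most \<open>K * (\<delta> + \<delta>)\<close>,
  hence \<delta> is \<open>\<epsilon> / (2 * K)\<close>. Taking the least index makes the label
  measurable.\<close>

lemma fine_index_exists:
  assumes "0 < \<epsilon>"
  obtains k :: "'a \<Rightarrow> nat" where "k \<in> borel \<rightarrow>\<^sub>M count_space UNIV" "\<And>x y. k x = k y \<Longrightarrow> D x y \<le> \<epsilon>"
proof -
  obtain Z :: "'a set" where Z: "countable Z" "\<And>U. open U \<Longrightarrow> U \<noteq> {} \<Longrightarrow> \<exists>z\<in>Z. z \<in> U"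
    by (rule countable_dense_setE) blast
  have "Z \<noteq> {}" using Z(2)[of UNIV] by auto
  define \<delta> where "\<delta> = \<epsilon> / (2 * K)"
  have \<delta>: "0 < \<delta>" using assms K_ge_1 by (simp add: \<delta>_def)
  define z where "z = from_nat_into Z"
  have ex: "\<exists>n. D (z n) x < \<delta>" for x
  proof -
    have "continuous_on UNIV (\<lambda>y. D y x)"
      by (rule continuous_on_compose2[OF D_cont, of UNIV "\<lambda>y. (y, x)", simplified]) (intro continuous_intros)
    then have "open {y. D y x < \<delta>}"
      by (intro open_Collect_less) (auto intro: continuous_intros)
    moreover have "x \<in> {y. D y x < \<delta>}" using \<delta> D_refl by simp
    ultimately obtain y where "y \<in> Z" "D y x < \<delta>" using Z(2) by blast
    then show ?thesis
      using from_nat_into_surj[OF Z(1), of y] unfolding z_def by metis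
  qed
  define k where "k x = (LEAST n. D (z n) x < \<delta>)" for x
  have k: "D (z (k x)) x < \<delta>" for x unfolding k_def using ex by (rule LeastI_ex)
  show ?thesis
  proof (rule that)
    show "k \<in> borel \<rightarrow>\<^sub>M count_space UNIV" unfolding k_def by measurable
    fix x y assume "k x = k y"
    then have "D x y \<le> K * (\<delta> + \<delta>)"
      using D_tri[of x y "z (k x)"] k[of x] k[of y] K_ge_1 D_sym[of x "z (k x)"]
      by (intro order_trans[OF D_tri[of x y "z (k x)"]] mult_left_mono add_mono) auto
    then show "D x y \<le> \<epsilon>" using K_ge_1 by (simp add: \<delta>_def)
  qed
qed

text \<open>Conditioning \<open>\<gamma>\<close> on small cells replaces the disintegration of \<open>\<gamma>\<close> over \<open>\<mu>\<close>.\<close>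

lemma kernel_coupling:
  assumes \<gamma>: "\<gamma> \<in> couplings \<mu> \<nu>" and \<epsilon>: "0 < \<epsilon>"
  obtains \<kappa> where "\<kappa> \<in> borel \<rightarrow>\<^sub>M prob_algebra borel" "\<mu> \<bind> \<kappa> = \<nu>"
    "(\<integral>\<^sup>+x. (\<integral>\<^sup>+z. D x z \<partial>\<kappa> x) \<partial>\<mu>) \<le> ennreal K * (ennreal \<epsilon> + (\<integral>\<^sup>+p. D (fst p) (snd p) \<partial>\<gamma>))"
proof -
  note s\<gamma>[measurable_cong] = sets_coupling[OF \<gamma>]
  have \<mu>P: "\<mu> \<in> prob_measures" and \<nu>P: "\<nu> \<in> prob_measures" using couplings_prob_measures[OF \<gamma>] .
  note s\<mu>[measurable_cong] = prob_measuresD(2)[OF \<mu>P]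
  obtain k :: "'a \<Rightarrow> nat" where k[measurable]: "k \<in> borel \<rightarrow>\<^sub>M count_space UNIV"
    and kD: "\<And>x y. k x = k y \<Longrightarrow> D x y \<le> \<epsilon>" using fine_index_exists[OF \<epsilon>] by blast
  have k\<mu>: "k \<in> \<mu> \<rightarrow>\<^sub>M count_space UNIV" and k\<gamma>: "(\<lambda>p. k (fst p)) \<in> \<gamma> \<rightarrow>\<^sub>M count_space UNIV" by measurable
  have "emeasure \<mu> {x \<in> space \<mu>. k x = i} = emeasure \<gamma> {p \<in> space \<gamma>. k (fst p) = i}" for i
    unfolding couplingsD(4)[OF \<gamma>, symmetric]
    by (subst emeasure_distr) (auto intro!: arg_cong2[where f=emeasure])
  \<comment> \<open>The target is the coupling itself, labelled by the cell of its first component: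
    from \<open>x\<close> a whole pair is drawn whose first component lies in the cell of
    \<open>x\<close>.\<close>
  from index_kernel_exists[OF prob_measuresD(1)[OF \<mu>P] couplingsD(1)[OF \<gamma>] k\<mu> k\<gamma> this]
  obtain \<kappa> where \<kappa>: "\<kappa> \<in> \<mu> \<rightarrow>\<^sub>M prob_algebra \<gamma>" "\<mu> \<bind> \<kappa> = \<gamma>"
    and ae: "AE x in \<mu>. AE p in \<kappa> x. k (fst p) = k x" .
  have "prob_algebra \<gamma> = prob_algebra (borel \<Otimes>\<^sub>M borel)"
    by (simp add: prob_algebra_def subprob_algebra_cong[OF s\<gamma>])
  then have \<kappa>'[measurable]: "\<kappa> \<in> borel \<rightarrow>\<^sub>M prob_algebra (borel \<Otimes>\<^sub>M borel)"
    using \<kappa>(1) by (simp add: measurable_cong_sets[OF s\<mu> refl])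
  have s\<kappa>[measurable_cong]: "sets (\<kappa> x) = sets (borel \<Otimes>\<^sub>M borel)" and p\<kappa>: "prob_space (\<kappa> x)" for x
    using measurable_space[OF \<kappa>', of x] by (auto simp: space_prob_algebra)
  \<comment> \<open>Only the second component of the drawn pair is kept. Its distance from
    \<open>x\<close> is estimated through the first component, which is within \<epsilon> of
    \<open>x\<close>; this detour is the source of the factor \<open>K\<close>.\<close>
  define \<kappa>2 where "\<kappa>2 x = distr (\<kappa> x) borel snd" for x
  show ?thesis
  proof (rule that)
    show "\<kappa>2 \<in> borel \<rightarrow>\<^sub>M prob_algebra borel"
      unfolding \<kappa>2_def[abs_def] by (rule measurable_compose[OF \<kappa>' measurable_distr_prob_space]) simp
    have "\<mu> \<bind> \<kappa>2 = distr (\<mu> \<bind> \<kappa>) borel snd"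
      unfolding \<kappa>2_def[abs_def] using prob_measuresD(3)[OF \<mu>P]
      by (intro distr_bind[symmetric, where K="borel \<Otimes>\<^sub>M borel"] measurable_prob_algebraD) auto
    then show "\<mu> \<bind> \<kappa>2 = \<nu>" using \<kappa>(2) couplingsD(5)[OF \<gamma>] by simp
    have "(\<integral>\<^sup>+x. (\<integral>\<^sup>+z. D x z \<partial>\<kappa>2 x) \<partial>\<mu>) = (\<integral>\<^sup>+x. (\<integral>\<^sup>+p. D x (snd p) \<partial>\<kappa> x) \<partial>\<mu>)"
      unfolding \<kappa>2_def by (intro nn_integral_cong, subst nn_integral_distr) auto
    also have "\<dots> \<le> (\<integral>\<^sup>+x. (\<integral>\<^sup>+p. ennreal K * (ennreal \<epsilon> + D (fst p) (snd p)) \<partial>\<kappa> x) \<partial>\<mu>)"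
    proof (rule nn_integral_mono_AE, use ae in eventually_elim)
      case (elim x)
      show ?case
      proof (rule nn_integral_mono_AE, use elim in eventually_elim)
        case (elim p)
        have "ennreal (D x (fst p)) \<le> ennreal \<epsilon>" using kD[of x "fst p"] elim by (intro ennreal_leI) simp
        then show ?case
          by (intro order_trans[OF ennreal_tri[of x "snd p" "fst p"]] mult_left_mono add_mono) auto
      qed
    qed
    also have "\<dots> = (\<integral>\<^sup>+p. ennreal K * (ennreal \<epsilon> + D (fst p) (snd p)) \<partial>\<gamma>)"
      unfolding \<kappa>(2)[symmetric]
      by (rule nn_integral_bind[symmetric, where B="borel \<Otimes>\<^sub>M borel"]) (auto intro!: measurable_prob_algebraD)
    also have "\<dots> = ennreal K * (ennreal \<epsilon> + (\<integral>\<^sup>+p. D (fst p) (snd p) \<partial>\<gamma>))"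
      using prob_space.emeasure_space_1[OF couplingsD(1)[OF \<gamma>]]
      by (simp add: nn_integral_cmult nn_integral_add)
    finally show "(\<integral>\<^sup>+x. (\<integral>\<^sup>+z. D x z \<partial>\<kappa>2 x) \<partial>\<mu>) \<le> \<dots>" .
  qed
qed

text \<open>A coupling of cost \<open>r\<close> strictly below \<delta> leaves the margin
  \<open>\<delta> - r\<close>, which is spent on the diameter of the cells. The factor
  \<open>K\<close> of the conditioning remains.\<close>

lemma cheap_kernel:
  assumes "W \<mu> \<nu> < ennreal \<delta>"
  obtains \<kappa> where "\<kappa> \<in> borel \<rightarrow>\<^sub>M prob_algebra borel" "\<mu> \<bind> \<kappa> = \<nu>"
    "(\<integral>\<^sup>+x. (\<integral>\<^sup>+z. D x z \<partial>\<kappa> x) \<partial>\<mu>) \<le> ennreal (K * \<delta>)"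
proof -
  obtain \<gamma> where \<gamma>: "\<gamma> \<in> couplings \<mu> \<nu>" and less: "(\<integral>\<^sup>+p. ennreal (D (fst p) (snd p)) \<partial>\<gamma>) < ennreal \<delta>"
    using transport_cost_lessE[OF assms] .
  then obtain r where r: "0 \<le> r" "(\<integral>\<^sup>+p. ennreal (D (fst p) (snd p)) \<partial>\<gamma>) = ennreal r"
    by (cases "\<integral>\<^sup>+p. ennreal (D (fst p) (snd p)) \<partial>\<gamma>") auto
  with less have "r < \<delta>" by (simp add: ennreal_less_iff)
  then have "0 < \<delta> - r" by simp
  from kernel_coupling[OF \<gamma> this] obtain \<kappa> where
    "\<kappa> \<in> borel \<rightarrow>\<^sub>M prob_algebra borel" "\<mu> \<bind> \<kappa> = \<nu>"
    and le: "(\<integral>\<^sup>+x. (\<integral>\<^sup>+z. D x z \<partial>\<kappa> x) \<partial>\<mu>) \<le> ennreal K * (ennreal (\<delta> - r) + ennreal r)"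
    unfolding r(2) .
  moreover have "ennreal K * (ennreal (\<delta> - r) + ennreal r) = ennreal (K * \<delta>)"
    using r \<open>r < \<delta>\<close> K_ge_1 by (simp add: ennreal_plus[symmetric] ennreal_mult del: ennreal_plus)
  ultimately show ?thesis by (intro that) auto
qed

section \<open>Relaxed metric axioms for the transport cost \<open>W\<close>\<close>

lemma W_refl:
  assumes "\<mu> \<in> prob_measures"
  shows "W \<mu> \<mu> = 0"
proof -
  note [measurable_cong] = prob_measuresD(2)[OF assms]
  have [simp]: "distr \<mu> borel (\<lambda>x. x) = \<mu>" by (rule distr_id2) (simp add: prob_measuresD[OF assms])
  have "distr \<mu> borel (\<lambda>x. (x, x)) \<in> couplings \<mu> \<mu>"
    using distr_in_couplings[OF prob_measuresD(1)[OF assms], of "\<lambda>x. x" "\<lambda>x. x"] by simp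
  from transport_cost_le[OF this, of D] show ?thesis
    by (subst (asm) nn_integral_distr) (auto simp: D_refl)
qed

lemma W_sym_le: "W \<mu> \<nu> \<le> W \<nu> \<mu>"
proof -
  have "W \<mu> \<nu> \<le> (\<integral>\<^sup>+p. ennreal (D (fst p) (snd p)) \<partial>\<gamma>)" if \<gamma>: "\<gamma> \<in> couplings \<nu> \<mu>" for \<gamma>
  proof -
    note [measurable_cong] = sets_coupling[OF \<gamma>]
    have "distr \<gamma> borel (\<lambda>p. (snd p, fst p)) \<in> couplings \<mu> \<nu>"
      using distr_in_couplings[OF couplingsD(1)[OF \<gamma>], of snd fst] couplingsD(4,5)[OF \<gamma>] by simp
    from transport_cost_le[OF this, of D] show ?thesis
      by (subst (asm) nn_integral_distr) (auto simp: D_sym)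
  qed
  then show ?thesis
    unfolding transport_cost_def[of D \<nu> \<mu>] by (auto intro!: INF_greatest simp: case_prod_unfold)
qed

lemma W_sym: "W \<mu> \<nu> = W \<nu> \<mu>"
  by (intro antisym W_sym_le)

text \<open>A nearly optimal coupling of \<mu> and \<nu> is glued to a cheap kernel from \<nu> to
  \<xi>. One factor \<open>K\<close> comes from the inequality for \<open>D\<close>, the other from
  replacing the second coupling by a kernel.\<close>

lemma W_tri: "W \<mu> \<xi> \<le> ennreal (K^2) * (W \<mu> \<nu> + W \<nu> \<xi>)"
proof (cases "W \<mu> \<nu> + W \<nu> \<xi> = \<infinity>")
  case True
  show ?thesis unfolding True using K_ge_1 by (simp add: ennreal_mult_top)
next
  case False
  then obtain a b where a: "0 \<le> a" "W \<mu> \<nu> = ennreal a" and b: "0 \<le> b" "W \<nu> \<xi> = ennreal b"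
    by (cases "W \<mu> \<nu>"; cases "W \<nu> \<xi>") auto
  have step: "W \<mu> \<xi> \<le> ennreal (K^2 * (a + b)) + ennreal e" if e: "0 < e" for e
  proof -
    \<comment> \<open>Both costs are exceeded by \<delta>, and each excess is later multiplied by
      \<open>K^2\<close>; together they amount to \<open>e\<close>.\<close>
    define \<delta> where "\<delta> = e / (2 * K^2)"
    have \<delta>: "0 < \<delta>" using e K_ge_1 by (simp add: \<delta>_def)
    have "W \<mu> \<nu> < ennreal (a + \<delta>)" "W \<nu> \<xi> < ennreal (b + \<delta>)"
      using a b \<delta> by (auto simp: ennreal_less_iff)
    note less = this
    obtain \<gamma> where \<gamma>: "\<gamma> \<in> couplings \<mu> \<nu>"
      and c\<gamma>: "(\<integral>\<^sup>+p. ennreal (D (fst p) (snd p)) \<partial>\<gamma>) < ennreal (a + \<delta>)"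
      by (rule transport_cost_lessE[OF less(1)])
    obtain \<kappa> where \<kappa>[measurable]: "\<kappa> \<in> borel \<rightarrow>\<^sub>M prob_algebra borel" and \<kappa>2: "\<nu> \<bind> \<kappa> = \<xi>"
      and c\<kappa>: "(\<integral>\<^sup>+x. (\<integral>\<^sup>+z. D x z \<partial>\<kappa> x) \<partial>\<nu>) \<le> ennreal (K * (b + \<delta>))"
      by (rule cheap_kernel[OF less(2)])
    note [measurable_cong] = sets_coupling[OF \<gamma>]
    note \<kappa>_sub[measurable] = measurable_prob_algebraD[OF \<kappa>]
    have s\<kappa>[measurable_cong]: "sets (\<kappa> x) = sets borel" and p\<kappa>: "emeasure (\<kappa> x) (space (\<kappa> x)) = 1" for x
      using measurable_space[OF \<kappa>, of x] by (auto simp: space_prob_algebra prob_space.emeasure_space_1)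
    have m: "(\<lambda>x. \<integral>\<^sup>+z. D x z \<partial>\<kappa> x) \<in> borel_measurable borel"
      by (rule nn_integral_measurable_subprob_algebra2[OF _ \<kappa>_sub]) simp
    obtain \<Gamma> where \<Gamma>: "\<Gamma> \<in> couplings \<mu> \<xi>" and int: "\<forall>\<phi>\<in>borel_measurable (borel \<Otimes>\<^sub>M borel).
      (\<integral>\<^sup>+p. \<phi> p \<partial>\<Gamma>) = (\<integral>\<^sup>+p. (\<integral>\<^sup>+z. \<phi> (fst p, z) \<partial>\<kappa> (snd p)) \<partial>\<gamma>)"
      by (rule bexE[OF coupling_compose_kernel[OF \<gamma> \<kappa>, unfolded \<kappa>2]])
    have "W \<mu> \<xi> \<le> (\<integral>\<^sup>+p. ennreal (D (fst p) (snd p)) \<partial>\<Gamma>)" by (rule transport_cost_le[OF \<Gamma>])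
    also have "\<dots> = (\<integral>\<^sup>+p. (\<integral>\<^sup>+z. D (fst p) z \<partial>\<kappa> (snd p)) \<partial>\<gamma>)"
      using bspec[OF int, of "\<lambda>p. ennreal (D (fst p) (snd p))"] by simp
    also have "\<dots> \<le> (\<integral>\<^sup>+p. (\<integral>\<^sup>+z. ennreal K * (ennreal (D (fst p) (snd p)) + D (snd p) z) \<partial>\<kappa> (snd p)) \<partial>\<gamma>)"
      by (intro nn_integral_mono ennreal_tri)
    also have "\<dots> = (\<integral>\<^sup>+p. ennreal K * (ennreal (D (fst p) (snd p)) + (\<integral>\<^sup>+z. D (snd p) z \<partial>\<kappa> (snd p))) \<partial>\<gamma>)"
      by (intro nn_integral_cong) (simp add: nn_integral_cmult nn_integral_add p\<kappa>)
    also have "\<dots> = ennreal K * ((\<integral>\<^sup>+p. ennreal (D (fst p) (snd p)) \<partial>\<gamma>) + (\<integral>\<^sup>+p. (\<integral>\<^sup>+z. D (snd p) z \<partial>\<kappa> (snd p)) \<partial>\<gamma>))"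
      using m by (simp add: nn_integral_cmult nn_integral_add)
    also have "\<dots> \<le> ennreal K * (ennreal (K * (a + \<delta>)) + ennreal (K * (b + \<delta>)))"
    proof (intro mult_left_mono add_mono)
      \<comment> \<open>The first leg comes from a coupling and carries no second factor
        \<open>K\<close>; it is enlarged to match the other leg.\<close>
      have "a + \<delta> \<le> K * (a + \<delta>)" using K_ge_1 a \<delta> by simp
      then show "(\<integral>\<^sup>+p. ennreal (D (fst p) (snd p)) \<partial>\<gamma>) \<le> ennreal (K * (a + \<delta>))"
        using c\<gamma> by (meson ennreal_leI less_imp_le order_trans)
      show "(\<integral>\<^sup>+p. (\<integral>\<^sup>+z. D (snd p) z \<partial>\<kappa> (snd p)) \<partial>\<gamma>) \<le> ennreal (K * (b + \<delta>))"
        unfolding nn_integral_coupling(2)[OF \<gamma> m] by (rule c\<kappa>)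
    qed auto
    also have "\<dots> = ennreal (K^2 * (a + b) + e)"
      using a b K_ge_1 \<delta> e by (simp add: ennreal_plus[symmetric] ennreal_mult[symmetric] del: ennreal_plus)
        (simp add: \<delta>_def field_simps power2_eq_square)
    also have "\<dots> = ennreal (K^2 * (a + b)) + ennreal e"
      using a b e by (simp add: ennreal_plus)
    finally show ?thesis .
  qed
  have "W \<mu> \<xi> \<le> ennreal (K^2 * (a + b))"
    by (rule ennreal_le_epsilon) (rule step)
  also have "\<dots> = ennreal (K^2) * (W \<mu> \<nu> + W \<nu> \<xi>)"
    unfolding a(2) b(2) using a(1) b(1) by (simp add: ennreal_mult)
  finally show ?thesis .
qed

end

text \<open>Take \<open>h w = sup\<^sub>z (f w z - L * g w z)\<close>: it is lower semicontinuous, hence measurable,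
  and decreases to \<open>u\<close> as \<open>L\<close> tends to infinity.\<close>

lemma penalized_majorant:
  fixes f g :: "'w::topological_space \<Rightarrow> 'z::topological_space \<Rightarrow> real" and a u :: "'w \<Rightarrow> real"
  assumes M: "sets M = sets borel"
    and contf: "\<And>z. continuous_on UNIV (\<lambda>w. f w z)" and contg: "\<And>z. continuous_on UNIV (\<lambda>w. g w z)"
    and g0: "\<And>w z. 0 \<le> g w z" and u: "\<And>w. 0 \<le> u w"
    and le: "\<And>w z. f w z \<le> a w + b * g w z"
    and a: "(\<integral>\<^sup>+w. ennreal (a w) \<partial>M) < \<infinity>"
    and lim: "\<And>w s. (\<lambda>n. g w (s n)) \<longlonglongrightarrow> 0 \<Longrightarrow> (\<lambda>n. f w (s n)) \<longlonglongrightarrow> u w"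
    and less: "(\<integral>\<^sup>+w. ennreal (u w) \<partial>M) < r"
  obtains h L where "h \<in> borel_measurable borel" "0 \<le> L"
    "\<And>w z. ennreal (f w z) \<le> h w + ennreal (L * g w z)" "(\<integral>\<^sup>+w. h w \<partial>M) < r"
proof -
  note [measurable_cong] = M
  define h where "h n w = (SUP z. ennreal (f w z - real n * g w z))" for n w
  have h_meas: "h n \<in> borel_measurable borel" for n
  proof (rule borel_measurableI_greater)
    fix y
    have "open {w. y < ennreal (f w z - real n * g w z)}" for z
    proof (rule open_Collect_less)
      show "continuous_on UNIV (\<lambda>w. ennreal (f w z - real n * g w z))"
        by (intro continuous_on_ennreal continuous_on_diff continuous_on_mult continuous_on_const contf contg)
    qed (rule continuous_on_const)
    then have "open (\<Union>z. {w. y < ennreal (f w z - real n * g w z)})" by (intro open_UN ballI)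
    also have "(\<Union>z. {w. y < ennreal (f w z - real n * g w z)}) = {w. y < h n w}"
      by (auto simp: h_def less_SUP_iff)
    finally have "open {w. y < h n w}" .
    then show "{x \<in> space borel. y < h n x} \<in> sets borel" by (simp add: borel_open)
  qed
  have h_ge: "ennreal (f w z) \<le> h n w + ennreal (real n * g w z)" for n w z
  proof -
    have "ennreal (f w z) \<le> ennreal (f w z - real n * g w z) + ennreal (real n * g w z)"
      using g0[of w z] by (cases "0 \<le> f w z - real n * g w z") (auto simp: ennreal_plus[symmetric] ennreal_neg intro: ennreal_leI simp del: ennreal_plus)
    also have "\<dots> \<le> h n w + ennreal (real n * g w z)"
      unfolding h_def by (intro add_right_mono SUP_upper) simp
    finally show ?thesis .
  qed
  have dec: "h m w \<le> h n w" if "n \<le> m" for m n w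
    unfolding h_def using that g0 by (intro SUP_mono' ennreal_leI) (auto intro!: mult_right_mono)
  \<comment> \<open>From penalty \<open>N\<close> on, the growth term \<open>b * g\<close> is
    absorbed, so that \<open>h\<close> is dominated by \<open>a\<close>. The integrals are finite
    from there, which starts monotone convergence downwards.\<close>
  obtain N where N: "b \<le> real N" using real_arch_simple by blast
  have h_le: "h (n + N) w \<le> ennreal (a w)" for n w
    unfolding h_def
  proof (intro SUP_least ennreal_leI)
    fix z
    have "b * g w z \<le> real (n + N) * g w z" using N g0 by (intro mult_right_mono) auto
    then show "f w z - real (n + N) * g w z \<le> a w" using le[of w z] by simp
  qed
  have INF_le: "(INF n. h (n + N) w) \<le> ennreal (u w)" for w
  proof (rule ccontr)
    assume "\<not> ?thesis"
    then obtain y where y: "ennreal (u w) < y" "y < (INF n. h (n + N) w)"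
      using dense by (auto simp: not_le)
    then have "y < \<top>" by (auto intro: less_le_trans)
    then obtain t where t: "y = ennreal t" "0 \<le> t" by (cases y) auto
    have "u w < t" using y(1) u[of w] t by (simp add: ennreal_less_iff)
    have "\<exists>z. t < f w z - real (n + N) * g w z" for n
    proof -
      have "y < h (n + N) w" using y(2) by (rule less_le_trans) (rule INF_lower, simp)
      then obtain z where "ennreal t < ennreal (f w z - real (n + N) * g w z)"
        unfolding h_def less_SUP_iff t by auto
      then show ?thesis using t(2) by (metis ennreal_less_iff)
    qed
    \<comment> \<open>Near-maximizers \<open>s n\<close> under penalty \<open>n + N\<close>. The
      \<open>N\<close> units of penalty pay for the growth, and the other \<open>n\<close> units
      force \<open>g w (s n)\<close> below \<open>a w / n\<close>. Hence \<open>lim\<close> drives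
      \<open>f w (s n)\<close> to \<open>u w\<close>, although these values stay above
      \<open>t\<close>.\<close>
    then obtain s where s: "\<And>n. t < f w (s n) - real (n + N) * g w (s n)" by metis
    have bound: "real n * g w (s n) \<le> a w" for n
    proof -
      have "b * g w (s n) \<le> real N * g w (s n)" using N g0 by (intro mult_right_mono) auto
      then show ?thesis using s[of n] le[of w "s n"] t(2) by (simp add: algebra_simps)
    qed
    have "(\<lambda>n. g w (s n)) \<longlonglongrightarrow> 0"
    proof (rule tendsto_sandwich[OF _ _ tendsto_const lim_const_over_n[of "a w"]])
      show "\<forall>\<^sub>F n in sequentially. g w (s n) \<le> a w / real n"
        using bound by (intro eventually_sequentiallyI[of 1]) (simp add: field_simps)
    qed (simp add: g0)
    from lim[OF this] have "(\<lambda>n. f w (s n)) \<longlonglongrightarrow> u w" .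
    moreover have "t \<le> f w (s n)" for n
      using s[of n] mult_nonneg_nonneg[OF of_nat_0_le_iff[of "n + N"] g0[of w "s n"]] by linarith
    ultimately have "t \<le> u w" by (intro LIMSEQ_le_const) auto
    with \<open>u w < t\<close> show False by simp
  qed
  have "(INF n. \<integral>\<^sup>+w. h (n + N) w \<partial>M) = (\<integral>\<^sup>+w. (INF n. h (n + N) w) \<partial>M)"
  proof (rule nn_integral_monotone_convergence_INF_decseq[symmetric, where i=0])
    show "decseq (\<lambda>n. h (n + N))" by (intro antimonoI le_funI dec) simp
    show "h (n + N) \<in> borel_measurable M" for n using h_meas by measurable
    have "(\<integral>\<^sup>+w. h (0 + N) w \<partial>M) \<le> (\<integral>\<^sup>+w. ennreal (a w) \<partial>M)" by (intro nn_integral_mono h_le)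
    then show "(\<integral>\<^sup>+w. h (0 + N) w \<partial>M) < \<infinity>" using a by simp
  qed
  also have "\<dots> \<le> (\<integral>\<^sup>+w. ennreal (u w) \<partial>M)" by (intro nn_integral_mono INF_le)
  also note less
  finally obtain n where "(\<integral>\<^sup>+w. h (n + N) w \<partial>M) < r" by (auto simp: INF_less_iff)
  from that[OF h_meas of_nat_0_le_iff h_ge this] show ?thesis .
qed

section \<open>Separation: measures at transport cost zero coincide\<close>

context quasi_cost
begin

lemma continuous_on_D[continuous_intros]:
  "continuous_on S f \<Longrightarrow> continuous_on S g \<Longrightarrow> continuous_on S (\<lambda>w. D (f w) (g w))"
  using continuous_on_compose2[OF D_cont, of S "\<lambda>w. (f w, g w)"] by (auto intro: continuous_intros)

text \<open>A coupling of small cost moves the mass of \<open>F\<close> into the neighbourhood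
  \<open>U \<delta>\<close>, up to the mass that travels at least \<delta>. The latter is small by
  Markov's inequality, and the neighbourhoods shrink to \<open>F\<close> because \<open>F\<close> is
  closed and \<open>D_conv\<close> holds.\<close>

lemma W_zero_le_closed:
  assumes W: "W \<mu> \<nu> = 0" and \<mu>\<nu>: "\<mu> \<in> prob_measures" "\<nu> \<in> prob_measures" and F: "closed F"
  shows "emeasure \<mu> F \<le> emeasure \<nu> F"
proof -
  define U where "U \<delta> = {y. \<exists>x\<in>F. D x y < \<delta>}" for \<delta>
  have U: "open (U \<delta>)" for \<delta>
  proof -
    have "U \<delta> = (\<Union>x\<in>F. {y. D x y < \<delta>})" by (auto simp: U_def)
    moreover have "open {y. D x y < \<delta>}" for x by (intro open_Collect_less continuous_intros)
    ultimately show ?thesis by auto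
  qed
  have le: "emeasure \<mu> F \<le> emeasure \<nu> (U \<delta>)" if \<delta>: "0 < \<delta>" for \<delta>
  proof (rule ennreal_le_epsilon)
    fix e :: real assume e: "0 < e"
    \<comment> \<open>Markov's inequality divides the cost by \<delta>, so the bound
      \<open>e * \<delta>\<close> leaves the error \<open>e\<close>.\<close>
    have "W \<mu> \<nu> < ennreal (e * \<delta>)" using W e \<delta> by (simp add: ennreal_zero_less_mult_iff)
    then obtain \<gamma> where \<gamma>: "\<gamma> \<in> couplings \<mu> \<nu>" and less: "(\<integral>\<^sup>+p. ennreal (D (fst p) (snd p)) \<partial>\<gamma>) < ennreal (e * \<delta>)"
      by (rule transport_cost_lessE)
    note [measurable_cong] = sets_coupling[OF \<gamma>]
    have [measurable]: "F \<in> sets borel" "U \<delta> \<in> sets borel" using F U by auto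
    have "emeasure \<mu> F = (\<integral>\<^sup>+x. indicator F x \<partial>\<mu>)"
      using F prob_measuresD(2)[OF \<mu>\<nu>(1)] by (simp add: borel_closed)
    also have "\<dots> = (\<integral>\<^sup>+p. indicator F (fst p) \<partial>\<gamma>)"
      by (rule nn_integral_coupling(1)[OF \<gamma>, symmetric]) measurable
    also have "\<dots> \<le> (\<integral>\<^sup>+p. indicator (U \<delta>) (snd p) + ennreal (1 / \<delta>) * ennreal (D (fst p) (snd p)) \<partial>\<gamma>)"
    proof (rule nn_integral_mono)
      fix p
      show "indicator F (fst p) \<le> indicator (U \<delta>) (snd p) + ennreal (1 / \<delta>) * ennreal (D (fst p) (snd p))"
      proof (cases "fst p \<in> F \<and> snd p \<notin> U \<delta>")
        case True
        then have "1 \<le> 1 / \<delta> * D (fst p) (snd p)" using \<delta> by (auto simp: U_def not_less field_simps)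
        then have "1 \<le> ennreal (1 / \<delta> * D (fst p) (snd p))" by (simp only: ennreal_ge_1)
        also have "\<dots> = ennreal (1 / \<delta>) * ennreal (D (fst p) (snd p))"
          by (rule ennreal_mult) (use \<delta> D_nonneg in auto)
        finally show ?thesis using True by simp
      qed (auto simp: indicator_def)
    qed
    also have "\<dots> = (\<integral>\<^sup>+p. indicator (U \<delta>) (snd p) \<partial>\<gamma>) + ennreal (1 / \<delta>) * (\<integral>\<^sup>+p. ennreal (D (fst p) (snd p)) \<partial>\<gamma>)"
      by (simp add: nn_integral_add nn_integral_cmult)
    also have "(\<integral>\<^sup>+p. indicator (U \<delta>) (snd p) \<partial>\<gamma>) = (\<integral>\<^sup>+x. indicator (U \<delta>) x \<partial>\<nu>)"
      by (rule nn_integral_coupling(2)[OF \<gamma>]) measurable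
    also have "(\<integral>\<^sup>+x. indicator (U \<delta>) x \<partial>\<nu>) = emeasure \<nu> (U \<delta>)"
      using U prob_measuresD(2)[OF \<mu>\<nu>(2)] by (simp add: borel_open)
    also have "ennreal (1 / \<delta>) * (\<integral>\<^sup>+p. ennreal (D (fst p) (snd p)) \<partial>\<gamma>) \<le> ennreal (1 / \<delta>) * ennreal (e * \<delta>)"
      using less by (intro mult_left_mono) auto
    also have "ennreal (1 / \<delta>) * ennreal (e * \<delta>) = ennreal e"
      using \<delta> e by (simp add: ennreal_mult[symmetric])
    finally show "emeasure \<mu> F \<le> emeasure \<nu> (U \<delta>) + ennreal e" by simp
  qed
  have Int: "(\<Inter>n. U (1 / real (Suc n))) = F"
  proof safe
    fix y assume "y \<in> F"
    then show "y \<in> U (1 / real (Suc n))" for n using D_refl[of y] by (auto simp: U_def intro!: bexI[of _ y])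
  next
    fix y assume "y \<in> (\<Inter>n. U (1 / real (Suc n)))"
    then have "\<forall>n. \<exists>x\<in>F. D x y < 1 / real (Suc n)" by (auto simp: U_def)
    then obtain s where s: "\<And>n. s n \<in> F" "\<And>n. D (s n) y < 1 / real (Suc n)" by metis
    have "(\<lambda>n. D y (s n)) \<longlonglongrightarrow> 0"
    proof (rule tendsto_sandwich[OF _ _ tendsto_const LIMSEQ_inverse_real_of_nat])
      show "\<forall>\<^sub>F n in sequentially. D y (s n) \<le> inverse (real (Suc n))"
        using s(2) by (auto simp: D_sym[of y] inverse_eq_divide intro!: always_eventually less_imp_le)
    qed (simp add: D_nonneg)
    then have "s \<longlonglongrightarrow> y" by (rule D_conv)
    with s(1) F show "y \<in> F" by (auto intro: closed_sequentially)
  qed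
  have "emeasure \<mu> F \<le> (INF n. emeasure \<nu> (U (1 / real (Suc n))))"
    by (intro INF_greatest le) simp
  also have "\<dots> = emeasure \<nu> (\<Inter>n. U (1 / real (Suc n)))"
  proof (rule INF_emeasure_decseq)
    show "range (\<lambda>n. U (1 / real (Suc n))) \<subseteq> sets \<nu>"
      using U prob_measuresD(2)[OF \<mu>\<nu>(2)] by auto
    have "U a \<subseteq> U b" if "a \<le> b" for a b using that by (force simp: U_def)
    then show "decseq (\<lambda>n. U (1 / real (Suc n)))"
      by (auto simp: decseq_def field_simps intro!: \<open>\<And>a b. a \<le> b \<Longrightarrow> U a \<subseteq> U b\<close>[THEN subsetD, rotated])
    interpret prob_space \<nu> using \<mu>\<nu>(2) by (rule prob_measuresD)
    show "emeasure \<nu> (U (1 / real (Suc i))) \<noteq> \<infinity>" for i by simp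
  qed
  finally show ?thesis unfolding Int .
qed

text \<open>By symmetry of \<open>W\<close> the inequality on closed sets holds in both directions,
  and the closed sets form an intersection-stable generator of the Borel sets.\<close>

lemma W_eq_0_iff:
  assumes \<mu>\<nu>: "\<mu> \<in> prob_measures" "\<nu> \<in> prob_measures"
  shows "W \<mu> \<nu> = 0 \<longleftrightarrow> \<mu> = \<nu>"
proof
  interpret prob_space \<mu> using \<mu>\<nu>(1) by (rule prob_measuresD)
  assume W: "W \<mu> \<nu> = 0"
  then have W': "W \<nu> \<mu> = 0" using W_sym[of \<mu> \<nu>] by simp
  have "emeasure \<mu> F = emeasure \<nu> F" if "closed F" for F
    using W_zero_le_closed[OF W \<mu>\<nu> that] W_zero_le_closed[OF W' \<mu>\<nu>(2,1) that] by (rule antisym)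
  moreover have "sets (borel :: 'a measure) = sigma_sets UNIV {F. closed F}"
    unfolding borel_eq_closed by (rule sets_measure_of) simp
  ultimately show "\<mu> = \<nu>"
    using prob_measuresD[OF \<mu>\<nu>(1)] prob_measuresD[OF \<mu>\<nu>(2)] emeasure_space_1
    by (intro measure_eqI_generator_eq[where E="{F. closed F}" and \<Omega>=UNIV and A="\<lambda>_. UNIV"])
      (auto simp: Int_stable_def)
qed (use W_refl[OF \<mu>\<nu>(1)] in simp)

section \<open>Completeness: limits of fast Cauchy sequences of measures\<close>

lemma D_chain: "D (s n) (s (n + k)) \<le> (\<Sum>i<k. K ^ Suc i * D (s (n + i)) (s (Suc (n + i))))"
proof (induction k arbitrary: n)
  case (Suc k)
  have "D (s n) (s (n + Suc k)) \<le> K * (D (s n) (s (Suc n)) + D (s (Suc n)) (s (Suc n + k)))"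
    using D_tri[of "s n" "s (n + Suc k)" "s (Suc n)"] by simp
  also have "\<dots> \<le> K * (D (s n) (s (Suc n)) + (\<Sum>i<k. K ^ Suc i * D (s (Suc n + i)) (s (Suc (Suc n + i)))))"
    using K_ge_1 Suc.IH[of "Suc n"] by (intro mult_left_mono add_left_mono) auto
  also have "\<dots> = (\<Sum>i<Suc k. K ^ Suc i * D (s (n + i)) (s (Suc (n + i))))"
    by (subst sum.lessThan_Suc_shift) (simp add: sum_distrib_left distrib_left mult.assoc)
  finally show ?case .
qed (simp add: D_refl)

text \<open>Peeling off one link at a time multiplies the rest by \<open>K\<close>, which explains
  the geometric weights. Their summability makes \<open>s\<close> Cauchy for \<open>D\<close>, and
  continuity of \<open>D\<close> carries the bound on finite stretches over to the limit.\<close>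

lemma D_limit_bound:
  assumes "summable (\<lambda>j. K ^ Suc j * D (s j) (s (Suc j)))"
  shows "convergent s" "D (s n) (lim s) \<le> (\<Sum>j. K ^ Suc (j + n) * D (s (j + n)) (s (Suc (j + n))))"
proof -
  define u where "u j = K ^ Suc j * D (s j) (s (Suc j))" for j
  have u: "summable u" "\<And>j. 0 \<le> u j" using assms K_ge_1 D_nonneg by (simp_all add: u_def[abs_def])
  define T where "T n = (\<Sum>j. u (j + n))" for n
  have D_le: "D (s n) (s m) \<le> T n" if "n \<le> m" for n m
  proof -
    obtain k where k: "m = n + k" using le_Suc_ex[OF \<open>n \<le> m\<close>] by blast
    have "D (s n) (s m) \<le> (\<Sum>i<k. K ^ Suc i * D (s (n + i)) (s (Suc (n + i))))"
      unfolding k by (rule D_chain)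
    \<comment> \<open>The weights are raised from \<open>K ^ Suc i\<close> to
      \<open>K ^ Suc (i + n)\<close>, so that the bounds for all \<open>n\<close> are tails of one
      and the same series.\<close>
    also have "\<dots> \<le> (\<Sum>i<k. u (i + n))"
      unfolding u_def
    proof (intro sum_mono)
      fix i
      have "K ^ Suc i \<le> K ^ Suc (i + n)" using K_ge_1 by (intro power_increasing) auto
      then show "K ^ Suc i * D (s (n + i)) (s (Suc (n + i))) \<le> K ^ Suc (i + n) * D (s (i + n)) (s (Suc (i + n)))"
        using D_nonneg by (subst (1 2) add.commute[of n i]) (intro mult_right_mono)
    qed
    also have "\<dots> \<le> T n"
      unfolding T_def using u by (intro sum_le_suminf) (auto simp: summable_iff_shift)
    finally show ?thesis .
  qed
  show conv: "convergent s"
  proof (rule D_complete)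
    fix e :: real assume e: "0 < e"
    then obtain N where "\<forall>n\<ge>N. norm (\<Sum>i. u (i + n)) < e"
      using suminf_exist_split[OF e u(1)] by blast
    then have N: "T n < e" if "n \<ge> N" for n using that by (auto simp: T_def)
    show "\<exists>N. \<forall>m\<ge>N. \<forall>n\<ge>N. D (s m) (s n) < e"
    proof (intro exI[of _ N] allI impI)
      fix m n assume "N \<le> m" "N \<le> n"
      then show "D (s m) (s n) < e"
        using D_le[of m n] D_le[of n m] N[of m] N[of n] D_sym[of "s m" "s n"] by (cases m n rule: le_cases) auto
    qed
  qed
  have "(\<lambda>m. D (s n) (s m)) \<longlonglongrightarrow> D (s n) (lim s)"
    using conv by (intro tendsto_D tendsto_const) (simp add: convergent_LIMSEQ_iff)
  then have "D (s n) (lim s) \<le> T n"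
    using D_le by (intro LIMSEQ_le_const2) auto
  then show "D (s n) (lim s) \<le> (\<Sum>j. K ^ Suc (j + n) * D (s (j + n)) (s (Suc (j + n))))"
    by (simp add: T_def u_def)
qed

text \<open>A Markov chain with these marginals and cheap steps converges almost surely, and the law
  of its limit is the required measure. The rate is chosen for the weights: step \<open>j\<close>
  has expected cost at most \<open>K * (1 / (2 * K)) ^ j\<close>, which the weight
  \<open>K ^ Suc j\<close> turns into \<open>K^2 * (1 / 2) ^ j\<close>; the tail from
  \<open>n\<close> on sums to \<open>2 * K^2 * (1 / 2) ^ n\<close>.\<close>

lemma W_fast_Cauchy_limit:
  assumes \<nu>: "\<And>n. \<nu> n \<in> prob_measures"
    and fast: "\<And>n. W (\<nu> n) (\<nu> (Suc n)) < ennreal ((1 / (2 * K)) ^ n)"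
  obtains \<xi> where "\<xi> \<in> prob_measures" "\<And>n. W (\<nu> n) \<xi> \<le> ennreal (2 * K^2 * (1 / 2) ^ n)"
proof -
  have "\<exists>\<kappa>. \<kappa> \<in> borel \<rightarrow>\<^sub>M prob_algebra borel \<and> \<nu> n \<bind> \<kappa> = \<nu> (Suc n) \<and>
    (\<integral>\<^sup>+x. (\<integral>\<^sup>+z. D x z \<partial>\<kappa> x) \<partial>\<nu> n) \<le> ennreal (K * (1 / (2 * K)) ^ n)" for n
    using cheap_kernel[OF fast[of n]] by blast
  then obtain \<kappa> where \<kappa>: "\<And>n. \<kappa> n \<in> borel \<rightarrow>\<^sub>M prob_algebra borel" "\<And>n. \<nu> n \<bind> \<kappa> n = \<nu> (Suc n)"
    and cost: "\<And>n. (\<integral>\<^sup>+x. (\<integral>\<^sup>+z. D x z \<partial>\<kappa> n x) \<partial>\<nu> n) \<le> ennreal (K * (1 / (2 * K)) ^ n)"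
    by metis
  have \<nu>_alg: "\<nu> n \<in> space (prob_algebra borel)" for n using \<nu> by (simp add: prob_measures_iff)
  obtain \<Omega> :: "(nat \<Rightarrow> 'a) measure" where "prob_space \<Omega>"
    and coord: "\<forall>n. (\<lambda>\<omega>. \<omega> n) \<in> \<Omega> \<rightarrow>\<^sub>M borel" and X0: "distr \<Omega> borel (\<lambda>\<omega>. \<omega> 0) = \<nu> 0"
    and markov: "\<forall>n. \<forall>\<phi>\<in>borel_measurable (borel \<Otimes>\<^sub>M borel).
      (\<integral>\<^sup>+\<omega>. \<phi> (\<omega> n, \<omega> (Suc n)) \<partial>\<Omega>) = (\<integral>\<^sup>+x. (\<integral>\<^sup>+z. \<phi> (x, z) \<partial>\<kappa> n x) \<partial>distr \<Omega> borel (\<lambda>\<omega>. \<omega> n))"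
    using markov_chain_exists[where \<kappa> = \<kappa>, OF \<nu>_alg[of 0] \<kappa>(1)] .
  have X[measurable]: "(\<lambda>\<omega>. \<omega> n) \<in> \<Omega> \<rightarrow>\<^sub>M borel" for n
    using coord by simp
  note step = bspec[OF spec[OF markov]]
  interpret prob_space \<Omega> by fact
  have s\<kappa>: "sets (\<kappa> n x) = sets borel" for n x
    using measurable_space[OF \<kappa>(1), of x] by (auto simp: space_prob_algebra)
  have law: "distr \<Omega> borel (\<lambda>\<omega>. \<omega> n) = \<nu> n" for n
  proof (induction n)
    case (Suc n)
    show ?case
    proof (rule measure_eqI)
      show "sets (distr \<Omega> borel (\<lambda>\<omega>. \<omega> (Suc n))) = sets (\<nu> (Suc n))"
        using prob_measuresD(2)[OF \<nu>] by simp
      fix A assume "A \<in> sets (distr \<Omega> borel (\<lambda>\<omega>. \<omega> (Suc n)))"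
      then have A[measurable]: "A \<in> sets borel" by simp
      have "emeasure (distr \<Omega> borel (\<lambda>\<omega>. \<omega> (Suc n))) A = (\<integral>\<^sup>+\<omega>. indicator A (\<omega> (Suc n)) \<partial>\<Omega>)"
        by (subst nn_integral_indicator[symmetric], simp, subst nn_integral_distr) auto
      also have "\<dots> = (\<integral>\<^sup>+x. (\<integral>\<^sup>+z. indicator A z \<partial>\<kappa> n x) \<partial>\<nu> n)"
        using step[of "\<lambda>p. indicator A (snd p)" n] Suc.IH by simp
      also have "\<dots> = (\<integral>\<^sup>+x. emeasure (\<kappa> n x) A \<partial>\<nu> n)"
        using A s\<kappa> by (intro nn_integral_cong nn_integral_indicator) auto
      also have "\<dots> = emeasure (\<nu> (Suc n)) A"
        using emeasure_bind_prob_algebra[OF \<nu>_alg[of n] \<kappa>(1)[of n] A] by (simp add: \<kappa>(2))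
      finally show "emeasure (distr \<Omega> borel (\<lambda>\<omega>. \<omega> (Suc n))) A = emeasure (\<nu> (Suc n)) A" .
    qed
  qed (rule X0)
  define t where "t \<omega> j = ennreal (K ^ Suc j * D (\<omega> j) (\<omega> (Suc j)))" for \<omega> j
  have t[measurable]: "(\<lambda>\<omega>. t \<omega> j) \<in> borel_measurable \<Omega>" for j unfolding t_def by measurable
  have int_t: "(\<integral>\<^sup>+\<omega>. t \<omega> j \<partial>\<Omega>) \<le> ennreal (K^2 * (1 / 2) ^ j)" for j
  proof -
    have "(\<integral>\<^sup>+\<omega>. t \<omega> j \<partial>\<Omega>) = ennreal (K ^ Suc j) * (\<integral>\<^sup>+\<omega>. D (\<omega> j) (\<omega> (Suc j)) \<partial>\<Omega>)"
      unfolding t_def using K_ge_1 D_nonneg by (subst nn_integral_cmult[symmetric]) (auto simp: ennreal_mult)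
    also have "(\<integral>\<^sup>+\<omega>. D (\<omega> j) (\<omega> (Suc j)) \<partial>\<Omega>) = (\<integral>\<^sup>+x. (\<integral>\<^sup>+z. D x z \<partial>\<kappa> j x) \<partial>\<nu> j)"
      using step[of "\<lambda>p. ennreal (D (fst p) (snd p))" j] by (simp add: law)
    also have "ennreal (K ^ Suc j) * \<dots> \<le> ennreal (K ^ Suc j) * ennreal (K * (1 / (2 * K)) ^ j)"
      by (intro mult_left_mono cost) simp
    also have "\<dots> = ennreal (K^2 * (1 / 2) ^ j)"
      using K_ge_1 by (subst ennreal_mult[symmetric]) (auto simp: power2_eq_square power_divide power_mult_distrib field_simps)
    finally show ?thesis .
  qed
  have int_sum: "(\<integral>\<^sup>+\<omega>. (\<Sum>j. t \<omega> (j + n)) \<partial>\<Omega>) \<le> ennreal (2 * K^2 * (1 / 2) ^ n)" for n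
  proof -
    have "(\<integral>\<^sup>+\<omega>. (\<Sum>j. t \<omega> (j + n)) \<partial>\<Omega>) = (\<Sum>j. \<integral>\<^sup>+\<omega>. t \<omega> (j + n) \<partial>\<Omega>)"
      by (rule nn_integral_suminf) simp
    also have "\<dots> \<le> (\<Sum>j. ennreal (K^2 * (1 / 2) ^ (j + n)))"
      by (intro suminf_le int_t) auto
    also have "\<dots> = ennreal (2 * K^2 * (1 / 2) ^ n)"
    proof (rule suminf_ennreal_eq)
      show "(\<lambda>j. K^2 * (1 / 2) ^ (j + n)) sums (2 * K^2 * (1 / 2) ^ n)"
        using sums_mult[OF geometric_sums[of "1/2::real"], of "K^2 * (1 / 2) ^ n"]
        by (simp add: power_add mult_ac)
    qed simp
    finally show ?thesis .
  qed
  \<comment> \<open>The weighted series has finite expectation, so it converges off a null set. On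
    \<open>G\<close> the path converges and its distance to the limit is bounded by a tail of the
    series.\<close>
  define G where "G = {\<omega> \<in> space \<Omega>. (\<Sum>j. t \<omega> j) < \<infinity>}"
  have G[measurable]: "G \<in> sets \<Omega>" unfolding G_def by measurable
  have "AE \<omega> in \<Omega>. (\<Sum>j. t \<omega> (j + 0)) \<noteq> \<infinity>"
    using int_sum[of 0] by (intro nn_integral_noteq_infinite) (auto simp: top_unique)
  then have AE_G: "AE \<omega> in \<Omega>. \<omega> \<in> G"
    using AE_space by eventually_elim (auto simp: G_def less_top)
  have sm: "summable (\<lambda>j. K ^ Suc j * D (\<omega> j) (\<omega> (Suc j)))" if "\<omega> \<in> G" for \<omega>
    using that K_ge_1 D_nonneg unfolding G_def t_def
    by (intro summable_suminf_not_top) auto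
  \<comment> \<open>Off \<open>G\<close> an arbitrary constant is used, and the approximants are
    altered in the same way. Thus \<open>X\<close> is a limit of measurable maps at every
    point.\<close>
  define X where "X \<omega> = (if \<omega> \<in> G then lim \<omega> else undefined)" for \<omega> :: "nat \<Rightarrow> 'a"
  have X_meas[measurable]: "X \<in> borel_measurable \<Omega>"
  proof (rule borel_measurable_LIMSEQ_metric)
    show "(\<lambda>\<omega>. if \<omega> \<in> G then \<omega> i else undefined) \<in> borel_measurable \<Omega>" for i by measurable
    show "(\<lambda>i. if \<omega> \<in> G then \<omega> i else undefined) \<longlonglongrightarrow> X \<omega>" for \<omega>
      using D_limit_bound(1)[OF sm, of \<omega>] by (auto simp: X_def convergent_LIMSEQ_iff)
  qed
  have D_X: "ennreal (D (\<omega> n) (X \<omega>)) \<le> (\<Sum>j. t \<omega> (j + n))" if "\<omega> \<in> G" for \<omega> n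
  proof -
    have "ennreal (D (\<omega> n) (X \<omega>)) \<le> ennreal (\<Sum>j. K ^ Suc (j + n) * D (\<omega> (j + n)) (\<omega> (Suc (j + n))))"
      using D_limit_bound(2)[OF sm[OF that]] that by (intro ennreal_leI) (simp add: X_def)
    also have "\<dots> = (\<Sum>j. t \<omega> (j + n))"
      unfolding t_def using K_ge_1 D_nonneg sm[OF that, THEN summable_ignore_initial_segment, of n]
      by (intro suminf_ennreal2[symmetric]) auto
    finally show ?thesis .
  qed
  show ?thesis
  proof (rule that)
    show "distr \<Omega> borel X \<in> prob_measures" by (auto simp: prob_measures_def intro!: prob_space_distr)
    fix n
    have "distr \<Omega> borel (\<lambda>\<omega>. (\<omega> n, X \<omega>)) \<in> couplings (\<nu> n) (distr \<Omega> borel X)"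
      using distr_in_couplings[OF prob_space_axioms X[of n] X_meas] by (simp add: law)
    from transport_cost_le[OF this, of D]
    have "W (\<nu> n) (distr \<Omega> borel X) \<le> (\<integral>\<^sup>+\<omega>. D (\<omega> n) (X \<omega>) \<partial>\<Omega>)"
      by (subst (asm) nn_integral_distr) auto
    also have "\<dots> \<le> (\<integral>\<^sup>+\<omega>. (\<Sum>j. t \<omega> (j + n)) \<partial>\<Omega>)"
      using AE_G by (intro nn_integral_mono_AE) (auto intro: D_X elim!: eventually_mono)
    also note int_sum
    finally show "W (\<nu> n) (distr \<Omega> borel X) \<le> ennreal (2 * K^2 * (1 / 2) ^ n)" .
  qed
qed

end

text \<open>The two experiments are coupled so that their labels agree almost surely. On matching
  labels the cost is bounded by a function of the first outcome plus a function of the second, so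
  that the integral of the bound depends on the marginals alone.\<close>

lemma transport_cost_index_bound:
  fixes Y :: "'b \<Rightarrow> 'a::second_countable_topology" and Y' :: "'c \<Rightarrow> 'a" and F :: "'b \<Rightarrow> nat" and F' :: "'c \<Rightarrow> nat"
  assumes M: "prob_space M" and M': "prob_space M'"
    and Y[measurable]: "Y \<in> borel_measurable M" and Y'[measurable]: "Y' \<in> borel_measurable M'"
    and F: "F \<in> M \<rightarrow>\<^sub>M count_space UNIV" and F': "F' \<in> M' \<rightarrow>\<^sub>M count_space UNIV"
    and law: "\<And>i. emeasure M {x \<in> space M. F x = i} = emeasure M' {y \<in> space M'. F' y = i}"
    and c[measurable]: "(\<lambda>p. c (fst p) (snd p)) \<in> borel_measurable (borel \<Otimes>\<^sub>M borel)"
    and l[measurable]: "l \<in> borel_measurable M" "l' \<in> borel_measurable M'"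
    and le: "\<And>\<omega> \<omega>'. F \<omega> = F' \<omega>' \<Longrightarrow> ennreal (c (Y \<omega>) (Y' \<omega>')) \<le> l \<omega> + l' \<omega>'"
  shows "transport_cost c (distr M borel Y) (distr M' borel Y') \<le> (\<integral>\<^sup>+\<omega>. l \<omega> \<partial>M) + (\<integral>\<^sup>+\<omega>. l' \<omega> \<partial>M')"
proof -
  obtain \<kappa> where \<kappa>[measurable]: "\<kappa> \<in> M \<rightarrow>\<^sub>M prob_algebra M'" and bind: "M \<bind> \<kappa> = M'"
    and ae: "AE x in M. AE y in \<kappa> x. F' y = F x"
    using index_kernel_exists[OF M M' F F' law] .
  obtain \<Gamma> where \<Gamma>: "\<Gamma> \<in> couplings (distr M borel Y) (distr M' borel Y')"
    and int: "\<forall>\<phi>\<in>borel_measurable (borel \<Otimes>\<^sub>M borel).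
      (\<integral>\<^sup>+p. \<phi> p \<partial>\<Gamma>) = (\<integral>\<^sup>+\<omega>. (\<integral>\<^sup>+z. \<phi> (Y \<omega>, Y' z) \<partial>\<kappa> \<omega>) \<partial>M)"
    by (rule bexE[OF coupling_of_kernel[OF M \<kappa> Y Y', unfolded bind]])
  have \<kappa>_sub[measurable]: "\<kappa> \<in> M \<rightarrow>\<^sub>M subprob_algebra M'" by (rule measurable_prob_algebraD[OF \<kappa>])
  have m: "(\<lambda>\<omega>. \<integral>\<^sup>+z. l' z \<partial>\<kappa> \<omega>) \<in> borel_measurable M"
    by (rule nn_integral_measurable_subprob_algebra2[OF _ \<kappa>_sub]) simp
  have "transport_cost c (distr M borel Y) (distr M' borel Y') \<le> (\<integral>\<^sup>+p. ennreal (c (fst p) (snd p)) \<partial>\<Gamma>)"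
    by (rule transport_cost_le[OF \<Gamma>])
  also have "\<dots> = (\<integral>\<^sup>+\<omega>. (\<integral>\<^sup>+z. ennreal (c (Y \<omega>) (Y' z)) \<partial>\<kappa> \<omega>) \<partial>M)"
    using bspec[OF int, of "\<lambda>p. ennreal (c (fst p) (snd p))"] by simp
  also have "\<dots> \<le> (\<integral>\<^sup>+\<omega>. l \<omega> + (\<integral>\<^sup>+z. l' z \<partial>\<kappa> \<omega>) \<partial>M)"
  proof (rule nn_integral_mono_AE)
    show "AE \<omega> in M. (\<integral>\<^sup>+z. ennreal (c (Y \<omega>) (Y' z)) \<partial>\<kappa> \<omega>) \<le> l \<omega> + (\<integral>\<^sup>+z. l' z \<partial>\<kappa> \<omega>)"
      using ae AE_space
    proof eventually_elim
      case (elim \<omega>)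
      then have s: "sets (\<kappa> \<omega>) = sets M'" and p: "emeasure (\<kappa> \<omega>) (space (\<kappa> \<omega>)) = 1"
        using measurable_space[OF \<kappa>, of \<omega>] by (auto simp: space_prob_algebra prob_space.emeasure_space_1)
      have "l' \<in> borel_measurable (\<kappa> \<omega>)"
        using l(2) by (simp add: measurable_cong_sets[OF s refl])
      then have add: "(\<integral>\<^sup>+z. l \<omega> + l' z \<partial>\<kappa> \<omega>) = l \<omega> + (\<integral>\<^sup>+z. l' z \<partial>\<kappa> \<omega>)"
        by (subst nn_integral_add) (auto simp: p)
      have "(\<integral>\<^sup>+z. ennreal (c (Y \<omega>) (Y' z)) \<partial>\<kappa> \<omega>) \<le> (\<integral>\<^sup>+z. l \<omega> + l' z \<partial>\<kappa> \<omega>)"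
        using elim(1) by (intro nn_integral_mono_AE) (auto intro!: le elim!: eventually_mono)
      also have "\<dots> = l \<omega> + (\<integral>\<^sup>+z. l' z \<partial>\<kappa> \<omega>)" by (rule add)
      finally show ?case .
    qed
  qed
  also have "\<dots> = (\<integral>\<^sup>+\<omega>. l \<omega> \<partial>M) + (\<integral>\<^sup>+\<omega>. (\<integral>\<^sup>+z. l' z \<partial>\<kappa> \<omega>) \<partial>M)"
    using m by (simp add: nn_integral_add)
  also have "(\<integral>\<^sup>+\<omega>. (\<integral>\<^sup>+z. l' z \<partial>\<kappa> \<omega>) \<partial>M) = (\<integral>\<^sup>+z. l' z \<partial>M')"
    using nn_integral_bind[OF l(2) \<kappa>_sub] by (simp only: bind)
  finally show ?thesis .
qed

section \<open>Separability: couplings compared through their masses on finitely many cells\<close>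

definition unit_uniform :: "real measure" where
  "unit_uniform = uniform_measure lborel {0..1}"

lemma sets_unit_uniform[measurable_cong]: "sets unit_uniform = sets borel"
  by (simp add: unit_uniform_def)

lemma prob_space_unit_uniform: "prob_space unit_uniform"
  unfolding unit_uniform_def by (rule prob_space_uniform_measure) auto

lemma emeasure_unit_uniform_less:
  assumes "0 \<le> t" "t \<le> 1"
  shows "emeasure unit_uniform {u. u < t} = ennreal t"
proof -
  have "{0..1} \<inter> {u. u < t} = {0..<t}" using assms by auto
  then show ?thesis using assms by (simp add: unit_uniform_def divide_ennreal_def)
qed

lemma nn_integral_unit_uniform_less:
  assumes "0 \<le> t" "t \<le> 1"
  shows "(\<integral>\<^sup>+u. (if u < t then a else b) \<partial>unit_uniform) = a * ennreal t + b * ennreal (1 - t)"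
proof -
  interpret prob_space unit_uniform by (rule prob_space_unit_uniform)
  have sp: "space unit_uniform = UNIV" using sets_eq_imp_space_eq[OF sets_unit_uniform] by simp
  have "emeasure unit_uniform (space unit_uniform - {u. u < t}) = ennreal (1 - t)"
    using assms emeasure_unit_uniform_less[OF assms] emeasure_space_1
    by (subst emeasure_compl) (auto simp: sets_unit_uniform ennreal_minus[symmetric])
  then have compl: "emeasure unit_uniform (- {u. u < t}) = ennreal (1 - t)" by (simp add: sp Compl_eq_Diff_UNIV)
  have "(\<integral>\<^sup>+u. (if u < t then a else b) \<partial>unit_uniform) =
      (\<integral>\<^sup>+u. a * indicator {u. u < t} u + b * indicator (- {u. u < t}) u \<partial>unit_uniform)"
    by (intro nn_integral_cong) (auto simp: indicator_def)
  also have "\<dots> = a * emeasure unit_uniform {u. u < t} + b * emeasure unit_uniform (- {u. u < t})"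
    by (subst nn_integral_add) (auto simp: nn_integral_cmult_indicator sets_unit_uniform)
  finally show ?thesis by (simp add: emeasure_unit_uniform_less[OF assms] compl)
qed

text \<open>A coin of bias \<open>h\<close> decides whether the cells of both coordinates are recorded or only the
  first one. The resulting tag has a law which depends on \<open>q\<close> and \<open>\<mu>\<close>, but not on \<open>\<gamma>\<close>.\<close>

lemma tagged_coupling:
  fixes k :: "'a::second_countable_topology \<Rightarrow> nat" and q :: "nat \<Rightarrow> nat \<Rightarrow> real" and c :: "'a \<Rightarrow> 'a \<Rightarrow> real"
  defines "cell \<equiv> \<lambda>i j. {p. k (fst p) = i \<and> k (snd p) = j}"
  assumes \<gamma>: "\<gamma> \<in> couplings \<mu> \<nu>"
    and k[measurable]: "k \<in> borel \<rightarrow>\<^sub>M count_space UNIV"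
    and c[measurable]: "(\<lambda>p. c (fst p) (snd p)) \<in> borel_measurable (borel \<Otimes>\<^sub>M borel)"
    and q0: "\<And>i j. 0 \<le> q i j" and q: "\<And>i j. i < N \<Longrightarrow> j < N \<Longrightarrow> q i j \<le> measure \<gamma> (cell i j)"
    and gap: "\<And>i j. i < N \<Longrightarrow> j < N \<Longrightarrow> real N ^ 3 * (measure \<gamma> (cell i j) - q i j) \<le> \<epsilon>"
    and out: "(\<integral>\<^sup>+p. ennreal (c (fst p) (snd p)) * indicator {p. \<not> (k (fst p) < N \<and> k (snd p) < N \<and> c (fst p) (snd p) \<le> real N)} p \<partial>\<gamma>) \<le> ennreal \<epsilon>"
    and \<epsilon>: "0 \<le> \<epsilon>"
  obtains h where "h \<in> borel_measurable (borel \<Otimes>\<^sub>M borel)"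
    "\<forall>i j. emeasure (\<gamma> \<Otimes>\<^sub>M unit_uniform) {\<omega>. k (fst (fst \<omega>)) = i \<and> k (snd (fst \<omega>)) = j \<and> snd \<omega> < h (fst \<omega>)} = ennreal (if i < N \<and> j < N then q i j else 0)"
    "\<forall>i. emeasure (\<gamma> \<Otimes>\<^sub>M unit_uniform) {\<omega>. k (fst (fst \<omega>)) = i \<and> \<not> snd \<omega> < h (fst \<omega>)} = emeasure \<mu> {x. k x = i} - ennreal (if i < N then \<Sum>j<N. q i j else 0)"
    "(\<integral>\<^sup>+\<omega>. (if snd \<omega> < h (fst \<omega>) then 0 else ennreal (c (fst (fst \<omega>)) (snd (fst \<omega>)))) \<partial>(\<gamma> \<Otimes>\<^sub>M unit_uniform)) \<le> ennreal (2 * \<epsilon>)"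
proof -
  interpret \<gamma>: prob_space \<gamma> using \<gamma> by (rule couplingsD)
  interpret U: prob_space unit_uniform by (rule prob_space_unit_uniform)
  interpret pair_prob_space \<gamma> unit_uniform ..
  note s\<gamma>[measurable_cong] = sets_coupling[OF \<gamma>] and sU[measurable_cong] = sets_unit_uniform
  have sp\<gamma>: "space \<gamma> = UNIV" by (rule couplingsD(3)[OF \<gamma>])
  have spM: "space (\<gamma> \<Otimes>\<^sub>M unit_uniform) = UNIV"
    using sets_eq_imp_space_eq[OF sU] by (simp add: space_pair_measure sp\<gamma>)
  have cell[measurable]: "cell i j \<in> sets \<gamma>" for i j
  proof -
    have "{p \<in> space \<gamma>. k (fst p) = i \<and> k (snd p) = j} \<in> sets \<gamma>" by measurable
    then show ?thesis by (simp add: cell_def sp\<gamma>)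
  qed
  define m where "m i j = measure \<gamma> (cell i j)" for i j
  have em: "emeasure \<gamma> (cell i j) = ennreal (m i j)" for i j by (simp add: m_def \<gamma>.emeasure_eq_measure)
  have m0: "0 \<le> m i j" for i j by (simp add: m_def)
  have qm: "q i j \<le> m i j" if "i < N" "j < N" for i j using q that by (simp add: m_def)
  \<comment> \<open>The share of the cell mass that is to be matched. On a null cell
    \<open>q i j\<close> vanishes as well, so the value 0 of the division is the right one; outside
    the \<open>N\<close> by \<open>N\<close> block nothing is matched.\<close>
  define \<rho> where "\<rho> i j = (if i < N \<and> j < N then q i j / m i j else 0)" for i j
  have \<rho>: "0 \<le> \<rho> i j" "\<rho> i j \<le> 1" for i j
    using q0[of i j] qm[of i j] m0[of i j] by (auto simp: \<rho>_def divide_le_eq_1)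
  have \<rho>m: "\<rho> i j * m i j = (if i < N \<and> j < N then q i j else 0)" for i j
    using q0[of i j] qm[of i j] by (auto simp: \<rho>_def)
  define h where "h p = \<rho> (k (fst p)) (k (snd p))" for p
  have h[measurable]: "h \<in> borel_measurable (borel \<Otimes>\<^sub>M borel)" unfolding h_def by measurable
  have h01: "0 \<le> h p" "h p \<le> 1" for p by (simp_all add: h_def \<rho>)
  have int: "(\<integral>\<^sup>+\<omega>. (if snd \<omega> < h (fst \<omega>) then a (fst \<omega>) else b (fst \<omega>)) \<partial>(\<gamma> \<Otimes>\<^sub>M unit_uniform)) =
      (\<integral>\<^sup>+p. a p * ennreal (h p) + b p * ennreal (1 - h p) \<partial>\<gamma>)"
    if [measurable]: "a \<in> borel_measurable \<gamma>" "b \<in> borel_measurable \<gamma>" for a b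
  proof -
    have "(\<lambda>\<omega>. if snd \<omega> < h (fst \<omega>) then a (fst \<omega>) else b (fst \<omega>)) \<in> borel_measurable (\<gamma> \<Otimes>\<^sub>M unit_uniform)"
      by measurable
    from U.nn_integral_fst[OF this] show ?thesis
      by (simp only: fst_conv snd_conv nn_integral_unit_uniform_less[OF h01])
  qed
  have int_cell: "(\<integral>\<^sup>+p. indicator (cell i j) p * ennreal (h p) \<partial>\<gamma>) = ennreal (if i < N \<and> j < N then q i j else 0)" for i j
  proof -
    have "(\<integral>\<^sup>+p. indicator (cell i j) p * ennreal (h p) \<partial>\<gamma>) = (\<integral>\<^sup>+p. ennreal (\<rho> i j) * indicator (cell i j) p \<partial>\<gamma>)"
      by (intro nn_integral_cong) (auto simp: indicator_def h_def cell_def)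
    also have "\<dots> = ennreal (\<rho> i j) * ennreal (m i j)" by (simp add: nn_integral_cmult_indicator em)
    also have "\<dots> = ennreal (if i < N \<and> j < N then q i j else 0)"
      by (simp only: ennreal_mult[OF \<rho>(1) m0, symmetric] \<rho>m)
    finally show ?thesis .
  qed
  show ?thesis
  proof (rule that[OF h]; (intro allI)?)
    fix i j
    have "emeasure (\<gamma> \<Otimes>\<^sub>M unit_uniform) {\<omega>. k (fst (fst \<omega>)) = i \<and> k (snd (fst \<omega>)) = j \<and> snd \<omega> < h (fst \<omega>)}
      = emeasure (\<gamma> \<Otimes>\<^sub>M unit_uniform) {\<omega> \<in> space (\<gamma> \<Otimes>\<^sub>M unit_uniform). k (fst (fst \<omega>)) = i \<and> k (snd (fst \<omega>)) = j \<and> snd \<omega> < h (fst \<omega>)}"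
      by (simp add: spM)
    also have "\<dots> = (\<integral>\<^sup>+\<omega>. indicator {\<omega> \<in> space (\<gamma> \<Otimes>\<^sub>M unit_uniform). k (fst (fst \<omega>)) = i \<and> k (snd (fst \<omega>)) = j \<and> snd \<omega> < h (fst \<omega>)} \<omega> \<partial>(\<gamma> \<Otimes>\<^sub>M unit_uniform))"
      by (intro nn_integral_indicator[symmetric]) measurable
    also have "\<dots> = (\<integral>\<^sup>+\<omega>. (if snd \<omega> < h (fst \<omega>) then indicator (cell i j) (fst \<omega>) else 0) \<partial>(\<gamma> \<Otimes>\<^sub>M unit_uniform))"
      by (intro nn_integral_cong) (auto simp: indicator_def cell_def)
    also have "\<dots> = (\<integral>\<^sup>+p. indicator (cell i j) p * ennreal (h p) \<partial>\<gamma>)"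
      by (subst int) auto
    also note int_cell
    finally show "emeasure (\<gamma> \<Otimes>\<^sub>M unit_uniform) {\<omega>. k (fst (fst \<omega>)) = i \<and> k (snd (fst \<omega>)) = j \<and> snd \<omega> < h (fst \<omega>)} = ennreal (if i < N \<and> j < N then q i j else 0)" .
  next
    fix i
    \<comment> \<open>Since \<open>h\<close> vanishes outside the block, the recorded pairs in row
      \<open>i\<close> have mass \<open>\<Sum>j<N. q i j\<close>. The unrecorded rest of the row is
      the \<mu>-mass of the cell minus this sum, where \<gamma> no longer occurs.\<close>
    let ?S = "{p. k (fst p) = i}"
    have S[measurable]: "?S \<in> sets \<gamma>"
    proof -
      have "{p \<in> space \<gamma>. k (fst p) = i} \<in> sets \<gamma>" by measurable
      then show ?thesis by (simp add: sp\<gamma>)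
    qed
    have "emeasure (\<gamma> \<Otimes>\<^sub>M unit_uniform) {\<omega>. k (fst (fst \<omega>)) = i \<and> \<not> snd \<omega> < h (fst \<omega>)}
      = emeasure (\<gamma> \<Otimes>\<^sub>M unit_uniform) {\<omega> \<in> space (\<gamma> \<Otimes>\<^sub>M unit_uniform). k (fst (fst \<omega>)) = i \<and> \<not> snd \<omega> < h (fst \<omega>)}"
      by (simp add: spM)
    also have "\<dots> = (\<integral>\<^sup>+\<omega>. indicator {\<omega> \<in> space (\<gamma> \<Otimes>\<^sub>M unit_uniform). k (fst (fst \<omega>)) = i \<and> \<not> snd \<omega> < h (fst \<omega>)} \<omega> \<partial>(\<gamma> \<Otimes>\<^sub>M unit_uniform))"
      by (intro nn_integral_indicator[symmetric]) measurable
    also have "\<dots> = (\<integral>\<^sup>+\<omega>. (if snd \<omega> < h (fst \<omega>) then 0 else indicator ?S (fst \<omega>)) \<partial>(\<gamma> \<Otimes>\<^sub>M unit_uniform))"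
      by (intro nn_integral_cong) (auto simp: indicator_def spM)
    also have "\<dots> = (\<integral>\<^sup>+p. indicator ?S p * ennreal (1 - h p) \<partial>\<gamma>)"
      by (subst int) auto
    finally have e1: "emeasure (\<gamma> \<Otimes>\<^sub>M unit_uniform) {\<omega>. k (fst (fst \<omega>)) = i \<and> \<not> snd \<omega> < h (fst \<omega>)} = \<dots>" .
    have "(\<integral>\<^sup>+p. indicator ?S p * ennreal (h p) \<partial>\<gamma>) = (\<integral>\<^sup>+p. (\<Sum>j<N. indicator (cell i j) p * ennreal (h p)) \<partial>\<gamma>)"
    proof (rule nn_integral_cong)
      fix p
      show "indicator ?S p * ennreal (h p) = (\<Sum>j<N. indicator (cell i j) p * ennreal (h p))"
      proof (cases "k (fst p) = i \<and> k (snd p) < N")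
        case True
        then have "(\<Sum>j<N. indicator (cell i j) p * ennreal (h p)) = (\<Sum>j<N. if j = k (snd p) then ennreal (h p) else 0)"
          by (intro sum.cong) (auto simp: indicator_def cell_def)
        with True show ?thesis by (simp add: indicator_def)
      next
        case False
        then have "h p = 0 \<or> k (fst p) \<noteq> i" by (auto simp: h_def \<rho>_def)
        then show ?thesis by (auto simp: indicator_def cell_def)
      qed
    qed
    also have "\<dots> = (\<Sum>j<N. ennreal (if i < N \<and> j < N then q i j else 0))"
      by (subst nn_integral_sum) (auto simp: int_cell)
    also have "\<dots> = ennreal (if i < N then \<Sum>j<N. q i j else 0)"
      using q0 by (subst sum_ennreal) auto
    finally have e2: "(\<integral>\<^sup>+p. indicator ?S p * ennreal (h p) \<partial>\<gamma>) = \<dots>" .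
    have "emeasure \<mu> {x. k x = i} = emeasure \<gamma> ?S"
      unfolding couplingsD(4)[OF \<gamma>, symmetric] by (subst emeasure_distr) (auto simp: sp\<gamma> vimage_def)
    also have "\<dots> = (\<integral>\<^sup>+p. indicator ?S p \<partial>\<gamma>)" by simp
    also have "\<dots> = (\<integral>\<^sup>+p. indicator ?S p * ennreal (1 - h p) + indicator ?S p * ennreal (h p) \<partial>\<gamma>)"
      using h01 by (intro nn_integral_cong) (auto simp: distrib_left[symmetric] ennreal_plus[symmetric] simp del: ennreal_plus)
    also have "\<dots> = (\<integral>\<^sup>+p. indicator ?S p * ennreal (1 - h p) \<partial>\<gamma>) + ennreal (if i < N then \<Sum>j<N. q i j else 0)"
      unfolding e2[symmetric] by (rule nn_integral_add) auto
    finally show "emeasure (\<gamma> \<Otimes>\<^sub>M unit_uniform) {\<omega>. k (fst (fst \<omega>)) = i \<and> \<not> snd \<omega> < h (fst \<omega>)} = emeasure \<mu> {x. k x = i} - ennreal (if i < N then \<Sum>j<N. q i j else 0)"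
      unfolding e1 by (simp add: ennreal_add_diff_cancel_right)
  next
    let ?O = "{p. \<not> (k (fst p) < N \<and> k (snd p) < N \<and> c (fst p) (snd p) \<le> real N)}"
    have O[measurable]: "?O \<in> sets \<gamma>"
    proof -
      have "{p \<in> space \<gamma>. \<not> (k (fst p) < N \<and> k (snd p) < N \<and> c (fst p) (snd p) \<le> real N)} \<in> sets \<gamma>" by measurable
      then show ?thesis by (simp add: sp\<gamma>)
    qed
    \<comment> \<open>Inside the block an unmatched pair costs at most \<open>N\<close>, the
      unmatched mass of a cell is at most \<open>\<epsilon> / N^3\<close>, and there are
      \<open>N^2\<close> cells; this is the reason for the cube in \<open>gap\<close>. The block
      thus contributes \<epsilon>, and \<open>out\<close> bounds the rest by another
      \<epsilon>.\<close>
    let ?R = "\<lambda>i j. ennreal (real N * (1 - \<rho> i j))"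
    have "(\<integral>\<^sup>+\<omega>. (if snd \<omega> < h (fst \<omega>) then 0 else ennreal (c (fst (fst \<omega>)) (snd (fst \<omega>)))) \<partial>(\<gamma> \<Otimes>\<^sub>M unit_uniform))
      = (\<integral>\<^sup>+p. ennreal (c (fst p) (snd p)) * ennreal (1 - h p) \<partial>\<gamma>)"
      by (subst int[of "\<lambda>_. 0" "\<lambda>p. ennreal (c (fst p) (snd p))", simplified]) auto
    also have "\<dots> \<le> (\<integral>\<^sup>+p. ennreal (c (fst p) (snd p)) * indicator ?O p + (\<Sum>i<N. \<Sum>j<N. ?R i j * indicator (cell i j) p) \<partial>\<gamma>)"
    proof (rule nn_integral_mono)
      fix p
      show "ennreal (c (fst p) (snd p)) * ennreal (1 - h p) \<le> ennreal (c (fst p) (snd p)) * indicator ?O p + (\<Sum>i<N. \<Sum>j<N. ?R i j * indicator (cell i j) p)"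
      proof (cases "p \<in> ?O")
        case True
        have "ennreal (c (fst p) (snd p)) * ennreal (1 - h p) \<le> ennreal (c (fst p) (snd p)) * 1"
          using h01[of p] by (intro mult_left_mono) auto
        with True show ?thesis by (intro order_trans[OF _ add_increasing2]) auto
      next
        case False
        define i j where "i = k (fst p)" and "j = k (snd p)"
        have ij: "i < N" "j < N" "c (fst p) (snd p) \<le> real N" using False by (auto simp: i_def j_def)
        have "ennreal (c (fst p) (snd p)) * ennreal (1 - h p) \<le> ennreal (real N) * ennreal (1 - h p)"
          using ij(3) by (intro mult_right_mono ennreal_leI) auto
        also have "\<dots> = ?R i j * indicator (cell i j) p"
          using h01[of p] by (simp add: ennreal_mult h_def i_def j_def cell_def)
        also have "\<dots> \<le> (\<Sum>j<N. ?R i j * indicator (cell i j) p)"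
          using ij by (intro member_le_sum) auto
        also have "\<dots> \<le> (\<Sum>i<N. \<Sum>j<N. ?R i j * indicator (cell i j) p)"
          using ij by (intro member_le_sum[of i _ "\<lambda>i. \<Sum>j<N. ?R i j * indicator (cell i j) p"]) auto
        finally show ?thesis by (intro add_increasing) auto
      qed
    qed
    also have "\<dots> = (\<integral>\<^sup>+p. ennreal (c (fst p) (snd p)) * indicator ?O p \<partial>\<gamma>) + (\<Sum>i<N. \<Sum>j<N. ?R i j * ennreal (m i j))"
    proof -
      have R[measurable]: "(\<lambda>p. ?R i j * indicator (cell i j) p) \<in> borel_measurable \<gamma>" for i j by measurable
      have "(\<integral>\<^sup>+p. (\<Sum>i<N. \<Sum>j<N. ?R i j * indicator (cell i j) p) \<partial>\<gamma>) = (\<Sum>i<N. \<integral>\<^sup>+p. (\<Sum>j<N. ?R i j * indicator (cell i j) p) \<partial>\<gamma>)"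
        by (intro nn_integral_sum borel_measurable_sum R)
      also have "\<dots> = (\<Sum>i<N. \<Sum>j<N. \<integral>\<^sup>+p. ?R i j * indicator (cell i j) p \<partial>\<gamma>)"
        by (intro sum.cong refl nn_integral_sum R)
      also have "\<dots> = (\<Sum>i<N. \<Sum>j<N. ?R i j * ennreal (m i j))"
        by (intro sum.cong refl) (simp only: nn_integral_cmult_indicator[OF cell] em)
      finally have sum: "(\<integral>\<^sup>+p. (\<Sum>i<N. \<Sum>j<N. ?R i j * indicator (cell i j) p) \<partial>\<gamma>) = (\<Sum>i<N. \<Sum>j<N. ?R i j * ennreal (m i j))" .
      have m1: "(\<lambda>p. ennreal (c (fst p) (snd p)) * indicator ?O p) \<in> borel_measurable \<gamma>" by measurable
      have m2: "(\<lambda>p. \<Sum>i<N. \<Sum>j<N. ?R i j * indicator (cell i j) p) \<in> borel_measurable \<gamma>"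
        by (intro borel_measurable_sum R)
      show ?thesis unfolding nn_integral_add[OF m1 m2] sum ..
    qed
    also have "\<dots> \<le> ennreal \<epsilon> + ennreal \<epsilon>"
    proof (intro add_mono out)
      have R: "?R i j * ennreal (m i j) = ennreal (real N * (m i j - q i j))" if "i < N" "j < N" for i j
        using \<rho>[of i j] m0[of i j] \<rho>m[of i j] that
        by (subst ennreal_mult[symmetric]) (auto simp: algebra_simps)
      have "(\<Sum>i<N. \<Sum>j<N. ?R i j * ennreal (m i j)) = (\<Sum>i<N. \<Sum>j<N. ennreal (real N * (m i j - q i j)))"
        by (intro sum.cong refl R) auto
      also have "\<dots> = ennreal (\<Sum>i<N. \<Sum>j<N. real N * (m i j - q i j))"
      proof -
        have "(\<Sum>j<N. ennreal (real N * (m i j - q i j))) = ennreal (\<Sum>j<N. real N * (m i j - q i j))" if "i < N" for i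
          using qm that by (intro sum_ennreal) auto
        then have "(\<Sum>i<N. \<Sum>j<N. ennreal (real N * (m i j - q i j))) = (\<Sum>i<N. ennreal (\<Sum>j<N. real N * (m i j - q i j)))"
          by (intro sum.cong) auto
        also have "\<dots> = ennreal (\<Sum>i<N. \<Sum>j<N. real N * (m i j - q i j))"
          using qm by (intro sum_ennreal sum_nonneg) auto
        finally show ?thesis .
      qed
      also have "\<dots> \<le> ennreal \<epsilon>"
      proof (cases "N = 0")
        case False
        have "(\<Sum>i<N. \<Sum>j<N. real N * (m i j - q i j)) \<le> (\<Sum>i<N. \<Sum>j<N. \<epsilon> / real N ^ 2)"
          using gap False by (intro sum_mono) (auto simp: m_def field_simps power2_eq_square power3_eq_cube)
        also have "\<dots> = \<epsilon>" using False by (simp add: power2_eq_square)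
        finally show ?thesis by (rule ennreal_leI)
      qed (simp add: \<epsilon>)
      finally show "(\<Sum>i<N. \<Sum>j<N. ?R i j * ennreal (m i j)) \<le> ennreal \<epsilon>" .
    qed
    also have "\<dots> = ennreal (2 * \<epsilon>)" using \<epsilon> by (simp add: ennreal_plus[symmetric] del: ennreal_plus)
    finally show "(\<integral>\<^sup>+\<omega>. (if snd \<omega> < h (fst \<omega>) then 0 else ennreal (c (fst (fst \<omega>)) (snd (fst \<omega>)))) \<partial>(\<gamma> \<Otimes>\<^sub>M unit_uniform)) \<le> ennreal (2 * \<epsilon>)" .
  qed
qed

context quasi_cost
begin

text \<open>Equal tag laws allow both couplings to be sampled with equal tags. If both cells were
  recorded, the second components share a cell and are \<epsilon>-close. Otherwise only the first
  components share a cell, and the route from \<open>y\<close> over \<open>x\<close> and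
  \<open>x'\<close> to \<open>y'\<close> pays for both pairs; these costs are integrated over the
  unrecorded part only, where they are small.\<close>

lemma W_le_of_common_minorant:
  fixes k :: "'a \<Rightarrow> nat" and q :: "nat \<Rightarrow> nat \<Rightarrow> real"
  defines "cell \<equiv> \<lambda>i j. {p. k (fst p) = i \<and> k (snd p) = j}"
  assumes \<gamma>: "\<gamma> \<in> couplings \<mu> \<nu>" and \<gamma>': "\<gamma>' \<in> couplings \<mu> \<nu>'"
    and k[measurable]: "k \<in> borel \<rightarrow>\<^sub>M count_space UNIV" and kD: "\<And>x y. k x = k y \<Longrightarrow> D x y \<le> \<epsilon>" and \<epsilon>: "0 \<le> \<epsilon>"
    and q: "\<And>i j. 0 \<le> q i j"
      "\<And>i j. i < N \<Longrightarrow> j < N \<Longrightarrow> q i j \<le> measure \<gamma> (cell i j)"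
      "\<And>i j. i < N \<Longrightarrow> j < N \<Longrightarrow> q i j \<le> measure \<gamma>' (cell i j)"
    and gap: "\<And>i j. i < N \<Longrightarrow> j < N \<Longrightarrow> real N ^ 3 * (measure \<gamma> (cell i j) - q i j) \<le> \<epsilon>"
      "\<And>i j. i < N \<Longrightarrow> j < N \<Longrightarrow> real N ^ 3 * (measure \<gamma>' (cell i j) - q i j) \<le> \<epsilon>"
    and out: "(\<integral>\<^sup>+p. ennreal (D (fst p) (snd p)) * indicator {p. \<not> (k (fst p) < N \<and> k (snd p) < N \<and> D (fst p) (snd p) \<le> real N)} p \<partial>\<gamma>) \<le> ennreal \<epsilon>"
      "(\<integral>\<^sup>+p. ennreal (D (fst p) (snd p)) * indicator {p. \<not> (k (fst p) < N \<and> k (snd p) < N \<and> D (fst p) (snd p) \<le> real N)} p \<partial>\<gamma>') \<le> ennreal \<epsilon>"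
  shows "W \<nu> \<nu>' \<le> ennreal (5 * K^2 * \<epsilon>)"
proof -
  note [measurable_cong] = sets_coupling[OF \<gamma>] sets_coupling[OF \<gamma>'] sets_unit_uniform
  have Dm: "(\<lambda>p. D (fst p) (snd p)) \<in> borel_measurable (borel \<Otimes>\<^sub>M borel)" by measurable
  let ?M = "\<gamma> \<Otimes>\<^sub>M unit_uniform" and ?M' = "\<gamma>' \<Otimes>\<^sub>M unit_uniform"
  obtain h where h[measurable]: "h \<in> borel_measurable (borel \<Otimes>\<^sub>M borel)"
    and h1: "\<forall>i j. emeasure ?M {\<omega>. k (fst (fst \<omega>)) = i \<and> k (snd (fst \<omega>)) = j \<and> snd \<omega> < h (fst \<omega>)} = ennreal (if i < N \<and> j < N then q i j else 0)"
    and h2: "\<forall>i. emeasure ?M {\<omega>. k (fst (fst \<omega>)) = i \<and> \<not> snd \<omega> < h (fst \<omega>)} = emeasure \<mu> {x. k x = i} - ennreal (if i < N then \<Sum>j<N. q i j else 0)"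
    and h3: "(\<integral>\<^sup>+\<omega>. (if snd \<omega> < h (fst \<omega>) then 0 else ennreal (D (fst (fst \<omega>)) (snd (fst \<omega>)))) \<partial>?M) \<le> ennreal (2 * \<epsilon>)"
    using tagged_coupling[OF \<gamma> k Dm q(1,2)[unfolded cell_def] gap(1)[unfolded cell_def] out(1) \<epsilon>] .
  obtain h' where h'[measurable]: "h' \<in> borel_measurable (borel \<Otimes>\<^sub>M borel)"
    and h'1: "\<forall>i j. emeasure ?M' {\<omega>. k (fst (fst \<omega>)) = i \<and> k (snd (fst \<omega>)) = j \<and> snd \<omega> < h' (fst \<omega>)} = ennreal (if i < N \<and> j < N then q i j else 0)"
    and h'2: "\<forall>i. emeasure ?M' {\<omega>. k (fst (fst \<omega>)) = i \<and> \<not> snd \<omega> < h' (fst \<omega>)} = emeasure \<mu> {x. k x = i} - ennreal (if i < N then \<Sum>j<N. q i j else 0)"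
    and h'3: "(\<integral>\<^sup>+\<omega>. (if snd \<omega> < h' (fst \<omega>) then 0 else ennreal (D (fst (fst \<omega>)) (snd (fst \<omega>)))) \<partial>?M') \<le> ennreal (2 * \<epsilon>)"
    using tagged_coupling[OF \<gamma>' k Dm q(1,3)[unfolded cell_def] gap(2)[unfolded cell_def] out(2) \<epsilon>] .
  interpret \<gamma>: prob_space \<gamma> using \<gamma> by (rule couplingsD)
  interpret \<gamma>': prob_space \<gamma>' using \<gamma>' by (rule couplingsD)
  interpret U: prob_space unit_uniform by (rule prob_space_unit_uniform)
  interpret M: pair_prob_space \<gamma> unit_uniform ..
  interpret M': pair_prob_space \<gamma>' unit_uniform ..
  have spU: "space unit_uniform = UNIV" using sets_eq_imp_space_eq[OF sets_unit_uniform] by simp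
  have sp: "space ?M = UNIV" "space ?M' = UNIV"
    by (simp_all add: space_pair_measure couplingsD(3)[OF \<gamma>] couplingsD(3)[OF \<gamma>'] spU)
  \<comment> \<open>The second entry is 0 when only the first cell is recorded; the successor keeps
    this apart from a recorded cell 0.\<close>
  define tag :: "('a \<times> 'a \<Rightarrow> real) \<Rightarrow> ('a \<times> 'a) \<times> real \<Rightarrow> nat" where
    "tag g \<omega> = prod_encode (k (fst (fst \<omega>)), if snd \<omega> < g (fst \<omega>) then Suc (k (snd (fst \<omega>))) else 0)" for g \<omega>
  have tag_Suc: "{\<omega>. tag g \<omega> = prod_encode (i, Suc j)} = {\<omega>. k (fst (fst \<omega>)) = i \<and> k (snd (fst \<omega>)) = j \<and> snd \<omega> < g (fst \<omega>)}"
    and tag_0: "{\<omega>. tag g \<omega> = prod_encode (i, 0)} = {\<omega>. k (fst (fst \<omega>)) = i \<and> \<not> snd \<omega> < g (fst \<omega>)}" for g i j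
    by (auto simp: tag_def prod_encode_eq split: if_splits)
  have law: "emeasure ?M {\<omega> \<in> space ?M. tag h \<omega> = n} = emeasure ?M' {\<omega> \<in> space ?M'. tag h' \<omega> = n}" for n
  proof -
    obtain i l where n: "n = prod_encode (i, l)" by (metis prod_decode_inverse surj_pair)
    show ?thesis
      unfolding n sp by (cases l) (simp_all add: tag_Suc tag_0 h1 h2 h'1 h'2)
  qed
  define l :: "('a \<times> 'a \<Rightarrow> real) \<Rightarrow> ('a \<times> 'a) \<times> real \<Rightarrow> ennreal" where
    "l g \<omega> = ennreal (K^2) * (if snd \<omega> < g (fst \<omega>) then 0 else ennreal (D (fst (fst \<omega>)) (snd (fst \<omega>))))" for g \<omega>
  have le: "ennreal (D (snd (fst \<omega>)) (snd (fst \<omega>'))) \<le> (ennreal (K^2 * \<epsilon>) + l h \<omega>) + l h' \<omega>'" if "tag h \<omega> = tag h' \<omega>'" for \<omega> \<omega>'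
  proof -
    obtain x y u x' y' u' where \<omega>: "\<omega> = ((x, y), u)" "\<omega>' = ((x', y'), u')" by (metis surj_pair)
    have K2: "\<epsilon> \<le> K^2 * \<epsilon>" using one_le_power[OF K_ge_1, of 2] \<epsilon> mult_right_mono[of 1 "K^2" \<epsilon>] by simp
    show ?thesis
    proof (cases "u < h (x, y)")
      case True
      then have "k y = k y'" using that by (auto simp: \<omega> tag_def prod_encode_eq split: if_splits)
      then have "ennreal (D y y') \<le> ennreal (K^2 * \<epsilon>)" using kD[of y y'] K2 by (intro ennreal_leI) simp
      then show ?thesis by (simp add: \<omega> add_increasing2)
    next
      case False
      then have *: "k x = k x'" "\<not> u' < h' (x', y')" using that by (auto simp: \<omega> tag_def prod_encode_eq split: if_splits)
      have K': "K \<le> K^2" using K_ge_1 mult_right_mono[of 1 K K] by (simp add: power2_eq_square)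
      have "D y y' \<le> K * (D x y + D x y')" using D_tri[of y y' x] by (simp add: D_sym)
      also have "\<dots> \<le> K * (D x y + K * (D x x' + D x' y'))"
        using K_ge_1 D_tri[of x y' x'] by (intro mult_left_mono) auto
      also have "\<dots> \<le> K^2 * D x y + K^2 * (\<epsilon> + D x' y')"
      proof -
        have "K * D x y \<le> K^2 * D x y" using K' D_nonneg by (rule mult_right_mono)
        moreover have "K^2 * (D x x' + D x' y') \<le> K^2 * (\<epsilon> + D x' y')"
          using kD[OF *(1)] by (intro mult_left_mono) auto
        ultimately show ?thesis by (simp add: algebra_simps power2_eq_square)
      qed
      also have "\<dots> = K^2 * \<epsilon> + K^2 * D x y + K^2 * D x' y'" by (simp add: algebra_simps)
      finally have "ennreal (D y y') \<le> ennreal (K^2 * \<epsilon> + K^2 * D x y + K^2 * D x' y')" by (rule ennreal_leI)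
      also have "\<dots> = (ennreal (K^2 * \<epsilon>) + l h \<omega>) + l h' \<omega>'"
        using False * \<epsilon> D_nonneg by (simp add: l_def \<omega> ennreal_plus ennreal_mult)
      finally show ?thesis by (simp add: \<omega>)
    qed
  qed
  have lm[measurable]: "l h \<in> borel_measurable ?M" "l h' \<in> borel_measurable ?M'"
    unfolding l_def by measurable
  have dist: "distr ?M borel (\<lambda>\<omega>. snd (fst \<omega>)) = \<nu>" "distr ?M' borel (\<lambda>\<omega>. snd (fst \<omega>)) = \<nu>'"
  proof -
    have "distr ?M borel (\<lambda>\<omega>. snd (fst \<omega>)) = distr (distr ?M \<gamma> fst) borel snd"
      by (subst distr_distr) (auto simp: comp_def)
    then show "distr ?M borel (\<lambda>\<omega>. snd (fst \<omega>)) = \<nu>"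
      by (simp add: U.distr_pair_fst couplingsD(5)[OF \<gamma>])
    have "distr ?M' borel (\<lambda>\<omega>. snd (fst \<omega>)) = distr (distr ?M' \<gamma>' fst) borel snd"
      by (subst distr_distr) (auto simp: comp_def)
    then show "distr ?M' borel (\<lambda>\<omega>. snd (fst \<omega>)) = \<nu>'"
      by (simp add: U.distr_pair_fst couplingsD(5)[OF \<gamma>'])
  qed
  have "W (distr ?M borel (\<lambda>\<omega>. snd (fst \<omega>))) (distr ?M' borel (\<lambda>\<omega>. snd (fst \<omega>)))
      \<le> (\<integral>\<^sup>+\<omega>. ennreal (K^2 * \<epsilon>) + l h \<omega> \<partial>?M) + (\<integral>\<^sup>+\<omega>. l h' \<omega> \<partial>?M')"
  proof (rule transport_cost_index_bound[OF M.prob_space_axioms M'.prob_space_axioms _ _ _ _ law Dm _ _ le])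
    show "tag h \<in> ?M \<rightarrow>\<^sub>M count_space UNIV" "tag h' \<in> ?M' \<rightarrow>\<^sub>M count_space UNIV"
      unfolding tag_def by measurable
  qed measurable
  \<comment> \<open>One \<epsilon> stands for the diameter of the cells and
    \<open>2 * \<epsilon>\<close> for the unrecorded part of each of the two couplings, all
    multiplied by \<open>K^2\<close>; hence the 5.\<close>
  also have "\<dots> \<le> (ennreal (K^2 * \<epsilon>) + ennreal (K^2) * ennreal (2 * \<epsilon>)) + ennreal (K^2) * ennreal (2 * \<epsilon>)"
  proof (intro add_mono)
    have "(\<integral>\<^sup>+\<omega>. l h \<omega> \<partial>?M) \<le> ennreal (K^2) * ennreal (2 * \<epsilon>)"
      unfolding l_def by (subst nn_integral_cmult) (auto intro!: mult_left_mono h3)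
    then show "(\<integral>\<^sup>+\<omega>. ennreal (K^2 * \<epsilon>) + l h \<omega> \<partial>?M) \<le> ennreal (K^2 * \<epsilon>) + ennreal (K^2) * ennreal (2 * \<epsilon>)"
      by (subst nn_integral_add) (auto simp: M.emeasure_space_1)
    show "(\<integral>\<^sup>+\<omega>. l h' \<omega> \<partial>?M') \<le> ennreal (K^2) * ennreal (2 * \<epsilon>)"
      unfolding l_def by (subst nn_integral_cmult) (auto intro!: mult_left_mono h'3)
  qed
  also have "\<dots> = ennreal (5 * K^2 * \<epsilon>)"
    using \<epsilon> by (simp add: ennreal_plus[symmetric] ennreal_mult[symmetric] algebra_simps del: ennreal_plus)
  finally show ?thesis by (simp add: dist)
qed

text \<open>The exceptional sets decrease to the empty set, and the finite cost of \<gamma> permits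
  monotone convergence downwards.\<close>

lemma cost_tail_small:
  fixes k :: "'a \<Rightarrow> nat"
  assumes \<gamma>: "\<gamma> \<in> couplings \<mu> \<nu>" and fin: "(\<integral>\<^sup>+p. ennreal (D (fst p) (snd p)) \<partial>\<gamma>) < \<infinity>"
    and k[measurable]: "k \<in> borel \<rightarrow>\<^sub>M count_space UNIV" and \<epsilon>: "0 < \<epsilon>"
  shows "\<exists>N. (\<integral>\<^sup>+p. ennreal (D (fst p) (snd p)) *
    indicator {p. \<not> (k (fst p) < N \<and> k (snd p) < N \<and> D (fst p) (snd p) \<le> real N)} p \<partial>\<gamma>) \<le> ennreal \<epsilon>"
proof -
  note [measurable_cong] = sets_coupling[OF \<gamma>]
  define Out where "Out N = {p. \<not> (k (fst p) < N \<and> k (snd p) < N \<and> D (fst p) (snd p) \<le> real N)}" for N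
  define f where "f N p = ennreal (D (fst p) (snd p)) * indicator (Out N) p" for N p
  have Out[measurable]: "Out N \<in> sets \<gamma>" for N
  proof -
    have "{p \<in> space \<gamma>. \<not> (k (fst p) < N \<and> k (snd p) < N \<and> D (fst p) (snd p) \<le> real N)} \<in> sets \<gamma>" by measurable
    then show ?thesis by (simp add: Out_def couplingsD(3)[OF \<gamma>])
  qed
  have Out_anti: "Out M \<subseteq> Out N" if "N \<le> M" for N M
    using that by (auto simp: Out_def)
  have "(INF N. \<integral>\<^sup>+p. f N p \<partial>\<gamma>) = (\<integral>\<^sup>+p. (INF N. f N p) \<partial>\<gamma>)"
  proof (rule nn_integral_monotone_convergence_INF_decseq[symmetric, where i=0])
    show "decseq f"
      by (intro antimonoI le_funI) (use Out_anti in \<open>auto simp: f_def indicator_def\<close>)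
    show "f N \<in> borel_measurable \<gamma>" for N unfolding f_def by measurable
    have "(\<integral>\<^sup>+p. f 0 p \<partial>\<gamma>) \<le> (\<integral>\<^sup>+p. ennreal (D (fst p) (snd p)) \<partial>\<gamma>)"
      by (intro nn_integral_mono) (auto simp: f_def indicator_def)
    then show "(\<integral>\<^sup>+p. f 0 p \<partial>\<gamma>) < \<infinity>" using fin by simp
  qed
  also have "\<dots> = (\<integral>\<^sup>+p. 0 \<partial>\<gamma>)"
  proof (rule nn_integral_cong)
    fix p
    obtain n where n: "D (fst p) (snd p) \<le> real n" using real_arch_simple by blast
    have "p \<notin> Out (Suc (max (max (k (fst p)) (k (snd p))) n))" using n by (auto simp: Out_def)
    then have "f (Suc (max (max (k (fst p)) (k (snd p))) n)) p = 0" by (simp add: f_def)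
    then have "(INF N. f N p) \<le> 0" by (metis INF_lower UNIV_I)
    then show "(INF N. f N p) = 0" by simp
  qed
  finally have "(INF N. \<integral>\<^sup>+p. f N p \<partial>\<gamma>) < ennreal \<epsilon>" using \<epsilon> by simp
  then obtain N where "(\<integral>\<^sup>+p. f N p \<partial>\<gamma>) < ennreal \<epsilon>" by (auto simp: INF_less_iff)
  then show ?thesis unfolding f_def Out_def by (intro exI[of _ N]) (rule less_imp_le)
qed

text \<open>Measures for which the rounded cell masses of chosen couplings with \<open>\<mu>\<close> agree are close.\<close>

lemma W_countable_net:
  assumes e: "0 < e"
  obtains C where "countable C" "C \<subseteq> {\<nu>. W \<mu> \<nu> < \<infinity>}"
    "\<forall>\<nu>. W \<mu> \<nu> < \<infinity> \<longrightarrow> (\<exists>\<xi>\<in>C. W \<nu> \<xi> < ennreal e)"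
proof -
  \<comment> \<open>The comparison bound is \<open>5 * K^2 * \<epsilon>\<close>; the 6 makes it
    strictly less than \<open>e\<close>.\<close>
  define \<epsilon> where "\<epsilon> = e / (6 * K^2)"
  have K2: "1 \<le> K^2" using K_ge_1 by simp
  then have "0 < K^2" by linarith
  then have \<epsilon>: "0 < \<epsilon>" "5 * K^2 * \<epsilon> < e" using e by (simp_all add: \<epsilon>_def field_simps)
  obtain k :: "'a \<Rightarrow> nat" where k: "k \<in> borel \<rightarrow>\<^sub>M count_space UNIV" and kD: "\<And>x y. k x = k y \<Longrightarrow> D x y \<le> \<epsilon>"
    using fine_index_exists[OF \<epsilon>(1)] by blast
  define E where "E = {\<nu>. W \<mu> \<nu> < \<infinity>}"
  define tail where "tail \<gamma> N = (\<integral>\<^sup>+p. ennreal (D (fst p) (snd p)) *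
    indicator {p. \<not> (k (fst p) < N \<and> k (snd p) < N \<and> D (fst p) (snd p) \<le> real N)} p \<partial>\<gamma>)" for \<gamma> :: "('a \<times> 'a) measure" and N
  have "\<exists>\<gamma> N. \<gamma> \<in> couplings \<mu> \<nu> \<and> tail \<gamma> N \<le> ennreal \<epsilon>" if "\<nu> \<in> E" for \<nu>
  proof -
    have "W \<mu> \<nu> < \<infinity>" using that by (simp add: E_def)
    then obtain \<gamma> where \<gamma>: "\<gamma> \<in> couplings \<mu> \<nu>" "(\<integral>\<^sup>+p. ennreal (D (fst p) (snd p)) \<partial>\<gamma>) < \<infinity>"
      by (rule transport_cost_lessE)
    from cost_tail_small[OF \<gamma> k \<epsilon>(1)] \<gamma>(1) show ?thesis unfolding tail_def by blast
  qed
  then obtain \<gamma> N where \<gamma>: "\<And>\<nu>. \<nu> \<in> E \<Longrightarrow> \<gamma> \<nu> \<in> couplings \<mu> \<nu>"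
    and N: "\<And>\<nu>. \<nu> \<in> E \<Longrightarrow> tail (\<gamma> \<nu>) (N \<nu>) \<le> ennreal \<epsilon>"
    by metis
  \<comment> \<open>The denominator for rounding: masses rounded down to multiples of
    \<open>1 / P\<close> err by at most \<open>1 / P\<close>, and multiplication by
    \<open>n ^ 3\<close> keeps this within \<epsilon>.\<close>
  have "\<exists>P::nat. 0 < P \<and> real n ^ 3 \<le> \<epsilon> * real P" for n :: nat
  proof -
    obtain P :: nat where "real n ^ 3 / \<epsilon> \<le> real P" using real_arch_simple by blast
    then have "real n ^ 3 \<le> \<epsilon> * real (Suc P)" using \<epsilon> by (simp add: field_simps)
    then show ?thesis by blast
  qed
  then obtain P :: "nat \<Rightarrow> nat" where P: "\<And>n. 0 < P n" "\<And>n. real n ^ 3 \<le> \<epsilon> * real (P n)" by metis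
  define m where "m \<nu> i j = measure (\<gamma> \<nu>) {p. k (fst p) = i \<and> k (snd p) = j}" for \<nu> i j
  define a where "a \<nu> i j = nat \<lfloor>m \<nu> i j * real (P (N \<nu>))\<rfloor>" for \<nu> i j
  \<comment> \<open>The data range over a countable type. They include \<open>N \<nu>\<close>, which
    also fixes the denominator of the rounding; as rounding is downwards, equal data yield a common
    minorant of both tables of cell masses.\<close>
  define data where "data \<nu> = (N \<nu>, map (\<lambda>i. map (\<lambda>j. a \<nu> i j) [0..<N \<nu>]) [0..<N \<nu>])" for \<nu>
  define q where "q \<nu> i j = real (a \<nu> i j) / real (P (N \<nu>))" for \<nu> i j
  have m0: "0 \<le> m \<nu> i j" for \<nu> i j by (simp add: m_def)
  have q_le: "q \<nu> i j \<le> m \<nu> i j" and gap: "real (N \<nu>) ^ 3 * (m \<nu> i j - q \<nu> i j) \<le> \<epsilon>" for \<nu> i j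
  proof -
    define t where "t = m \<nu> i j * real (P (N \<nu>))"
    have t: "0 \<le> t" by (simp add: t_def m0)
    have a: "real (a \<nu> i j) = of_int \<lfloor>t\<rfloor>" using t by (simp add: a_def t_def)
    have fl: "real (a \<nu> i j) \<le> t" "t \<le> real (a \<nu> i j) + 1" unfolding a by linarith+
    show "q \<nu> i j \<le> m \<nu> i j" using fl(1) P(1)[of "N \<nu>"] by (simp add: q_def t_def divide_le_eq)
    have "m \<nu> i j - q \<nu> i j = (t - real (a \<nu> i j)) / real (P (N \<nu>))"
      using P(1)[of "N \<nu>"] by (simp add: q_def t_def field_simps)
    also have "\<dots> \<le> 1 / real (P (N \<nu>))" using fl(2) by (intro divide_right_mono) auto
    finally have "real (N \<nu>) ^ 3 * (m \<nu> i j - q \<nu> i j) \<le> real (N \<nu>) ^ 3 * (1 / real (P (N \<nu>)))"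
      by (rule mult_left_mono) simp
    also have "\<dots> \<le> \<epsilon>" using P[of "N \<nu>"] by (simp add: divide_le_eq)
    finally show "real (N \<nu>) ^ 3 * (m \<nu> i j - q \<nu> i j) \<le> \<epsilon>" .
  qed
  have close: "W \<nu> \<xi> < ennreal e" if E: "\<nu> \<in> E" "\<xi> \<in> E" and eq: "data \<nu> = data \<xi>" for \<nu> \<xi>
  proof -
    have N_eq: "N \<xi> = N \<nu>" using eq by (simp add: data_def)
    have a_eq: "a \<nu> i j = a \<xi> i j" if "i < N \<nu>" "j < N \<nu>" for i j
      using eq that by (auto simp: data_def)
    have q_eq: "q \<nu> i j = q \<xi> i j" if "i < N \<nu>" "j < N \<nu>" for i j
      using a_eq[OF that] by (simp add: q_def N_eq)
    have "W \<nu> \<xi> \<le> ennreal (5 * K^2 * \<epsilon>)"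
    proof (rule W_le_of_common_minorant[OF \<gamma>[OF E(1)] \<gamma>[OF E(2)] k kD, where N="N \<nu>" and q="q \<nu>"])
      show "0 \<le> q \<nu> i j" for i j by (simp add: q_def)
      fix i j assume ij: "i < N \<nu>" "j < N \<nu>"
      show "q \<nu> i j \<le> measure (\<gamma> \<nu>) {p. k (fst p) = i \<and> k (snd p) = j}"
        using q_le[of \<nu> i j] by (simp add: m_def)
      show "q \<nu> i j \<le> measure (\<gamma> \<xi>) {p. k (fst p) = i \<and> k (snd p) = j}"
        using q_le[of \<xi> i j] by (simp add: m_def q_eq[OF ij])
      show "real (N \<nu>) ^ 3 * (measure (\<gamma> \<nu>) {p. k (fst p) = i \<and> k (snd p) = j} - q \<nu> i j) \<le> \<epsilon>"
        using gap[of \<nu> i j] by (simp add: m_def)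
      show "real (N \<nu>) ^ 3 * (measure (\<gamma> \<xi>) {p. k (fst p) = i \<and> k (snd p) = j} - q \<nu> i j) \<le> \<epsilon>"
        using gap[of \<xi> i j] by (simp add: m_def q_eq[OF ij] N_eq)
    next
      show "(\<integral>\<^sup>+p. ennreal (D (fst p) (snd p)) * indicator {p. \<not> (k (fst p) < N \<nu> \<and> k (snd p) < N \<nu> \<and> D (fst p) (snd p) \<le> real (N \<nu>))} p \<partial>\<gamma> \<nu>) \<le> ennreal \<epsilon>"
        using N[OF E(1)] by (simp only: tail_def)
      show "(\<integral>\<^sup>+p. ennreal (D (fst p) (snd p)) * indicator {p. \<not> (k (fst p) < N \<nu> \<and> k (snd p) < N \<nu> \<and> D (fst p) (snd p) \<le> real (N \<nu>))} p \<partial>\<gamma> \<xi>) \<le> ennreal \<epsilon>"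
        using N[OF E(2)] by (simp only: tail_def N_eq)
    qed (use \<epsilon> in auto)
    also have "\<dots> < ennreal e" using \<epsilon> K2 e by (intro ennreal_lessI) auto
    finally show ?thesis .
  qed
  show ?thesis
  proof (rule that)
    \<comment> \<open>The net consists of one representative for each value of \<open>data\<close>
      that occurs on \<open>E\<close>.\<close>
    show "countable (inv_into E data ` data ` E)" by (rule countable_image[OF countableI_type])
    show "inv_into E data ` data ` E \<subseteq> {\<nu>. W \<mu> \<nu> < \<infinity>}"
      using inv_into_into[of _ data E] by (auto simp: E_def)
    show "\<forall>\<nu>. W \<mu> \<nu> < \<infinity> \<longrightarrow> (\<exists>\<xi>\<in>inv_into E data ` data ` E. W \<nu> \<xi> < ennreal e)"
    proof (intro allI impI)
      fix \<nu> assume "W \<mu> \<nu> < \<infinity>"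
      then have \<nu>: "\<nu> \<in> E" by (simp add: E_def)
      have "W \<nu> (inv_into E data (data \<nu>)) < ennreal e"
        using \<nu> by (intro close) (auto simp: f_inv_into_f intro: inv_into_into)
      then show "\<exists>\<xi>\<in>inv_into E data ` data ` E. W \<nu> \<xi> < ennreal e" using \<nu> by blast
    qed
  qed
qed

text \<open>Growth alone would replace the cost by a multiple of it plus \<open>A\<close>, so the
  bound \<open>r\<close> would be lost. The penalized majorant \<open>h\<close> still integrates to
  less than \<open>r\<close>, and moving \<nu> to \<xi> adds at most \<open>L\<close> times the cost
  of a cheap kernel.\<close>

lemma cost_upper_semicontinuous:
  assumes c0: "\<And>x y. 0 \<le> c x y" and cont: "continuous_on UNIV (\<lambda>(x, y). c x y)"
    and growth: "\<And>x y z. c x z \<le> A + B * c x y + B * D y z" and AB: "0 \<le> A" "0 \<le> B"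
    and less: "transport_cost c \<mu> \<nu> < ennreal r"
  obtains \<delta> where "0 < \<delta>" "\<And>\<xi>. W \<nu> \<xi> < ennreal \<delta> \<Longrightarrow> transport_cost c \<mu> \<xi> < ennreal r"
proof -
  have cont': "continuous_on S (\<lambda>w. c (f w) (g w))" if "continuous_on S f" "continuous_on S g" for S f and g :: "'b::topological_space \<Rightarrow> 'a"
    using continuous_on_compose2[OF cont, of S "\<lambda>w. (f w, g w)"] that by (auto intro: continuous_intros)
  have cm[measurable]: "(\<lambda>p. c (fst p) (snd p)) \<in> borel_measurable (borel \<Otimes>\<^sub>M borel)"
    unfolding borel_prod by (intro borel_measurable_continuous_onI cont' continuous_intros)
  obtain \<gamma> where \<gamma>: "\<gamma> \<in> couplings \<mu> \<nu>" and \<gamma>_less: "(\<integral>\<^sup>+p. ennreal (c (fst p) (snd p)) \<partial>\<gamma>) < ennreal r"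
    using transport_cost_lessE[OF less] .
  interpret \<gamma>: prob_space \<gamma> using \<gamma> by (rule couplingsD)
  note s\<gamma>[measurable_cong] = sets_coupling[OF \<gamma>]
  have fin: "(\<integral>\<^sup>+p. ennreal (A + B * c (fst p) (snd p)) \<partial>\<gamma>) < \<infinity>"
  proof -
    have "(\<integral>\<^sup>+p. ennreal (A + B * c (fst p) (snd p)) \<partial>\<gamma>) = (\<integral>\<^sup>+p. ennreal A + ennreal B * ennreal (c (fst p) (snd p)) \<partial>\<gamma>)"
      using AB c0 by (intro nn_integral_cong) (simp add: ennreal_plus ennreal_mult)
    also have "\<dots> = ennreal A + ennreal B * (\<integral>\<^sup>+p. ennreal (c (fst p) (snd p)) \<partial>\<gamma>)"
      by (simp add: nn_integral_add nn_integral_cmult \<gamma>.emeasure_space_1)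
    also have "\<dots> < \<infinity>"
      using order_less_trans[OF \<gamma>_less ennreal_less_top] by (simp add: ennreal_mult_less_top)
    finally show ?thesis .
  qed
  \<comment> \<open>Here \<open>w\<close> is a pair \<open>(x, y)\<close> drawn from \<gamma>, and
    \<open>z\<close> is the point to which \<open>y\<close> is moved. Small \<open>D y z\<close>
    forces \<open>z\<close> towards \<open>y\<close>, so the limit value is \<open>c x y\<close>;
    growth supplies the integrable majorant \<open>A + B * c x y\<close>.\<close>
  obtain h L where h: "h \<in> borel_measurable borel" and L: "0 \<le> L"
    and le: "\<forall>w z. ennreal (c (fst w) z) \<le> h w + ennreal (L * D (snd w) z)" and h_less: "(\<integral>\<^sup>+w. h w \<partial>\<gamma>) < ennreal r"
  proof (rule penalized_majorant[where M=\<gamma> and f="\<lambda>w z. c (fst w) z" and g="\<lambda>w z. D (snd w) z"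
        and u="\<lambda>w. c (fst w) (snd w)" and a="\<lambda>w. A + B * c (fst w) (snd w)" and b=B and r="ennreal r"])
    show "sets \<gamma> = sets borel" using \<gamma> by (rule couplingsD)
    show "continuous_on UNIV (\<lambda>w. c (fst w) z)" for z by (intro cont' continuous_intros)
    show "continuous_on UNIV (\<lambda>w. D (snd w) z)" for z by (intro continuous_intros)
    show "(\<lambda>n. c (fst w) (s n)) \<longlonglongrightarrow> c (fst w) (snd w)" if "(\<lambda>n. D (snd w) (s n)) \<longlonglongrightarrow> 0" for w and s :: "nat \<Rightarrow> 'a"
      using continuous_on_tendsto_compose[OF cont tendsto_Pair[OF tendsto_const D_conv[OF that]]] by simp
  qed (use c0 D_nonneg growth fin \<gamma>_less in auto)
  have h'[measurable]: "h \<in> borel_measurable (borel \<Otimes>\<^sub>M borel)" using h unfolding borel_prod .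
  obtain s where s: "0 \<le> s" "(\<integral>\<^sup>+w. h w \<partial>\<gamma>) = ennreal s" "s < r"
    using h_less by (cases "\<integral>\<^sup>+w. h w \<partial>\<gamma>") (auto simp: ennreal_less_iff)
  \<comment> \<open>The cheap kernel costs \<open>K * \<delta>\<close>, to be multiplied by
    \<open>L\<close>. The summand 1 makes the final inequality strict and covers
    \<open>L = 0\<close>.\<close>
  define \<delta> where "\<delta> = (r - s) / (L * K + 1)"
  have LK: "0 \<le> L * K" using L K_ge_1 by simp
  have \<delta>: "0 < \<delta>" "s + L * (K * \<delta>) < r"
  proof -
    show "0 < \<delta>" using s(3) LK by (simp add: \<delta>_def)
    then have "L * K * \<delta> < (L * K + 1) * \<delta>" by (simp add: algebra_simps)
    also have "\<dots> = r - s" using LK by (simp add: \<delta>_def)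
    finally show "s + L * (K * \<delta>) < r" by (simp add: mult.assoc)
  qed
  show ?thesis
  proof (rule that[OF \<delta>(1)])
    fix \<xi> assume "W \<nu> \<xi> < ennreal \<delta>"
    then obtain \<kappa> where \<kappa>[measurable]: "\<kappa> \<in> borel \<rightarrow>\<^sub>M prob_algebra borel" and \<kappa>2: "\<nu> \<bind> \<kappa> = \<xi>"
      and c\<kappa>: "(\<integral>\<^sup>+x. (\<integral>\<^sup>+z. D x z \<partial>\<kappa> x) \<partial>\<nu>) \<le> ennreal (K * \<delta>)"
      by (rule cheap_kernel)
    note \<kappa>_sub[measurable] = measurable_prob_algebraD[OF \<kappa>]
    have s\<kappa>[measurable_cong]: "sets (\<kappa> x) = sets borel" and p\<kappa>: "emeasure (\<kappa> x) (space (\<kappa> x)) = 1" for x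
      using measurable_space[OF \<kappa>, of x] by (auto simp: space_prob_algebra prob_space.emeasure_space_1)
    have m: "(\<lambda>x. \<integral>\<^sup>+z. D x z \<partial>\<kappa> x) \<in> borel_measurable borel"
      by (rule nn_integral_measurable_subprob_algebra2[OF _ \<kappa>_sub]) simp
    obtain \<Gamma> where \<Gamma>: "\<Gamma> \<in> couplings \<mu> \<xi>" and int: "\<forall>\<phi>\<in>borel_measurable (borel \<Otimes>\<^sub>M borel).
      (\<integral>\<^sup>+p. \<phi> p \<partial>\<Gamma>) = (\<integral>\<^sup>+p. (\<integral>\<^sup>+z. \<phi> (fst p, z) \<partial>\<kappa> (snd p)) \<partial>\<gamma>)"
      by (rule bexE[OF coupling_compose_kernel[OF \<gamma> \<kappa>, unfolded \<kappa>2]])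
    have "transport_cost c \<mu> \<xi> \<le> (\<integral>\<^sup>+p. ennreal (c (fst p) (snd p)) \<partial>\<Gamma>)" by (rule transport_cost_le[OF \<Gamma>])
    also have "\<dots> = (\<integral>\<^sup>+p. (\<integral>\<^sup>+z. c (fst p) z \<partial>\<kappa> (snd p)) \<partial>\<gamma>)"
      using bspec[OF int, of "\<lambda>p. ennreal (c (fst p) (snd p))"] by simp
    also have "\<dots> \<le> (\<integral>\<^sup>+p. h p + ennreal L * (\<integral>\<^sup>+z. D (snd p) z \<partial>\<kappa> (snd p)) \<partial>\<gamma>)"
    proof (rule nn_integral_mono)
      fix p
      have "(\<integral>\<^sup>+z. c (fst p) z \<partial>\<kappa> (snd p)) \<le> (\<integral>\<^sup>+z. h p + ennreal L * ennreal (D (snd p) z) \<partial>\<kappa> (snd p))"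
      proof (rule nn_integral_mono)
        fix z
        show "ennreal (c (fst p) z) \<le> h p + ennreal L * ennreal (D (snd p) z)"
          using le[rule_format, of p z] L D_nonneg by (simp add: ennreal_mult)
      qed
      also have "\<dots> = h p + ennreal L * (\<integral>\<^sup>+z. D (snd p) z \<partial>\<kappa> (snd p))"
        by (simp add: nn_integral_add nn_integral_cmult p\<kappa>)
      finally show "(\<integral>\<^sup>+z. c (fst p) z \<partial>\<kappa> (snd p)) \<le> h p + ennreal L * (\<integral>\<^sup>+z. D (snd p) z \<partial>\<kappa> (snd p))" .
    qed
    also have "\<dots> = (\<integral>\<^sup>+p. h p \<partial>\<gamma>) + ennreal L * (\<integral>\<^sup>+p. (\<integral>\<^sup>+z. D (snd p) z \<partial>\<kappa> (snd p)) \<partial>\<gamma>)"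
      using m by (simp add: nn_integral_add nn_integral_cmult)
    also have "\<dots> \<le> ennreal s + ennreal L * ennreal (K * \<delta>)"
      unfolding s(2) nn_integral_coupling(2)[OF \<gamma> m] by (intro add_left_mono mult_left_mono c\<kappa>) simp
    also have "\<dots> = ennreal (s + L * (K * \<delta>))"
      using s(1) L K_ge_1 \<delta>(1) by (simp add: ennreal_plus ennreal_mult)
    also have "\<dots> < ennreal r" using \<delta> s L K_ge_1 by (intro ennreal_lessI) auto
    finally show "transport_cost c \<mu> \<xi> < ennreal r" .
  qed
qed

text \<open>The same penalization with the roles of the costs exchanged: \<open>D\<close> vanishes
  in the limit when \<open>c\<close> does, so \<open>h\<close> has a small integral against \<nu>.
  The slope \<open>L\<close>, and with it \<delta>, depends on \<nu>, which is as much as pointwise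
  consistency is used to give. Since \<open>h\<close> depends on the first component only, any
  coupling can be inserted.\<close>

lemma W_small_of_cost_small:
  assumes c0: "\<And>x y. 0 \<le> c x y" and cont: "continuous_on UNIV (\<lambda>(x, y). c x y)"
    and growth: "\<And>x y. D x y \<le> A + B * c x y" and A: "0 \<le> A"
    and conv: "\<And>x s. (\<lambda>n. c x (s n)) \<longlonglongrightarrow> 0 \<Longrightarrow> s \<longlonglongrightarrow> x"
    and \<nu>: "\<nu> \<in> prob_measures" and e: "0 < e"
  obtains \<delta> where "0 < \<delta>" "\<And>\<xi>. transport_cost c \<nu> \<xi> < ennreal \<delta> \<Longrightarrow> W \<nu> \<xi> < ennreal e"
proof -
  have cont': "continuous_on S (\<lambda>w. c (f w) (g w))" if "continuous_on S f" "continuous_on S g" for S f and g :: "'b::topological_space \<Rightarrow> 'a"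
    using continuous_on_compose2[OF cont, of S "\<lambda>w. (f w, g w)"] that by (auto intro: continuous_intros)
  have cm[measurable]: "(\<lambda>p. c (fst p) (snd p)) \<in> borel_measurable (borel \<Otimes>\<^sub>M borel)"
    unfolding borel_prod by (intro borel_measurable_continuous_onI cont' continuous_intros)
  interpret \<nu>: prob_space \<nu> using \<nu> by (rule prob_measuresD)
  obtain h L where h: "h \<in> borel_measurable borel" and L: "0 \<le> L"
    and le: "\<forall>w z. ennreal (D w z) \<le> h w + ennreal (L * c w z)" and h_less: "(\<integral>\<^sup>+w. h w \<partial>\<nu>) < ennreal e"
  proof (rule penalized_majorant[where M=\<nu> and f=D and g=c and u="\<lambda>_::'a. 0::real" and a="\<lambda>_::'a. A" and b=B and r="ennreal e"])
    show "sets \<nu> = sets borel" using \<nu> by (rule prob_measuresD)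
    show "continuous_on UNIV (\<lambda>w. D w z)" for z by (intro continuous_intros)
    show "continuous_on UNIV (\<lambda>w. c w z)" for z by (intro cont' continuous_intros)
    show "(\<lambda>n. D w (s n)) \<longlonglongrightarrow> 0" if "(\<lambda>n. c w (s n)) \<longlonglongrightarrow> 0" for w s
      using tendsto_D[OF tendsto_const conv[OF that], of w] by (simp add: D_refl)
  qed (use c0 growth A e in \<open>auto simp: \<nu>.emeasure_space_1 ennreal_mult_less_top\<close>)
  obtain s where s: "0 \<le> s" "(\<integral>\<^sup>+w. h w \<partial>\<nu>) = ennreal s" "s < e"
    using h_less by (cases "\<integral>\<^sup>+w. h w \<partial>\<nu>") (auto simp: ennreal_less_iff)
  define \<delta> where "\<delta> = (e - s) / (L + 1)"
  have \<delta>: "0 < \<delta>" "s + L * \<delta> < e"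
  proof -
    show "0 < \<delta>" using s(3) L by (simp add: \<delta>_def)
    then have "L * \<delta> < (L + 1) * \<delta>" by (simp add: algebra_simps)
    also have "\<dots> = e - s" using L by (simp add: \<delta>_def)
    finally show "s + L * \<delta> < e" by simp
  qed
  show ?thesis
  proof (rule that[OF \<delta>(1)])
    fix \<xi> assume "transport_cost c \<nu> \<xi> < ennreal \<delta>"
    then obtain \<gamma> where \<gamma>: "\<gamma> \<in> couplings \<nu> \<xi>" and less: "(\<integral>\<^sup>+p. ennreal (c (fst p) (snd p)) \<partial>\<gamma>) < ennreal \<delta>"
      by (rule transport_cost_lessE)
    note s\<gamma>[measurable_cong] = sets_coupling[OF \<gamma>]
    have "W \<nu> \<xi> \<le> (\<integral>\<^sup>+p. ennreal (D (fst p) (snd p)) \<partial>\<gamma>)" by (rule transport_cost_le[OF \<gamma>])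
    also have "\<dots> \<le> (\<integral>\<^sup>+p. h (fst p) + ennreal L * ennreal (c (fst p) (snd p)) \<partial>\<gamma>)"
      using le L c0 by (intro nn_integral_mono) (auto simp: ennreal_mult[symmetric])
    also have "\<dots> = (\<integral>\<^sup>+p. h (fst p) \<partial>\<gamma>) + ennreal L * (\<integral>\<^sup>+p. ennreal (c (fst p) (snd p)) \<partial>\<gamma>)"
      using h by (simp add: nn_integral_add nn_integral_cmult)
    also have "\<dots> \<le> ennreal s + ennreal L * ennreal \<delta>"
      unfolding nn_integral_coupling(1)[OF \<gamma> h] s(2) using less by (intro add_left_mono mult_left_mono) auto
    also have "\<dots> = ennreal (s + L * \<delta>)"
      using s(1) L \<delta>(1) by (simp add: ennreal_plus ennreal_mult)
    also have "\<dots> < ennreal e" using \<delta> s L by (intro ennreal_lessI) auto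
    finally show "W \<nu> \<xi> < ennreal e" .
  qed
qed

end

section \<open>Tightness\<close>

text \<open>Ulam's argument: for each \<open>k\<close>, finitely many closed balls of radius
  \<open>1 / (k + 1)\<close> carry nearly all the mass; the intersection of these unions is closed
  and totally bounded, hence compact by completeness.\<close>

lemma (in Metric_space) complete_separable_imp_radon_space:
  assumes complete: mcomplete and C: "countable C" "C \<subseteq> M" "\<And>x e. x \<in> M \<Longrightarrow> 0 < e \<Longrightarrow> \<exists>y\<in>C. d y x < e"
  shows "radon_space mtopology"
  unfolding radon_space_def
proof (intro conjI allI impI)
  have "mtopology closure_of C = M"
  proof
    show "mtopology closure_of C \<subseteq> M" using closure_of_subset_topspace[of mtopology C] by simp
    show "M \<subseteq> mtopology closure_of C"
    proof
      fix x assume x: "x \<in> M"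
      have "\<exists>y\<in>C. y \<in> mball x r" if "0 < r" for r
        using C(3)[OF x that] C(2) x by (auto simp: commute)
      with x show "x \<in> mtopology closure_of C" by (simp add: metric_closure_of)
    qed
  qed
  then show "separable_space mtopology"
    using C(1,2) unfolding separable_space_def topspace_mtopology by blast
  show "metrizable_space mtopology" by (rule metrizable_space_mtopology)
  fix Q :: "'a measure" and \<epsilon> :: real
  assume "prob_space Q" and sets_Q: "sets Q = sets (borel_of mtopology)" and \<epsilon>: "0 < \<epsilon>"
  interpret Q: prob_space Q by fact
  have Q_open: "U \<in> sets Q" if "openin mtopology U" for U
  proof -
    have "{U. openin mtopology U} \<subseteq> Pow (topspace mtopology)" using openin_subset by blast
    with that show ?thesis
      unfolding sets_Q borel_of_def by (subst sets_measure_of) (auto intro: sigma_sets.Basic)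
  qed
  have sp: "space Q = M"
    using sets_eq_imp_space_eq[OF sets_Q] unfolding borel_of_def space_measure_of_conv by simp
  have Q_closed: "F \<in> sets Q" if "closedin mtopology F" for F
  proof -
    have "M - F \<in> sets Q" using that by (intro Q_open) (simp add: closedin_def)
    then have "M - (M - F) \<in> sets Q" using sets.compl_sets[of "M - F" Q] by (simp add: sp)
    moreover have "M - (M - F) = F" using closedin_subset[OF that] by auto
    ultimately show ?thesis by simp
  qed
  have "M \<noteq> {}" using Q.not_empty sp by simp
  then have "C \<noteq> {}" using C(3)[of _ 1] by auto
  define x where "x = from_nat_into C"
  have xM: "x n \<in> M" for n using from_nat_into[OF \<open>C \<noteq> {}\<close>] C(2) by (auto simp: x_def)
  define B where "B k N = (\<Union>n\<le>N. mcball (x n) (1 / real (Suc k)))" for k N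
  have B_closed: "closedin mtopology (B k N)" for k N
    unfolding B_def by (rule closedin_Union) (auto simp: closedin_mcball)
  have B_sets[measurable]: "B k N \<in> sets Q" for k N by (rule Q_closed[OF B_closed])
  \<comment> \<open>The errors sum to \<open>\<epsilon> / 2\<close>, which leaves room for the
    strict inequality.\<close>
  have "\<exists>N. measure Q (space Q - B k N) < \<epsilon> / 2 ^ Suc (Suc k)" for k
  proof -
    have "(\<lambda>N. measure Q (B k N)) \<longlonglongrightarrow> measure Q (\<Union>N. B k N)"
    proof (rule Q.finite_Lim_measure_incseq)
      show "incseq (B k)" unfolding B_def by (intro monoI UN_mono) auto
    qed auto
    moreover have "(\<Union>N. B k N) = space Q"
    proof
      show "(\<Union>N. B k N) \<subseteq> space Q" by (auto simp: B_def sp)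
      show "space Q \<subseteq> (\<Union>N. B k N)"
      proof
        fix y assume "y \<in> space Q"
        then have y: "y \<in> M" by (simp add: sp)
        then obtain z where z: "z \<in> C" "d z y < 1 / real (Suc k)" using C(3)[OF y, of "1 / real (Suc k)"] by auto
        obtain n where "x n = z" using from_nat_into_surj[OF C(1) z(1)] by (auto simp: x_def)
        then have "y \<in> B k n" using z y xM[of n] by (auto simp: B_def intro!: bexI[of _ n])
        then show "y \<in> (\<Union>N. B k N)" by blast
      qed
    qed
    ultimately have "(\<lambda>N. measure Q (B k N)) \<longlonglongrightarrow> 1" by (simp add: Q.prob_space)
    then have "\<forall>\<^sub>F N in sequentially. 1 - \<epsilon> / 2 ^ Suc (Suc k) < measure Q (B k N)"
      using \<epsilon> by (intro order_tendstoD(1)) auto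
    then obtain N where "1 - \<epsilon> / 2 ^ Suc (Suc k) < measure Q (B k N)"
      by (auto simp: eventually_sequentially)
    then show ?thesis by (intro exI[of _ N]) (simp add: Q.prob_compl)
  qed
  then obtain N where N: "\<And>k. measure Q (space Q - B k (N k)) < \<epsilon> / 2 ^ Suc (Suc k)" by metis
  define D where "D = (\<Inter>k. B k (N k))"
  have D_closed: "closedin mtopology D"
    unfolding D_def by (intro closedin_Inter) (auto simp: B_closed)
  have "mtotally_bounded D"
    unfolding mtotally_bounded_def
  proof (intro allI impI)
    fix e :: real assume "0 < e"
    then obtain k where k: "1 / real (Suc k) < e / 2" using nat_approx_posE[of "e / 2"] by auto
    \<comment> \<open>A finite net inside \<open>D\<close> is required, but the centres
      \<open>x n\<close> may lie outside. Each centre close to \<open>D\<close> is replaced by a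
      point of \<open>D\<close>, which doubles the radius and explains the bound
      \<open>e / 2\<close>.\<close>
    define I where "I = {n. n \<le> N k \<and> (\<exists>z\<in>D. d (x n) z \<le> 1 / real (Suc k))}"
    then have "\<forall>n\<in>I. \<exists>z\<in>D. d (x n) z \<le> 1 / real (Suc k)" by blast
    then obtain z where z: "\<And>n. n \<in> I \<Longrightarrow> z n \<in> D \<and> d (x n) (z n) \<le> 1 / real (Suc k)" by metis
    have DM: "D \<subseteq> M" using closedin_subset[OF D_closed] by simp
    show "\<exists>K. finite K \<and> K \<subseteq> D \<and> D \<subseteq> (\<Union>x\<in>K. mball x e)"
    proof (intro exI[of _ "z ` I"] conjI subsetI)
      show "finite (z ` I)" by (simp add: I_def)
      show "y \<in> D" if "y \<in> z ` I" for y using that z by auto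
      fix y assume y: "y \<in> D"
      then have "y \<in> B k (N k)" by (simp add: D_def)
      then obtain n where n: "n \<le> N k" "d (x n) y \<le> 1 / real (Suc k)" by (auto simp: B_def)
      then have "n \<in> I" using y by (auto simp: I_def)
      have "d (z n) y \<le> d (x n) (z n) + d (x n) y"
        using triangle[of "z n" "x n" y] commute[of "x n" "z n"] z[OF \<open>n \<in> I\<close>] y DM xM[of n] by auto
      also have "\<dots> < e" using z[OF \<open>n \<in> I\<close>] n k by linarith
      finally show "y \<in> (\<Union>x\<in>z ` I. mball x e)"
        using y z[OF \<open>n \<in> I\<close>] DM \<open>n \<in> I\<close> by auto
    qed
  qed
  then have "compactin mtopology (mtopology closure_of D)"
    using mtotally_bounded_eq_compact_closure_of[OF complete, of D] closedin_subset[OF D_closed] by simp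
  then have D_compact: "compactin mtopology D" using D_closed by (simp add: closure_of_closedin)
  have "measure Q (space Q - D) = measure Q (\<Union>k. space Q - B k (N k))"
    by (rule arg_cong[where f="measure Q"]) (auto simp: D_def)
  also have "\<dots> \<le> (\<Sum>k. measure Q (space Q - B k (N k)))"
  proof (rule Q.finite_measure_subadditive_countably)
    show "summable (\<lambda>k. measure Q (space Q - B k (N k)))"
    proof (rule summable_comparison_test')
      show "summable (\<lambda>k. \<epsilon> / 4 * (1 / 2) ^ k)" by (intro summable_mult summable_geometric) simp
      show "norm (measure Q (space Q - B k (N k))) \<le> \<epsilon> / 4 * (1 / 2) ^ k" for k
        using N[of k] by (simp add: field_simps)
    qed
  qed auto
  also have "\<dots> \<le> (\<Sum>k. \<epsilon> / 4 * (1 / 2) ^ k)"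
  proof (rule suminf_le)
    show "summable (\<lambda>k. \<epsilon> / 4 * (1 / 2) ^ k)" by (intro summable_mult summable_geometric) simp
    then show "summable (\<lambda>k. measure Q (space Q - B k (N k)))"
      by (rule summable_comparison_test') (use N in \<open>auto simp: field_simps intro: less_imp_le\<close>)
    show "measure Q (space Q - B k (N k)) \<le> \<epsilon> / 4 * (1 / 2) ^ k" for k
      using N[of k] by (simp add: field_simps)
  qed
  also have "\<dots> = \<epsilon> / 2" by (subst suminf_mult) (auto simp: suminf_geometric summable_geometric)
  finally have "measure Q (space Q - D) < \<epsilon>" using \<epsilon> by simp
  with D_compact show "\<exists>D. compactin mtopology D \<and> measure Q (space Q - D) < \<epsilon>" by blast
qed

section \<open>Costs of controlled growth\<close>

locale growth_cost =
  fixes c :: "'a::{metric_space, second_countable_topology} \<Rightarrow> 'a \<Rightarrow> real" and A B :: real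
  assumes c_nonneg: "0 \<le> c x y"
    and c_cont: "continuous_on UNIV (\<lambda>(x, y). c x y)"
    and consistent: "consistent_cost c"
    and AB: "0 \<le> A" "0 \<le> B"
    and growth_right: "c x y \<le> A + B * (c x z + c z y)"
    and growth_mixed: "c x y \<le> A + B * (c x z + c y z)"
    and growth_left: "c x y \<le> A + B * (c z x + c y z)"
    and compact_balls: "\<exists>x\<^sub>0. \<forall>r\<ge>0. compact {y. c x\<^sub>0 y \<le> r}"
begin

lemma c_right_iff: "(\<lambda>n. c x (s n)) \<longlonglongrightarrow> 0 \<longleftrightarrow> s \<longlonglongrightarrow> x"
  and c_left_iff: "(\<lambda>n. c (s n) x) \<longlonglongrightarrow> 0 \<longleftrightarrow> s \<longlonglongrightarrow> x"
  using consistent by (auto simp: consistent_cost_def)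

lemma c_refl: "c x x = 0"
  using c_right_iff[of x "\<lambda>_. x"] by (simp add: LIMSEQ_const_iff)

lemma tendsto_c: "f \<longlonglongrightarrow> x \<Longrightarrow> g \<longlonglongrightarrow> y \<Longrightarrow> (\<lambda>n. c (f n) (g n)) \<longlonglongrightarrow> c x y"
  using continuous_on_tendsto_compose[OF c_cont, of "\<lambda>n. (f n, g n)" "(x, y)" sequentially]
  by (auto intro: tendsto_Pair)

text \<open>Growth places a cost ball about any \<open>x\<close> inside one about the base point,
  which is compact. The maximum with 0 keeps the radius \<open>R\<close> nonnegative whatever
  \<open>r\<close> is.\<close>

lemma bounded_subsequence:
  assumes "\<And>n. c x (s n) \<le> r"
  obtains l \<phi> where "strict_mono (\<phi> :: nat \<Rightarrow> nat)" "(\<lambda>n. s (\<phi> n)) \<longlonglongrightarrow> l"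
proof -
  obtain x0 where x0: "\<And>r. 0 \<le> r \<Longrightarrow> compact {y. c x0 y \<le> r}" using compact_balls by blast
  define R where "R = A + B * (c x0 x + max 0 r)"
  have R: "0 \<le> R" using AB c_nonneg by (simp add: R_def)
  have "s n \<in> {y. c x0 y \<le> R}" for n
  proof -
    have "c x0 (s n) \<le> A + B * (c x0 x + c x (s n))" by (rule growth_right)
    also have "\<dots> \<le> R" unfolding R_def using AB assms[of n] by (intro add_left_mono mult_left_mono) auto
    finally show ?thesis by simp
  qed
  with x0[OF R] obtain l \<phi> where "strict_mono (\<phi> :: nat \<Rightarrow> nat)" "(s \<circ> \<phi>) \<longlonglongrightarrow> l"
    unfolding compact_eq_seq_compact_metric by (meson seq_compactE)
  then show ?thesis by (intro that) (auto simp: comp_def)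
qed

text \<open>Consistency only controls \<open>c\<close> near a given point; \<open>\<rho>\<close> is a compatible metric which
  dominates \<open>min 1 c\<close>.\<close>

definition \<rho> :: "'a \<Rightarrow> 'a \<Rightarrow> real" where
  "\<rho> x y = (SUP w. \<bar>min 1 (c w x) - min 1 (c w y)\<bar>)"

lemma rho_upper: "\<bar>min 1 (c w x) - min 1 (c w y)\<bar> \<le> \<rho> x y"
  and rho_least: "(\<And>w. \<bar>min 1 (c w x) - min 1 (c w y)\<bar> \<le> t) \<Longrightarrow> \<rho> x y \<le> t"
proof -
  have "\<bar>min 1 (c w x) - min 1 (c w y)\<bar> \<le> 1" for w
    using c_nonneg[of w x] c_nonneg[of w y] by (auto simp: min_def)
  then have "bdd_above (range (\<lambda>w. \<bar>min 1 (c w x) - min 1 (c w y)\<bar>))" by (intro bdd_aboveI[of _ 1]) auto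
  then show "\<bar>min 1 (c w x) - min 1 (c w y)\<bar> \<le> \<rho> x y" unfolding \<rho>_def by (intro cSUP_upper) auto
  show "\<rho> x y \<le> t" if "\<And>w. \<bar>min 1 (c w x) - min 1 (c w y)\<bar> \<le> t" unfolding \<rho>_def using that by (intro cSUP_least) auto
qed

lemma rho_nonneg: "0 \<le> \<rho> x y"
  using rho_upper[of x x y] by (rule order_trans[rotated]) simp

lemma rho_le_1: "\<rho> x y \<le> 1"
proof (rule rho_least)
  fix w
  show "\<bar>min 1 (c w x) - min 1 (c w y)\<bar> \<le> 1"
    using c_nonneg[of w x] c_nonneg[of w y] by (auto simp: min_def)
qed

lemma rho_sym: "\<rho> x y = \<rho> y x"
  by (simp add: \<rho>_def abs_minus_commute)

lemma rho_refl: "\<rho> x x = 0"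
  by (simp add: \<rho>_def)

lemma rho_tri: "\<rho> x z \<le> \<rho> x y + \<rho> y z"
proof (rule rho_least)
  fix w
  show "\<bar>min 1 (c w x) - min 1 (c w z)\<bar> \<le> \<rho> x y + \<rho> y z"
    using rho_upper[of w x y] rho_upper[of w y z] by linarith
qed

text \<open>The choice \<open>w = x\<close> in the supremum gives \<open>min 1 (c x y)\<close>, and
  below 1 the truncation is inactive.\<close>

lemma c_le_rho: "\<rho> x y < 1 \<Longrightarrow> c x y \<le> \<rho> x y"
  using rho_upper[of x x y] c_nonneg[of x y] by (auto simp: c_refl min_def split: if_splits)

text \<open>Pointwise continuity is not enough under a supremum over \<open>w\<close>. Points
  \<open>w n\<close> at which a gap persists stay in a bounded set, hence subconverge to some
  \<open>l\<close>; there joint continuity of the cost closes the gap.\<close>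

lemma rho_tendsto_0:
  assumes s: "s \<longlonglongrightarrow> x"
  shows "(\<lambda>n. \<rho> (s n) x) \<longlonglongrightarrow> 0"
proof (rule ccontr)
  assume "\<not> ?thesis"
  then obtain e where e: "0 < e" "\<exists>\<^sub>F n in sequentially. e \<le> \<rho> (s n) x"
    using rho_nonneg by (auto simp: tendsto_iff dist_real_def not_eventually not_less)
  then obtain \<phi> :: "nat \<Rightarrow> nat" where \<phi>: "strict_mono \<phi>" "\<And>n. e \<le> \<rho> (s (\<phi> n)) x"
    using infinite_enumerate[of "{n. e \<le> \<rho> (s n) x}"]
    by (auto simp: frequently_cofinite[symmetric] cofinite_eq_sequentially)
  define t where "t n = s (\<phi> n)" for n
  have t: "t \<longlonglongrightarrow> x" unfolding t_def using LIMSEQ_subseq_LIMSEQ[OF s \<phi>(1)] by (simp add: comp_def)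
  have "\<exists>w. e / 2 < \<bar>min 1 (c w (t n)) - min 1 (c w x)\<bar>" for n
  proof (rule ccontr)
    assume "\<not> ?thesis"
    then have "\<rho> (t n) x \<le> e / 2" by (intro rho_least) (auto simp: not_less)
    then show False using \<phi>(2)[of n] e(1) by (simp add: t_def)
  qed
  then obtain w where w: "\<And>n. e / 2 < \<bar>min 1 (c (w n) (t n)) - min 1 (c (w n) x)\<bar>" by metis
  have "(\<lambda>n. c x (t n)) \<longlonglongrightarrow> 0" using t by (simp add: c_right_iff)
  then have "Bseq (\<lambda>n. c x (t n))" by (intro convergent_imp_Bseq) (auto simp: convergent_def)
  then obtain b where b: "\<And>n. c x (t n) \<le> b" using c_nonneg by (auto simp: Bseq_def)
  have "c x (w n) \<le> A + B * (max 0 b + 1)" for n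
  proof -
    \<comment> \<open>If both costs exceeded 1, both truncations would equal 1 and there would be no
      gap. This is what truncation is for.\<close>
    have "c (w n) (t n) \<le> 1 \<or> c (w n) x \<le> 1" using w[of n] e(1) by (auto simp: min_def split: if_splits)
    then show ?thesis
    proof
      assume "c (w n) (t n) \<le> 1"
      with growth_mixed[of x "w n" "t n"] show ?thesis
        using AB b[of n] by (elim order_trans) (intro add_left_mono mult_left_mono add_mono, auto)
    next
      assume "c (w n) x \<le> 1"
      with growth_mixed[of x "w n" x] show ?thesis
        using AB by (elim order_trans) (intro add_left_mono mult_left_mono add_mono, auto simp: c_refl)
    qed
  qed
  then obtain l \<psi> where \<psi>: "strict_mono (\<psi> :: nat \<Rightarrow> nat)" "(\<lambda>n. w (\<psi> n)) \<longlonglongrightarrow> l"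
    by (rule bounded_subsequence)
  have "(\<lambda>n. t (\<psi> n)) \<longlonglongrightarrow> x" using LIMSEQ_subseq_LIMSEQ[OF t \<psi>(1)] by (simp add: comp_def)
  then have "(\<lambda>n. \<bar>min 1 (c (w (\<psi> n)) (t (\<psi> n))) - min 1 (c (w (\<psi> n)) x)\<bar>) \<longlonglongrightarrow> \<bar>min 1 (c l x) - min 1 (c l x)\<bar>"
    using \<psi>(2) by (intro tendsto_intros tendsto_min tendsto_c)
  then have "e / 2 \<le> \<bar>min 1 (c l x) - min 1 (c l x)\<bar>"
    using w by (intro LIMSEQ_le_const) (auto intro: less_imp_le)
  then show False using e(1) by simp
qed

text \<open>The two cost terms make \<open>D\<close> symmetric and control large distances; \<rho>
  supplies the triangle inequality at small scale.\<close>

definition D :: "'a \<Rightarrow> 'a \<Rightarrow> real" where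
  "D x y = \<rho> x y + c x y + c y x"

text \<open>The 3 serves the case \<open>\<rho> x z < 1\<close>, where each of the three terms of
  \<open>D x z\<close> is at most \<open>\<rho> x z\<close>. In the other case the constants
  \<open>1 + 2 * A\<close> are multiplied by a quantity that is at least 1, and \<open>B\<close>
  comes from growth. The sum covers both.\<close>

definition K :: real where
  "K = 3 + 2 * A + B"

lemma c_le_D: "c x y \<le> D x y" "c y x \<le> D x y"
  using rho_nonneg c_nonneg by (simp_all add: D_def)

lemma c_swap: "c y x \<le> A + B * c x y"
  using growth_left[of y x y] by (simp add: c_refl)

lemma D_le_c: "D x y \<le> (1 + A) + (1 + B) * c x y"
  using rho_le_1[of x y] c_swap[of y x] by (simp add: D_def algebra_simps)

sublocale quasi_cost D K
proof
  fix x y z :: 'a and s :: "nat \<Rightarrow> 'a"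
  show "0 \<le> D x y" using rho_nonneg c_nonneg by (simp add: D_def)
  show "D x x = 0" by (simp add: D_def rho_refl c_refl)
  show "D x y = D y x" by (simp add: D_def rho_sym[of x y])
  show "1 \<le> K" using AB by (simp add: K_def)
  show "D x z \<le> K * (D x y + D y z)"
  proof (cases "\<rho> x z < 1")
    case True
    have "D x z \<le> 3 * \<rho> x z"
      using c_le_rho[of x z] c_le_rho[of z x] True by (simp add: D_def rho_sym[of z x])
    also have "\<dots> \<le> 3 * (D x y + D y z)"
      using rho_tri[of x z y] c_nonneg[of x y] c_nonneg[of y x] c_nonneg[of y z] c_nonneg[of z y] by (simp add: D_def)
    also have "\<dots> \<le> K * (D x y + D y z)"
      using AB rho_nonneg c_nonneg by (intro mult_right_mono) (simp_all add: K_def D_def)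
    finally show ?thesis .
  next
    case False
    define S where "S = D x y + D y z"
    have 1: "1 \<le> \<rho> x y + \<rho> y z" using False rho_tri[of x z y] by simp
    have S: "\<rho> x y + \<rho> y z \<le> S" "(c x y + c y z) + (c z y + c y x) \<le> S"
      using rho_nonneg[of x y] rho_nonneg[of y z] c_nonneg[of x y] c_nonneg[of y x] c_nonneg[of y z] c_nonneg[of z y]
      by (simp_all add: S_def D_def)
    have "D x z \<le> 1 + (A + B * (c x y + c y z)) + (A + B * (c z y + c y x))"
      unfolding D_def by (intro add_mono rho_le_1 growth_right)
    also have "\<dots> = 1 + 2 * A * 1 + B * ((c x y + c y z) + (c z y + c y x))" by (simp add: algebra_simps)
    also have "\<dots> \<le> S + 2 * A * S + B * S"
      using AB 1 S by (intro add_mono mult_left_mono) auto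
    also have "\<dots> \<le> K * S" using S 1 by (simp add: K_def algebra_simps)
    finally show ?thesis by (simp add: S_def)
  qed
  show "continuous_on UNIV (\<lambda>(x, y). D x y)"
  proof (rule continuous_on_sequentiallyI)
    fix u and a :: "'a \<times> 'a" assume u: "u \<longlonglongrightarrow> a"
    then have f: "(\<lambda>n. fst (u n)) \<longlonglongrightarrow> fst a" and g: "(\<lambda>n. snd (u n)) \<longlonglongrightarrow> snd a"
      by (auto intro: tendsto_fst tendsto_snd)
    have "(\<lambda>n. \<rho> (fst (u n)) (snd (u n))) \<longlonglongrightarrow> \<rho> (fst a) (snd a)"
    proof (rule LIM_zero_cancel, rule Lim_null_comparison)
      have "(\<lambda>n. \<rho> (fst (u n)) (fst a) + \<rho> (snd (u n)) (snd a)) \<longlonglongrightarrow> 0 + 0"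
        by (intro tendsto_add rho_tendsto_0 f g)
      then show "(\<lambda>n. \<rho> (fst (u n)) (fst a) + \<rho> (snd (u n)) (snd a)) \<longlonglongrightarrow> 0" by simp
      show "\<forall>\<^sub>F n in sequentially. norm (\<rho> (fst (u n)) (snd (u n)) - \<rho> (fst a) (snd a)) \<le> \<rho> (fst (u n)) (fst a) + \<rho> (snd (u n)) (snd a)"
      proof (intro always_eventually allI)
        fix n
        show "norm (\<rho> (fst (u n)) (snd (u n)) - \<rho> (fst a) (snd a)) \<le> \<rho> (fst (u n)) (fst a) + \<rho> (snd (u n)) (snd a)"
          using rho_tri[of "fst (u n)" "snd (u n)" "fst a"] rho_tri[of "fst a" "snd (u n)" "snd a"]
            rho_tri[of "fst a" "snd a" "fst (u n)"] rho_tri[of "fst (u n)" "snd a" "snd (u n)"]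
            rho_sym[of "fst a" "fst (u n)"] rho_sym[of "snd a" "snd (u n)"]
          by (simp add: abs_le_iff)
      qed
    qed
    then show "(\<lambda>n. case u n of (x, y) \<Rightarrow> D x y) \<longlonglongrightarrow> (case a of (x, y) \<Rightarrow> D x y)"
      unfolding D_def case_prod_unfold by (intro tendsto_add tendsto_c f g)
  qed
  show "s \<longlonglongrightarrow> x" if "(\<lambda>n. D x (s n)) \<longlonglongrightarrow> 0"
  proof -
    have "(\<lambda>n. c x (s n)) \<longlonglongrightarrow> 0"
      using tendsto_sandwich[OF _ _ tendsto_const that, of "\<lambda>n. c x (s n)"] c_nonneg c_le_D by simp
    then show ?thesis by (simp add: c_right_iff)
  qed
  show "convergent s" if Cauchy: "\<And>e. 0 < e \<Longrightarrow> \<exists>N. \<forall>m\<ge>N. \<forall>n\<ge>N. D (s m) (s n) < e"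
  proof -
    \<comment> \<open>A tail lies in a cost ball and so has a convergent subsequence. The Cauchy
      property carries the whole sequence to the same limit, through the characterization of
      convergence by \<open>c (t n) l\<close>.\<close>
    obtain N where N: "\<And>m n. m \<ge> N \<Longrightarrow> n \<ge> N \<Longrightarrow> D (s m) (s n) < 1" using Cauchy[of 1] by auto
    define t where "t n = s (n + N)" for n
    have "c (s N) (t n) \<le> 1" for n using N[of N "n + N"] c_le_D(1)[of "s N" "t n"] by (simp add: t_def)
    then obtain l \<phi> where \<phi>: "strict_mono (\<phi> :: nat \<Rightarrow> nat)" "(\<lambda>n. t (\<phi> n)) \<longlonglongrightarrow> l"
      by (rule bounded_subsequence)
    have "(\<lambda>n. c (t n) l) \<longlonglongrightarrow> 0"
    proof (rule LIMSEQ_I)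
      fix e :: real assume e: "0 < e"
      then obtain M where M: "\<And>m n. m \<ge> M \<Longrightarrow> n \<ge> M \<Longrightarrow> D (s m) (s n) < e / 2" using Cauchy[of "e / 2"] by auto
      have "c (t n) l \<le> e / 2" if n: "n \<ge> M" for n
      proof (rule LIMSEQ_le_const2)
        show "(\<lambda>m. c (t n) (t (\<phi> m))) \<longlonglongrightarrow> c (t n) l" by (intro tendsto_c tendsto_const \<phi>(2))
        have "c (t n) (t (\<phi> m)) \<le> e / 2" if "m \<ge> M" for m
          using M[of "n + N" "\<phi> m + N"] c_le_D(1)[of "t n" "t (\<phi> m)"] n that seq_suble[OF \<phi>(1), of m] by (simp add: t_def)
        then show "\<exists>M. \<forall>m\<ge>M. c (t n) (t (\<phi> m)) \<le> e / 2" by blast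
      qed
      then show "\<exists>M. \<forall>n\<ge>M. norm (c (t n) l - 0) < e"
        using e c_nonneg by (intro exI[of _ M]) (force simp: abs_of_nonneg)
    qed
    then have "t \<longlonglongrightarrow> l" by (simp add: c_left_iff)
    then have "s \<longlonglongrightarrow> l" unfolding t_def by (rule LIMSEQ_offset)
    then show ?thesis by (auto simp: convergent_def)
  qed
qed

lemma transport_cost_le_W: "transport_cost c \<mu> \<nu> \<le> W \<mu> \<nu>"
  unfolding transport_cost_def by (intro INF_mono' nn_integral_mono) (auto intro!: ennreal_leI c_le_D)

text \<open>\<open>D\<close> is bounded by an affine function of the cost, and constants have finite
  integral under a coupling. Thus the class of finite cost can be described through
  \<open>W\<close>.\<close>

lemma W_finite_iff: "W \<mu> \<nu> < \<infinity> \<longleftrightarrow> transport_cost c \<mu> \<nu> < \<infinity>"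
proof
  assume "transport_cost c \<mu> \<nu> < \<infinity>"
  then obtain \<gamma> where \<gamma>: "\<gamma> \<in> couplings \<mu> \<nu>" and less: "(\<integral>\<^sup>+p. ennreal (c (fst p) (snd p)) \<partial>\<gamma>) < \<infinity>"
    by (rule transport_cost_lessE)
  interpret \<gamma>: prob_space \<gamma> using \<gamma> by (rule couplingsD)
  note [measurable_cong] = sets_coupling[OF \<gamma>]
  have [measurable]: "(\<lambda>p. c (fst p) (snd p)) \<in> borel_measurable (borel \<Otimes>\<^sub>M borel)"
    unfolding borel_prod using c_cont by (intro borel_measurable_continuous_onI) (simp add: case_prod_unfold)
  have "W \<mu> \<nu> \<le> (\<integral>\<^sup>+p. ennreal (D (fst p) (snd p)) \<partial>\<gamma>)" by (rule transport_cost_le[OF \<gamma>])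
  also have "\<dots> \<le> (\<integral>\<^sup>+p. ennreal (1 + A) + ennreal (1 + B) * ennreal (c (fst p) (snd p)) \<partial>\<gamma>)"
  proof (rule nn_integral_mono)
    fix p
    have "ennreal (D (fst p) (snd p)) \<le> ennreal ((1 + A) + (1 + B) * c (fst p) (snd p))"
      by (rule ennreal_leI[OF D_le_c])
    also have "\<dots> = ennreal (1 + A) + ennreal (1 + B) * ennreal (c (fst p) (snd p))"
      using AB c_nonneg by (subst ennreal_plus) (auto simp: ennreal_mult simp del: ennreal_plus)
    finally show "ennreal (D (fst p) (snd p)) \<le> \<dots>" .
  qed
  also have "\<dots> = ennreal (1 + A) + ennreal (1 + B) * (\<integral>\<^sup>+p. ennreal (c (fst p) (snd p)) \<partial>\<gamma>)"
    by (simp add: nn_integral_add nn_integral_cmult \<gamma>.emeasure_space_1 del: ennreal_plus)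
  also have "\<dots> < \<infinity>" using less by (simp add: ennreal_mult_less_top del: ennreal_plus)
  finally show "W \<mu> \<nu> < \<infinity>" .
qed (rule le_less_trans[OF transport_cost_le_W])

text \<open>On the class all values of \<open>W\<close> are finite, so the metrization theorem
  applies to their real versions. Radonness is obtained for the resulting metric and transferred by
  equality of the topologies.\<close>

lemma finite_cost_class_radon_space:
  assumes \<mu>\<^sub>0: "\<mu>\<^sub>0 \<in> prob_measures"
  shows "radon_space (subtopology (transport_topology c) (finite_cost_class c \<mu>\<^sub>0))"
proof -
  define E where "E = finite_cost_class c \<mu>\<^sub>0"
  have E_iff: "\<nu> \<in> E \<longleftrightarrow> \<nu> \<in> prob_measures \<and> W \<mu>\<^sub>0 \<nu> < \<infinity>" for \<nu>
    unfolding E_def finite_cost_class_def mem_Collect_eq W_finite_iff ..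
  have E_prob: "\<nu> \<in> prob_measures" if "\<nu> \<in> E" for \<nu> using that by (simp add: E_iff)
  have K2: "1 \<le> K^2" using K_ge_1 by simp
  have fin: "W \<mu> \<nu> < \<infinity>" if "\<mu> \<in> E" "\<nu> \<in> E" for \<mu> \<nu>
  proof -
    have "W \<mu> \<nu> \<le> ennreal (K^2) * (W \<mu> \<mu>\<^sub>0 + W \<mu>\<^sub>0 \<nu>)" by (rule W_tri)
    also have "\<dots> < \<infinity>" using that by (simp add: E_iff W_sym[of \<mu>] ennreal_mult_less_top)
    finally show ?thesis .
  qed
  define q where "q \<mu> \<nu> = enn2real (W \<mu> \<nu>)" for \<mu> \<nu>
  have q: "W \<mu> \<nu> = ennreal (q \<mu> \<nu>)" if "\<mu> \<in> E" "\<nu> \<in> E" for \<mu> \<nu>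
    using fin[OF that] by (simp add: q_def)
  have q0: "0 \<le> q \<mu> \<nu>" for \<mu> \<nu> by (simp add: q_def)
  have q_sym: "q \<mu> \<nu> = q \<nu> \<mu>" for \<mu> \<nu> by (simp add: q_def W_sym[of \<mu> \<nu>])
  have q_zero: "q \<mu> \<nu> = 0 \<longleftrightarrow> \<mu> = \<nu>" if "\<mu> \<in> E" "\<nu> \<in> E" for \<mu> \<nu>
    using W_eq_0_iff[OF E_prob[OF that(1)] E_prob[OF that(2)]] q0[of \<mu> \<nu>] unfolding q[OF that] by simp
  have q_tri: "q \<mu> \<xi> \<le> K^2 * (q \<mu> \<nu> + q \<nu> \<xi>)" if "\<mu> \<in> E" "\<nu> \<in> E" "\<xi> \<in> E" for \<mu> \<nu> \<xi>
  proof -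
    have "ennreal (q \<mu> \<xi>) \<le> ennreal (K^2 * (q \<mu> \<nu> + q \<nu> \<xi>))"
      using W_tri[of \<mu> \<xi> \<nu>] q0 that by (simp add: q ennreal_mult ennreal_plus)
    then show ?thesis using q0 K2 by (subst (asm) ennreal_le_iff) auto
  qed
  obtain m s where m: "Metric_space E m" and s: "0 < s"
    and m_le: "\<forall>\<mu>\<in>E. \<forall>\<nu>\<in>E. m \<mu> \<nu> \<le> q \<mu> \<nu> powr s" and m_ge: "\<forall>\<mu>\<in>E. \<forall>\<nu>\<in>E. q \<mu> \<nu> powr s \<le> 2 * m \<mu> \<nu>"
    using quasi_metric_metrizable[of E q "K^2", OF q0 q_sym q_zero q_tri K2] .
  interpret E: Metric_space E m by (rule m)
  \<comment> \<open>This and the converse comparison have moduli uniform over \<open>E\<close>; that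
    is what transfers Cauchy sequences as well as neighbourhoods between \<open>m\<close> and
    \<open>W\<close>.\<close>
  have m_small: "\<exists>\<delta>>0. \<forall>\<mu>\<in>E. \<forall>\<nu>\<in>E. W \<mu> \<nu> < ennreal \<delta> \<longrightarrow> m \<mu> \<nu> < e" if e: "0 < e" for e
  proof (intro exI[of _ "e powr (1 / s)"] conjI ballI impI)
    fix \<mu> \<nu> assume E: "\<mu> \<in> E" "\<nu> \<in> E" and "W \<mu> \<nu> < ennreal (e powr (1 / s))"
    then have "q \<mu> \<nu> < e powr (1 / s)" using q0 by (simp add: q[OF E] ennreal_less_iff)
    then have "q \<mu> \<nu> powr s < (e powr (1 / s)) powr s" using q0 s by (intro powr_less_mono2) auto
    also have "\<dots> = e" using s e by (simp add: powr_powr)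
    finally show "m \<mu> \<nu> < e" using m_le E by force
  qed (use e in simp)
  have W_small: "\<exists>\<delta>>0. \<forall>\<mu>\<in>E. \<forall>\<nu>\<in>E. m \<mu> \<nu> < \<delta> \<longrightarrow> W \<mu> \<nu> < ennreal e" if e: "0 < e" for e
  proof (intro exI[of _ "e powr s / 2"] conjI ballI impI)
    fix \<mu> \<nu> assume E: "\<mu> \<in> E" "\<nu> \<in> E" and "m \<mu> \<nu> < e powr s / 2"
    then have "q \<mu> \<nu> powr s < e powr s" using m_ge E by force
    then have "q \<mu> \<nu> < e" using powr_mono2[of s e "q \<mu> \<nu>"] e s by (force simp: not_less)
    then show "W \<mu> \<nu> < ennreal e" using q0 by (simp add: q[OF E] ennreal_less_iff)
  qed (use e in simp)

  have complete: E.mcomplete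
    unfolding E.mcomplete_def
  proof (intro allI impI)
    fix \<sigma> assume \<sigma>: "E.MCauchy \<sigma>"
    then have \<sigma>E: "\<sigma> n \<in> E" for n by (auto simp: E.MCauchy_def)
    have "\<exists>N. \<forall>i\<ge>N. \<forall>j\<ge>N. W (\<sigma> i) (\<sigma> j) < ennreal ((1 / (2 * K)) ^ n)" for n
    proof -
      have "0 < (1 / (2 * K)) ^ n" using K_ge_1 by simp
      then obtain \<delta> where \<delta>: "0 < \<delta>" "\<forall>\<mu>\<in>E. \<forall>\<nu>\<in>E. m \<mu> \<nu> < \<delta> \<longrightarrow> W \<mu> \<nu> < ennreal ((1 / (2 * K)) ^ n)"
        using W_small by blast
      then show ?thesis using \<sigma> \<sigma>E unfolding E.MCauchy_def by meson
    qed
    then obtain N where N: "\<And>n i j. i \<ge> N n \<Longrightarrow> j \<ge> N n \<Longrightarrow> W (\<sigma> i) (\<sigma> j) < ennreal ((1 / (2 * K)) ^ n)"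
      by metis
    \<comment> \<open>The sum dominates \<open>N n\<close>, and the summand \<open>n\<close> makes
      the indices strictly increasing.\<close>
    define r where "r n = (\<Sum>i\<le>n. N i) + n" for n
    have r: "strict_mono r" by (auto simp: r_def strict_mono_Suc_iff)
    have r_N: "N n \<le> r n" for n
      using member_le_sum[of n "{..n}" N] by (simp add: r_def)
    have "W (\<sigma> (r n)) (\<sigma> (r (Suc n))) < ennreal ((1 / (2 * K)) ^ n)" for n
      using r_N[of n] strict_monoD[OF r, of n "Suc n"] by (intro N) auto
    then obtain \<xi> where \<xi>: "\<xi> \<in> prob_measures" "\<forall>n. W (\<sigma> (r n)) \<xi> \<le> ennreal (2 * K^2 * (1 / 2) ^ n)"
      using W_fast_Cauchy_limit[of "\<lambda>n. \<sigma> (r n)"] E_prob[OF \<sigma>E] by metis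
    have "\<xi> \<in> E"
    proof -
      have "W \<mu>\<^sub>0 \<xi> \<le> ennreal (K^2) * (W \<mu>\<^sub>0 (\<sigma> (r 0)) + W (\<sigma> (r 0)) \<xi>)" by (rule W_tri)
      also have "\<dots> < \<infinity>"
        using \<sigma>E[of "r 0"] \<xi>(2)[rule_format, of 0]
        by (auto simp: E_iff ennreal_mult_less_top intro: le_less_trans)
      finally show ?thesis using \<xi>(1) by (simp add: E_iff)
    qed
    have "limitin E.mtopology (\<sigma> \<circ> r) \<xi> sequentially"
      unfolding E.limitin_metric
    proof (intro conjI allI impI \<open>\<xi> \<in> E\<close>)
      fix e :: real assume "0 < e"
      then obtain \<delta> where \<delta>: "0 < \<delta>" "\<forall>\<mu>\<in>E. \<forall>\<nu>\<in>E. W \<mu> \<nu> < ennreal \<delta> \<longrightarrow> m \<mu> \<nu> < e"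
        using m_small by blast
      have "(\<lambda>n. 2 * K^2 * (1 / 2) ^ n) \<longlonglongrightarrow> 2 * K^2 * 0"
        by (intro tendsto_mult tendsto_const LIMSEQ_power_zero) simp
      then have "\<forall>\<^sub>F n in sequentially. 2 * K^2 * (1 / 2) ^ n < \<delta>"
        using \<delta>(1) by (intro order_tendstoD(2)) auto
      then show "\<forall>\<^sub>F n in sequentially. (\<sigma> \<circ> r) n \<in> E \<and> m ((\<sigma> \<circ> r) n) \<xi> < e"
      proof eventually_elim
        case (elim n)
        then have "ennreal (2 * K^2 * (1 / 2) ^ n) < ennreal \<delta>" by (intro ennreal_lessI) (use \<delta> in auto)
        then have "W (\<sigma> (r n)) \<xi> < ennreal \<delta>" using \<xi>(2) by (blast intro: le_less_trans)
        then show ?case using \<delta>(2) \<sigma>E \<open>\<xi> \<in> E\<close> by simp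
      qed
    qed
    then show "\<exists>x. limitin E.mtopology \<sigma> x sequentially"
      using E.MCauchy_convergent_subsequence[OF \<sigma> r] by blast
  qed

  have "\<exists>C. countable C \<and> C \<subseteq> {\<nu>. W \<mu>\<^sub>0 \<nu> < \<infinity>} \<and> (\<forall>\<nu>. W \<mu>\<^sub>0 \<nu> < \<infinity> \<longrightarrow> (\<exists>\<xi>\<in>C. W \<nu> \<xi> < ennreal (1 / real (Suc n))))" for n
  proof -
    have pos: "0 < 1 / real (Suc n)" by simp
    obtain C where "countable C" "C \<subseteq> {\<nu>. W \<mu>\<^sub>0 \<nu> < \<infinity>}"
      "\<forall>\<nu>. W \<mu>\<^sub>0 \<nu> < \<infinity> \<longrightarrow> (\<exists>\<xi>\<in>C. W \<nu> \<xi> < ennreal (1 / real (Suc n)))"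
      using W_countable_net[OF pos, of \<mu>\<^sub>0] .
    then show ?thesis by (intro exI[of _ C] conjI)
  qed
  then obtain C where C: "\<And>n. countable (C n)" "\<And>n. C n \<subseteq> {\<nu>. W \<mu>\<^sub>0 \<nu> < \<infinity>}"
    "\<And>n \<nu>. W \<mu>\<^sub>0 \<nu> < \<infinity> \<Longrightarrow> \<exists>\<xi>\<in>C n. W \<nu> \<xi> < ennreal (1 / real (Suc n))"
    by metis
  \<comment> \<open>The nets are described by finite cost only. Finiteness provides a coupling,
    whose marginal is a probability measure; over the empty set of couplings the infimum would be
    infinite.\<close>
  have C_E: "C n \<subseteq> E" for n
  proof
    fix \<nu> assume "\<nu> \<in> C n"
    then have W: "W \<mu>\<^sub>0 \<nu> < \<infinity>" using C(2) by blast
    then obtain \<gamma> where "\<gamma> \<in> couplings \<mu>\<^sub>0 \<nu>" by (rule transport_cost_lessE)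
    then show "\<nu> \<in> E" using W couplings_prob_measures(2) by (auto simp: E_iff)
  qed
  have dense: "\<exists>\<xi>\<in>\<Union>n. C n. m \<xi> \<nu> < e" if \<nu>: "\<nu> \<in> E" and e: "0 < e" for \<nu> e
  proof -
    obtain \<delta> where \<delta>: "0 < \<delta>" "\<forall>\<mu>\<in>E. \<forall>\<nu>\<in>E. W \<mu> \<nu> < ennreal \<delta> \<longrightarrow> m \<mu> \<nu> < e"
      using m_small[OF e] by blast
    obtain n where n: "1 / real (Suc n) < \<delta>" using nat_approx_posE[OF \<delta>(1)] by blast
    obtain \<xi> where \<xi>: "\<xi> \<in> C n" "W \<nu> \<xi> < ennreal (1 / real (Suc n))" using C(3)[of \<nu> n] \<nu> by (auto simp: E_iff)
    have "W \<nu> \<xi> < ennreal \<delta>" using \<xi>(2) n by (meson ennreal_leI less_imp_le less_le_trans)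
    then have "m \<nu> \<xi> < e" using \<delta>(2) \<nu> C_E \<xi>(1) by blast
    then show ?thesis using \<xi>(1) E.commute[of \<nu> \<xi>] by auto
  qed
  have radon: "radon_space E.mtopology"
    by (rule E.complete_separable_imp_radon_space[OF complete, of "\<Union>n. C n"]) (use C(1) C_E dense in auto)

  have ball_open: "openin (transport_topology c) (transport_ball c \<mu> r)" if "\<mu> \<in> prob_measures" "0 < r" for \<mu> r
    unfolding transport_topology_def using that by (intro topology_generated_by_Basis) auto
  have J_refl: "transport_cost c \<mu> \<mu> = 0" if "\<mu> \<in> prob_measures" for \<mu>
    using transport_cost_le_W[of \<mu> \<mu>] W_refl[OF that] by simp
  have "E.mtopology = subtopology (transport_topology c) E"
    unfolding topology_eq
  proof (intro allI iffI)
    fix U assume U: "openin E.mtopology U"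
    have "\<exists>V. openin (subtopology (transport_topology c) E) V \<and> \<nu> \<in> V \<and> V \<subseteq> U" if \<nu>U: "\<nu> \<in> U" for \<nu>
    proof -
      have \<nu>: "\<nu> \<in> E" using U \<nu>U unfolding E.openin_mtopology by blast
      obtain e where e: "0 < e" "E.mball \<nu> e \<subseteq> U" using U \<nu>U unfolding E.openin_mtopology by blast
      obtain d1 where d1: "0 < d1" "\<forall>\<mu>\<in>E. \<forall>\<nu>\<in>E. W \<mu> \<nu> < ennreal d1 \<longrightarrow> m \<mu> \<nu> < e"
        using m_small[OF e(1)] by blast
      obtain d2 where d2: "0 < d2" "\<And>\<xi>. transport_cost c \<nu> \<xi> < ennreal d2 \<Longrightarrow> W \<nu> \<xi> < ennreal d1"
      proof (rule W_small_of_cost_small[OF c_nonneg c_cont D_le_c _ _ E_prob[OF \<nu>] d1(1)])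
        show "s \<longlonglongrightarrow> x" if "(\<lambda>n. c x (s n)) \<longlonglongrightarrow> 0" for x s using that by (simp add: c_right_iff)
      qed (use AB in auto)
      let ?V = "transport_ball c \<nu> d2 \<inter> E"
      have "openin (subtopology (transport_topology c) E) ?V"
        unfolding openin_subtopology using ball_open[OF E_prob[OF \<nu>] d2(1)] by blast
      moreover have "\<nu> \<in> ?V" using \<nu> E_prob[OF \<nu>] d2(1) by (simp add: transport_ball_def J_refl)
      moreover have "?V \<subseteq> U"
      proof
        fix \<xi> assume "\<xi> \<in> ?V"
        then have "\<xi> \<in> E" "m \<nu> \<xi> < e" using d1(2) d2(2) \<nu> by (auto simp: transport_ball_def)
        then show "\<xi> \<in> U" using e(2) \<nu> by (auto simp: E.in_mball)
      qed
      ultimately show ?thesis by blast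
    qed
    then show "openin (subtopology (transport_topology c) E) U" by (subst openin_subopen) blast
  next
    fix U assume "openin (subtopology (transport_topology c) E) U"
    then obtain V where V: "openin (transport_topology c) V" "U = V \<inter> E" by (auto simp: openin_subtopology)
    have "continuous_map E.mtopology (transport_topology c) (\<lambda>\<nu>. \<nu>)"
      unfolding transport_topology_def
    proof (rule continuous_on_generated_topo)
      fix V assume "V \<in> {transport_ball c \<mu> r |\<mu> r. \<mu> \<in> prob_measures \<and> 0 < r}"
      then obtain \<mu> r where V: "V = transport_ball c \<mu> r" by blast
      \<comment> \<open>The generating balls have arbitrary centres \<mu>, while a neighbourhood of
        each member \<nu> is required. Upper semicontinuity of the cost from \<mu> provides it in
        place of a triangle inequality.\<close>
      have "\<exists>e>0. E.mball \<nu> e \<subseteq> V \<inter> E" if \<nu>: "\<nu> \<in> V \<inter> E" for \<nu>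
      proof -
        have less: "transport_cost c \<mu> \<nu> < ennreal r" using \<nu> by (simp add: V transport_ball_def)
        obtain d where d: "0 < d" "\<And>\<xi>. W \<nu> \<xi> < ennreal d \<Longrightarrow> transport_cost c \<mu> \<xi> < ennreal r"
        proof (rule cost_upper_semicontinuous[OF c_nonneg c_cont _ AB less])
          fix x y z
          have "B * c y z \<le> B * D y z" using AB c_le_D(1) by (intro mult_left_mono)
          then show "c x z \<le> A + B * c x y + B * D y z"
            using growth_right[of x z y] by (simp add: distrib_left)
        qed blast
        obtain e where e: "0 < e" "\<forall>\<mu>\<in>E. \<forall>\<nu>\<in>E. m \<mu> \<nu> < e \<longrightarrow> W \<mu> \<nu> < ennreal d"
          using W_small[OF d(1)] by blast
        have "E.mball \<nu> e \<subseteq> V \<inter> E"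
          using e(2) d(2) E_prob by (auto simp: E.in_mball V transport_ball_def)
        with e(1) show ?thesis by blast
      qed
      then have "openin E.mtopology (V \<inter> E)" unfolding E.openin_mtopology by blast
      moreover have "(\<lambda>\<nu>. \<nu>) -` V \<inter> topspace E.mtopology = V \<inter> E" by simp
      ultimately show "openin E.mtopology ((\<lambda>\<nu>. \<nu>) -` V \<inter> topspace E.mtopology)" by simp
    next
      show "(\<lambda>\<nu>. \<nu>) ` topspace E.mtopology \<subseteq> \<Union> {transport_ball c \<mu> r |\<mu> r. \<mu> \<in> prob_measures \<and> 0 < r}"
      proof
        fix \<nu> assume "\<nu> \<in> (\<lambda>\<nu>. \<nu>) ` topspace E.mtopology"
        then have "\<nu> \<in> prob_measures" using E_prob by simp
        then have "\<nu> \<in> transport_ball c \<nu> 1" by (simp add: transport_ball_def J_refl)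
        with \<open>\<nu> \<in> prob_measures\<close> show "\<nu> \<in> \<Union> {transport_ball c \<mu> r |\<mu> r. \<mu> \<in> prob_measures \<and> 0 < r}"
          using zero_less_one by blast
      qed
    qed
    from openin_continuous_map_preimage[OF this V(1)] have "openin E.mtopology {\<nu> \<in> E. \<nu> \<in> V}" by simp
    moreover have "{\<nu> \<in> E. \<nu> \<in> V} = U" using V(2) by blast
    ultimately show "openin E.mtopology U" by simp
  qed
  with radon show ?thesis by (simp add: E_def)
qed

end

theorem theorem3p17:
  fixes c :: "'a::{metric_space, second_countable_topology} \<Rightarrow> 'a \<Rightarrow> real"
    and \<mu>\<^sub>0 :: "'a measure"
  assumes "radon_space (euclidean :: 'a topology)"
    and "\<And>x y. c x y \<ge> 0"
    and "continuous_on UNIV (\<lambda>(x, y). c x y)"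
    and "consistent_cost c"
    and "cost_growth c"
    and "\<exists>x\<^sub>0. \<forall>r\<ge>0. compact {y. c x\<^sub>0 y \<le> r}"
    and "\<mu>\<^sub>0 \<in> prob_measures"
  shows "radon_space (subtopology (transport_topology c) (finite_cost_class c \<mu>\<^sub>0))"
proof -
  obtain A B where "0 \<le> A" "0 \<le> B" and "\<forall>x y z. c x y \<le> A + B * (c x z + c y z) \<and>
      c x y \<le> A + B * (c x z + c z y) \<and> c x y \<le> A + B * (c z x + c y z) \<and> c x y \<le> A + B * (c z x + c z y)"
    using assms(5) unfolding cost_growth_def by blast
  with assms interpret growth_cost c A B
    by unfold_locales blast+
  show ?thesis using assms(7) by (rule finite_cost_class_radon_space)
qed

end
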